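(* Let $\delta>0$. There is a constant $C=C(\delta)$ such that the following holds. Let $n\ge 1$, let $m\ge 3\exp((\ln n)^{1/4})$, and let $A$ be an $n\times n$ symmetric matrix of complex numbers such that at least $mn$ of the entries of $A$ are nonzero. Let $L$ be an arbitrary linear form in $n$ variables, and let $x$ be a random vector of length $n$ with entries chosen uniformly and independently from $\{1,-1\}$. Then $$\sup_{c}\ \mathbf{P}\left(x^TAx=L(x)+c\right)\ \le\ C\, m^{-1/2+\delta}.$$
   Context: Here $L(x)=\sum_i \ell_i x_i$ with arbitrary complex coefficients $\ell_i$, and the supremum is over all complex constants $c$. "Symmetric" means $A^T=A$. *)

theory Defs
  imports "HOL-Probability.Probability" "Jordan_Normal_Form.Matrix"
begin

definition rademacher_vec :: "nat \<Rightarrow> complex Matrix.vec pmf" where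
  "rademacher_vec n =
     map_pmf (Matrix.vec n) (Pi_pmf {..<n} 0 (\<lambda>_. pmf_of_set {1, -1}))"

text \<open>The scalar product of \<^theory>\<open>Jordan_Normal_Form.Matrix\<close> is bilinear: no complex
  conjugation is involved, also over the complex numbers.\<close>

definition quadratic_form :: "complex mat \<Rightarrow> complex Matrix.vec \<Rightarrow> complex" where
  "quadratic_form A x = scalar_prod x (A *\<^sub>v x)"

definition linear_form :: "complex Matrix.vec \<Rightarrow> complex Matrix.vec \<Rightarrow> complex" where
  "linear_form l x = scalar_prod l x"

definition nonzero_entries :: "complex mat \<Rightarrow> (nat \<times> nat) set" where
  "nonzero_entries A = {(i, j). i < dim_row A \<and> j < dim_col A \<and> A $$ (i, j) \<noteq> 0}"

end

theory Submission
  imports Defs "HOL-Library.Function_Algebras"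
begin

text \<open>
  Since an off-diagonal entry outside a maximal matching touches a matched vertex, there is a matching
  of size \<open>r \<ge> m / 6\<close> among the nonzero entries. If many disjoint square blocks of \<open>A\<close> of size about
  \<open>log r\<close> are nonsingular, split the variables as \<open>(y, z)\<close> and use \<open>n + 1\<close> independent copies of \<open>y\<close>:
  \<open>P\<^sup>n\<^sup>+\<^sup>1\<close> is at most the probability that \<open>z\<close> solves \<open>n\<close> linear equations whose coefficients are, by
  Odlyzko's lemma, robustly independent; Halasz' inequality bounds it by \<open>r\<^sup>-\<^sup>n\<^sup>/\<^sup>2\<close> up to \<open>r\<^sup>o\<^sup>(\<^sup>1\<^sup>)\<close>.

  Otherwise, on most of the matching, \<open>A\<close> agrees off the diagonal with a matrix of rank \<open>O(log r)\<close>,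
  and the quadratic function is a quadratic polynomial in few linear forms that can be made robustly
  independent. For such functions one bounds the probability \<open>e j\<close> of the intersection of the quadric with a
  flat of codimension \<open>j\<close>: if the quadric contains a hyperplane of the flat, it is the union of two
  hyperplanes; if not, a Cauchy--Schwarz step in the variables \<open>(y, z)\<close> yields one more linear equation for
  \<open>z\<close>, while the quadratic equation is kept. Hence \<open>e j \<le> r\<^sup>-\<^sup>j\<^sup>/\<^sup>4 \<surd>(e (j + 1))\<close> up to a constant, and
  stopping at \<open>e n \<le> r\<^sup>-\<^sup>n\<^sup>/\<^sup>2\<close> gives \<open>e 0 \<le> r\<^sup>-\<^sup>1\<^sup>/\<^sup>2\<^sup>+\<^sup>\<epsilon>\<close> with \<open>\<epsilon> = 2\<^sup>-\<^sup>n\<^sup>-\<^sup>1\<close>.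
\<close>

section \<open>Concentration of random walks with given steps\<close>

text \<open>"Robustly independent" means independent on each of 2^t disjoint sets of variables, with
  2^t nearly r; this is what gives k linear equations the probability 2^(-tk/2). Decoupling with two
  copies costs a square root and yields only r^(-1/4); with n + 1 copies the exponent is n/(2(n +
  1)), which tends to 1/2. Several copies help only if their differences yield independent
  equations. Odlyzko's lemma ensures this when the blocks are large: its failure probability 2^(-(s
  - n)) has to beat the union bound over 2^t blocks and the target r^(-n/2), hence the block size s
  of order log r. For low rank this fails, and the square root is recovered differently: since the
  quadratic equation is never given up, each step gains a linear equation, and the recursion for the
  exponents has the fixed point (j + 1)/2 in codimension j. Polylogarithmic losses, such as the
  deletion of about s^2 2^t variables, are absorbed by taking 2^t about r^(1/(1 +
  \<delta>)).\<close>

fun walk_avg :: "'g::ab_group_add list \<Rightarrow> ('g \<Rightarrow> real) \<Rightarrow> real" where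
  "walk_avg [] F = F 0"
| "walk_avg (w # ws) F = (walk_avg ws (\<lambda>a. F (a + w)) + walk_avg ws (\<lambda>a. F (a - w))) / 2"

text \<open>The point mass at \<open>c\<close> of the sum of all steps with independent uniform
  signs. Recursion over the list of steps keeps probability spaces out of the argument.\<close>

definition conc :: "'g::ab_group_add list \<Rightarrow> 'g \<Rightarrow> real" where
  "conc ws c = walk_avg ws (\<lambda>a. of_bool (a = c))"

lemma walk_avg_append:
  "walk_avg (us @ vs) F = walk_avg us (\<lambda>a. walk_avg vs (\<lambda>b. F (a + b)))"
proof (induction us arbitrary: F)
  case (Cons u us)
  show ?case
    by (simp add: Cons.IH algebra_simps)
qed simp

lemma walk_avg_mono: "(\<And>a. F a \<le> G a) \<Longrightarrow> walk_avg ws F \<le> walk_avg ws G"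
proof (induction ws arbitrary: F G)
  case (Cons w ws)
  have "walk_avg ws (\<lambda>a. F (a + w)) \<le> walk_avg ws (\<lambda>a. G (a + w))"
    "walk_avg ws (\<lambda>a. F (a - w)) \<le> walk_avg ws (\<lambda>a. G (a - w))"
    using Cons by auto
  then show ?case by simp
qed simp

lemma walk_avg_const [simp]: "walk_avg ws (\<lambda>_. r) = r"
  by (induction ws) auto

lemma walk_avg_cmult: "walk_avg ws (\<lambda>a. r * F a) = r * walk_avg ws F"
proof (induction ws arbitrary: F)
  case (Cons w ws)
  show ?case by (simp add: Cons.IH algebra_simps)
qed simp

lemma walk_avg_map:
  assumes "\<And>a b. p (a + b) = p a + p b"
  shows "walk_avg (map p ws) F = walk_avg ws (\<lambda>a. F (p a))"
proof -
  have p0: "p 0 = 0" using assms[of 0 0] by simp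
  have pm: "p (a - b) = p a - p b" for a b using assms[of "a - b" b] by (simp add: eq_diff_eq)
  show ?thesis
    by (induction ws arbitrary: F) (auto simp: p0 pm assms)
qed

text \<open>Once the recursion is a fold of commuting operators, invariance under reordering of the
  steps becomes an instance of a fact about folds and multisets.\<close>

lemma walk_avg_foldr:
  "walk_avg ws F = foldr (\<lambda>w H F. (H (\<lambda>a. F (a + w)) + H (\<lambda>a. F (a - w))) / 2) ws (\<lambda>F. F 0) F"
  by (induction ws arbitrary: F) simp_all

lemma walk_avg_mset: "mset us = mset vs \<Longrightarrow> walk_avg us F = walk_avg vs F"
proof -
  assume *: "mset us = mset vs"
  let ?T = "\<lambda>(w::'a) (H::('a \<Rightarrow> real) \<Rightarrow> real) F. (H (\<lambda>a. F (a + w)) + H (\<lambda>a. F (a - w))) / 2"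
  have c: "?T x \<circ> ?T y = ?T y \<circ> ?T x" for x y
  proof (rule ext)+
    fix H :: "('a \<Rightarrow> real) \<Rightarrow> real" and F
    have e: "a + y + x = a + x + y" "a - y + x = a + x - y"
      "a + y - x = a - x + y" "a - y - x = a - x - y" for a
      by (simp_all add: algebra_simps)
    show "(?T x \<circ> ?T y) H F = (?T y \<circ> ?T x) H F"
      by (simp only: o_def e[symmetric]) argo
  qed
  have "fold ?T (rev us) = fold ?T (rev vs)"
    by (rule fold_multiset_equiv) (rule c, simp add: *)
  then show ?thesis
    unfolding walk_avg_foldr foldr_conv_fold by simp
qed

lemma conc_nonneg: "0 \<le> conc ws c"
  using walk_avg_mono[of "\<lambda>_. 0" "\<lambda>a. of_bool (a = c)" ws] by (simp add: conc_def)

lemma conc_le_one: "conc ws c \<le> 1"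
  using walk_avg_mono[of "\<lambda>a. of_bool (a = c)" "\<lambda>_. 1" ws] by (simp add: conc_def)

lemma conc_mset: "mset us = mset vs \<Longrightarrow> conc us c = conc vs c"
  unfolding conc_def by (rule walk_avg_mset)

lemma conc_append: "conc (us @ vs) c = walk_avg us (\<lambda>a. conc vs (c - a))"
  unfolding conc_def walk_avg_append by (simp add: eq_diff_eq add.commute)

text \<open>The extra steps only average the point masses of the first walk over shifted
  targets.\<close>

lemma conc_append_le:
  assumes "\<And>c. conc us c \<le> e"
  shows "conc (us @ vs) c \<le> e"
proof -
  have "conc (us @ vs) c = conc (vs @ us) c" by (rule conc_mset) simp
  also have "\<dots> \<le> walk_avg vs (\<lambda>_. e)" unfolding conc_append by (rule walk_avg_mono) (rule assms)
  finally show ?thesis by simp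
qed

lemma conc_le_map:
  assumes "\<And>a b. p (a + b) = p a + p b"
  shows "conc ws c \<le> conc (map p ws) (p c)"
  unfolding conc_def walk_avg_map[of p, OF assms] by (rule walk_avg_mono) auto

lemma conc_replicate_zero: "conc (replicate N 0) c = of_bool (c = 0)"
  by (induction N) (auto simp: conc_def)

text \<open>A finite set containing all end points. It turns averages into finite sums over the
  group, to which Cauchy--Schwarz applies.\<close>

fun walk_supp :: "'g::ab_group_add list \<Rightarrow> 'g set" where
  "walk_supp [] = {0}"
| "walk_supp (w # ws) = (\<lambda>a. a + w) ` walk_supp ws \<union> (\<lambda>a. a - w) ` walk_supp ws"

lemma finite_walk_supp [simp]: "finite (walk_supp ws)"
  by (induction ws) auto

lemma conc_Nil: "conc [] c = of_bool (c = 0)"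
  by (auto simp: conc_def)

lemma conc_Cons: "conc (w # ws) c = (conc ws (c - w) + conc ws (c + w)) / 2"
  unfolding conc_def by (simp add: eq_diff_eq diff_eq_eq)

lemma walk_avg_sum:
  "finite A \<Longrightarrow> walk_supp ws \<subseteq> A \<Longrightarrow> walk_avg ws F = (\<Sum>a\<in>A. conc ws a * F a)"
proof (induction ws arbitrary: A F)
  case Nil
  then have "(\<Sum>a\<in>A. conc [] a * F a) = (\<Sum>a\<in>{0}. conc [] a * F a)"
    by (intro sum.mono_neutral_right) (auto simp: conc_Nil)
  then show ?case by (simp add: conc_Nil)
next
  case (Cons w ws)
  have s1: "(\<Sum>a\<in>A. conc ws (a - w) * F a) = walk_avg ws (\<lambda>a. F (a + w))"
  proof -
    have "(\<Sum>a\<in>A. conc ws (a - w) * F a) = (\<Sum>a\<in>(\<lambda>a. a - w) ` A. conc ws a * F (a + w))"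
      by (subst sum.reindex) (auto simp: inj_on_def)
    also have "\<dots> = walk_avg ws (\<lambda>a. F (a + w))"
    proof (rule Cons.IH[symmetric])
      show "walk_supp ws \<subseteq> (\<lambda>a. a - w) ` A"
      proof
        fix a assume "a \<in> walk_supp ws"
        then have "a + w \<in> A" using Cons.prems by auto
        then have "(a + w) - w \<in> (\<lambda>a. a - w) ` A" by (rule imageI)
        then show "a \<in> (\<lambda>a. a - w) ` A" by simp
      qed
    qed (use Cons.prems in simp)
    finally show ?thesis .
  qed
  have s2: "(\<Sum>a\<in>A. conc ws (a + w) * F a) = walk_avg ws (\<lambda>a. F (a - w))"
  proof -
    have "(\<Sum>a\<in>A. conc ws (a + w) * F a) = (\<Sum>a\<in>(\<lambda>a. a + w) ` A. conc ws a * F (a - w))"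
      by (subst sum.reindex) (auto simp: inj_on_def)
    also have "\<dots> = walk_avg ws (\<lambda>a. F (a - w))"
    proof (rule Cons.IH[symmetric])
      show "walk_supp ws \<subseteq> (\<lambda>a. a + w) ` A"
      proof
        fix a assume "a \<in> walk_supp ws"
        then have "a - w \<in> A" using Cons.prems by auto
        then have "(a - w) + w \<in> (\<lambda>a. a + w) ` A" by (rule imageI)
        then show "a \<in> (\<lambda>a. a + w) ` A" by simp
      qed
    qed (use Cons.prems in simp)
    finally show ?thesis .
  qed
  have "(\<Sum>a\<in>A. conc (w # ws) a * F a)
      = ((\<Sum>a\<in>A. conc ws (a - w) * F a) + (\<Sum>a\<in>A. conc ws (a + w) * F a)) / 2"
    unfolding sum.distrib[symmetric] sum_divide_distrib
    by (rule sum.cong) (simp_all add: conc_Cons distrib_right)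
  then show ?case by (simp only: s1 s2 walk_avg.simps)
qed

lemma conc_uminus: "conc ws (- c) = conc ws c"
proof (induction ws arbitrary: c)
  case (Cons w ws)
  have "conc ws (- c - w) = conc ws (c + w)" "conc ws (- c + w) = conc ws (c - w)"
    using Cons[of "c + w"] Cons[of "c - w"] by (simp_all add: algebra_simps)
  then show ?case by (simp add: conc_Cons)
qed (auto simp: conc_Nil)

text \<open>The signs are symmetric, so a return to 0 after both copies means that two independent
  copies of the walk meet.\<close>

lemma conc_double: 
  assumes "finite A" "walk_supp us \<subseteq> A"
  shows "conc (us @ us) 0 = (\<Sum>a\<in>A. (conc us a)\<^sup>2)"
  unfolding conc_append walk_avg_sum[OF assms] by (simp add: conc_uminus power2_eq_square)

lemma conc_Cauchy_Schwarz:
  "(conc (us @ vs) c)\<^sup>2 \<le> conc (us @ us) 0 * conc (vs @ vs) 0"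
proof -
  define A where "A = walk_supp us \<union> (\<lambda>a. c - a) ` walk_supp vs"
  define B where "B = (\<lambda>a. c - a) ` A"
  have A: "finite A" "walk_supp us \<subseteq> A" by (auto simp: A_def)
  have B: "finite B" "walk_supp vs \<subseteq> B" using A by (auto simp: A_def B_def image_iff intro!: bexI[of _ "c - _"])
  have "(conc (us @ vs) c)\<^sup>2 = (\<Sum>a\<in>A. conc us a * conc vs (c - a))\<^sup>2"
    unfolding conc_append walk_avg_sum[OF A] ..
  also have "\<dots> \<le> (\<Sum>a\<in>A. (conc us a)\<^sup>2) * (\<Sum>a\<in>A. (conc vs (c - a))\<^sup>2)"
    by (rule Cauchy_Schwarz_ineq_sum)
  also have "(\<Sum>a\<in>A. (conc vs (c - a))\<^sup>2) = (\<Sum>a\<in>B. (conc vs a)\<^sup>2)"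
    unfolding B_def by (subst sum.reindex) (auto simp: inj_on_def)
  finally show ?thesis by (simp add: conc_double[OF A] conc_double[OF B])
qed

text \<open>A Hoelder inequality for convolutions, obtained by iterating Cauchy--Schwarz.\<close>

lemma conc_blocks:
  assumes "length Bs = 2 ^ t" "0 \<le> e"
    and "\<And>B c. B \<in> set Bs \<Longrightarrow> conc (concat (replicate (2 ^ t) B)) c \<le> e"
  shows "conc (concat Bs) c \<le> e"
  using assms
proof (induction t arbitrary: Bs c)
  case 0
  then obtain B where "Bs = [B]" by (auto simp: length_Suc_conv)
  with 0(3)[of B c] show ?case by simp
next
  case (Suc t)
  \<comment> \<open>Cauchy--Schwarz doubles each half of the list. The doubled blocks form a list of
    half the length, and 2^t copies of \<open>B @ B\<close> are 2^(t + 1) copies of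
    \<open>B\<close>.\<close>
  define D where "D = map (\<lambda>B::'a list. B @ B)"
  have mD: "mset (concat (D Cs)) = mset (concat Cs @ concat Cs)" for Cs
    by (induction Cs) (auto simp: D_def)
  have half: "conc (concat Cs @ concat Cs) 0 \<le> e" if Cs: "length Cs = 2 ^ t" "set Cs \<subseteq> set Bs" for Cs
  proof -
    have "conc (concat (D Cs)) 0 \<le> e"
    proof (rule Suc.IH)
      show "length (D Cs) = 2 ^ t" using Cs by (simp add: D_def)
      fix B c assume "B \<in> set (D Cs)"
      then have "B \<in> (\<lambda>B. B @ B) ` set Cs" by (simp add: D_def)
      then obtain C where C': "C \<in> set Cs" "B = C @ C" by (rule imageE)
      then have C: "C \<in> set Bs" "B = C @ C" using Cs by auto
      have "mset (concat (replicate n B)) = mset (concat (replicate (2 * n) C))" for n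
        by (induction n) (auto simp: C)
      then show "conc (concat (replicate (2 ^ t) B)) c \<le> e"
        using Suc.prems(3)[OF C(1), of c] conc_mset[of "concat (replicate (2 ^ t) B)"] by simp
    qed fact
    then show ?thesis using conc_mset[OF mD] by metis
  qed
  define Cs Ds where "Cs = take (2 ^ t) Bs" and "Ds = drop (2 ^ t) Bs"
  have "(conc (concat Bs) c)\<^sup>2 = (conc (concat Cs @ concat Ds) c)\<^sup>2"
    unfolding Cs_def Ds_def by (metis append_take_drop_id concat_append)
  also have "\<dots> \<le> conc (concat Cs @ concat Cs) 0 * conc (concat Ds @ concat Ds) 0"
    by (rule conc_Cauchy_Schwarz)
  also have "\<dots> \<le> e * e"
    by (intro mult_mono half conc_nonneg)
      (use Suc.prems in \<open>auto simp: Cs_def Ds_def dest: in_set_takeD in_set_dropD\<close>)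
  finally show ?case using \<open>0 \<le> e\<close> by (auto intro: power2_le_imp_le simp: power2_eq_square)
qed

section \<open>Repeated steps and central binomial coefficients\<close>

definition central :: "nat \<Rightarrow> real" where
  "central N = real (N choose (N div 2)) / 2 ^ N"

text \<open>The two claims share one induction: at the extreme end point, \<open>j = 0\<close>,
  Pascal's rule has a single term because by the second claim \<open>N\<close> steps cannot reach
  \<open>N + 2\<close>.\<close>

lemma conc_replicate_one:
  "conc (replicate N (1::complex)) (of_nat N - 2 * of_nat j) = real (N choose j) / 2 ^ N"
  "(\<And>j. c \<noteq> of_nat N - 2 * of_nat j) \<Longrightarrow> conc (replicate N (1::complex)) c = 0"
proof (induction N arbitrary: j c)
  case 0
  {
    case 1
    have "(0::complex) = of_nat j \<longleftrightarrow> j = 0" by (metis of_nat_eq_0_iff)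
    then show ?case by (cases "j = 0") (auto simp: conc_Nil)
  next
    case 2
    from 2[of 0] show ?case by (auto simp: conc_Nil)
  }
next
  case (Suc N)
  {
    case 1
    show ?case
    proof (cases j)
      case 0
      have "conc (replicate N (1::complex)) (of_nat N + 2) = 0"
      proof (rule Suc.IH(2))
        fix i
        show "(of_nat N + 2 :: complex) \<noteq> of_nat N - 2 * of_nat i"
        proof
          assume "(of_nat N + 2 :: complex) = of_nat N - 2 * of_nat i"
          then have "(of_nat (2 + 2 * i) :: complex) = 0" by (simp add: algebra_simps)
          then show False by (simp only: of_nat_eq_0_iff)
        qed
      qed
      then show ?thesis using Suc.IH(1)[of 0] by (simp add: conc_Cons 0 algebra_simps)
    next
      case (Suc i)
      have "of_nat (Suc N) - 2 * of_nat j - 1 = (of_nat N - 2 * of_nat j :: complex)"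
        "of_nat (Suc N) - 2 * of_nat j + 1 = (of_nat N - 2 * of_nat i :: complex)"
        by (simp_all add: Suc algebra_simps)
      then show ?thesis using Suc.IH(1)[of j] Suc.IH(1)[of i]
        by (simp only: conc_Cons replicate_Suc) (simp add: Suc add_divide_distrib)
    qed
  next
    case 2
    have "c - 1 \<noteq> of_nat N - 2 * of_nat j" for j
      using 2[of j] by (auto simp: algebra_simps)
    moreover have "c + 1 \<noteq> of_nat N - 2 * of_nat j" for j
      using 2[of "Suc j"] by (auto simp: algebra_simps)
    ultimately show ?case by (simp add: conc_Cons Suc.IH(2))
  }
qed

lemma conc_replicate_one_le: "conc (replicate N (1::complex)) c \<le> central N"
proof (cases "\<exists>j::nat. c = of_nat N - 2 * of_nat j")
  case True
  then obtain j :: nat where j: "c = of_nat N - 2 * of_nat j" by blast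
  have "real (N choose j) \<le> real (N choose (N div 2))" using binomial_maximum[of N j] by simp
  then show ?thesis unfolding j conc_replicate_one central_def by (simp add: divide_right_mono)
next
  case False
  then show ?thesis using conc_replicate_one(2)[of c N] by (simp add: central_def)
qed

lemma central_nonneg: "0 \<le> central N"
  by (simp add: central_def)

lemma conc_replicate_le:
  fixes w :: "nat \<Rightarrow> complex"
  assumes "w k \<noteq> 0"
  shows "conc (replicate N w) c \<le> central N"
proof -
  have "conc (replicate N w) c \<le> conc (map (\<lambda>v. v k / w k) (replicate N w)) (c k / w k)"
    by (rule conc_le_map) (simp add: add_divide_distrib)
  also have "\<dots> \<le> central N" using assms conc_replicate_one_le by (simp add: map_replicate)
  finally show ?thesis .
qed

text \<open>The second assumption says that \<open>B\<close> spans the coordinates in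
  \<open>K\<close>. Coordinate \<open>k\<close> is eliminated by projecting along a step
  \<open>w\<close> with \<open>w k \<noteq> 0\<close>. The projection of the other steps has to hit
  its target, which the induction hypothesis controls; after that the \<open>N\<close> copies of
  \<open>w\<close> still have to hit one point, which costs a factor
  \<open>central N\<close>.\<close>

lemma conc_copies_le:
  fixes B :: "(nat \<Rightarrow> complex) list"
  assumes "finite K"
    and "\<And>\<beta>. (\<forall>w\<in>set B. (\<Sum>m\<in>K. \<beta> m * w m) = 0) \<Longrightarrow> \<forall>m\<in>K. \<beta> m = 0"
  shows "conc (concat (map (replicate N) B)) c \<le> central N ^ card K"
  using assms
proof (induction K arbitrary: B c rule: finite_induct)
  case empty
  then show ?case using conc_le_one by simp
next
  case (insert k K)
  have "\<exists>w\<in>set B. w k \<noteq> 0"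
  proof (rule ccontr)
    assume "\<not> ?thesis"
    then have "\<forall>m\<in>insert k K. (of_bool (m = k) :: complex) = 0"
      using insert.hyps by (intro insert.prems) (auto simp: sum.insert)
    then show False by simp
  qed
  then obtain w where w: "w \<in> set B" "w k \<noteq> 0" by blast
  then obtain B1 B2 where B: "B = B1 @ w # B2" by (meson split_list)
  define p where "p v = (\<lambda>m. v m - (v k / w k) * w m)" for v
  have p_add: "p (a + b) = p a + p b" for a b
    by (auto simp: p_def fun_eq_iff add_divide_distrib algebra_simps)
  have pw: "p w = 0" using w by (auto simp: p_def fun_eq_iff)
  have IH: "conc (concat (map (replicate N) (map p (B1 @ B2)))) c' \<le> central N ^ card K" for c'
  proof (rule insert.IH)
    fix \<beta>
    assume b: "\<forall>v\<in>set (map p (B1 @ B2)). (\<Sum>m\<in>K. \<beta> m * v m) = 0"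
    \<comment> \<open>Extends a relation for the projected steps to one for the original steps; the
      coefficient at \<open>k\<close> is chosen such that \<open>w\<close> is annihilated.\<close>
    define \<gamma> where "\<gamma> = \<beta>(k := - (\<Sum>m\<in>K. \<beta> m * w m) / w k)"
    have g: "(\<Sum>m\<in>insert k K. \<gamma> m * v m) = (\<Sum>m\<in>K. \<beta> m * p v m)" for v
    proof -
      have "(\<Sum>m\<in>K. \<gamma> m * v m) = (\<Sum>m\<in>K. \<beta> m * v m)"
        by (rule sum.cong) (use insert.hyps in \<open>auto simp: \<gamma>_def\<close>)
      then have "(\<Sum>m\<in>insert k K. \<gamma> m * v m) = (\<Sum>m\<in>K. \<beta> m * v m) - (v k / w k) * (\<Sum>m\<in>K. \<beta> m * w m)"
        using insert.hyps by (simp add: \<gamma>_def)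
      also have "\<dots> = (\<Sum>m\<in>K. \<beta> m * p v m)"
        by (simp add: p_def algebra_simps sum_subtractf sum_distrib_left sum_divide_distrib)
      finally show ?thesis .
    qed
    have "\<forall>v\<in>set B. (\<Sum>m\<in>insert k K. \<gamma> m * v m) = 0"
      using b by (auto simp: g B pw)
    then have "\<forall>m\<in>insert k K. \<gamma> m = 0" by (rule insert.prems)
    then show "\<forall>m\<in>K. \<beta> m = 0" using insert.hyps by (auto simp: \<gamma>_def split: if_splits)
  qed
  define R where "R = concat (map (replicate N) (B1 @ B2))"
  have "conc (concat (map (replicate N) B)) c = conc (R @ replicate N w) c"
    by (rule conc_mset) (simp add: B R_def)
  also have "\<dots> = walk_avg R (\<lambda>a. conc (replicate N w) (c - a))" by (rule conc_append)
  also have "\<dots> \<le> walk_avg R (\<lambda>a. central N * of_bool (p a = p c))"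
  proof (rule walk_avg_mono)
    fix a
    have pca: "p (c - a) = p c - p a" using p_add[of "c - a" a] by (simp add: eq_diff_eq)
    have "conc (replicate N w) (c - a) \<le> conc (map p (replicate N w)) (p (c - a))"
      by (rule conc_le_map) (rule p_add)
    also have "\<dots> = conc (replicate N 0) (p c - p a)" by (simp add: map_replicate pw pca)
    also have "\<dots> = of_bool (p c - p a = 0)" by (rule conc_replicate_zero)
    also have "\<dots> = of_bool (p a = p c)" by (simp only: right_minus_eq eq_commute[of "p c"])
    finally have "conc (replicate N w) (c - a) \<le> of_bool (p a = p c)" .
    moreover have "conc (replicate N w) (c - a) \<le> central N" by (rule conc_replicate_le) fact
    ultimately show "conc (replicate N w) (c - a) \<le> central N * of_bool (p a = p c)"
      by (cases "p a = p c") auto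
  qed
  also have "\<dots> = central N * conc (map p R) (p c)"
    by (simp add: walk_avg_cmult conc_def walk_avg_map p_add)
  also have "map p R = concat (map (replicate N) (map p (B1 @ B2)))"
    by (simp add: R_def map_concat o_def map_replicate)
  also have "central N * conc \<dots> (p c) \<le> central N * central N ^ card K"
    by (intro mult_left_mono IH central_nonneg)
  finally show ?case using insert.hyps by simp
qed

text \<open>With the weight \<open>2 * n + 1\<close> the induction step reduces to (2n + 1)(2n + 3)
  <= (2n + 2)^2.\<close>

lemma central_binomial_square_le: "(real (2 * n choose n))\<^sup>2 * real (2 * n + 1) \<le> 16 ^ n"
proof (induction n)
  case (Suc n)
  define x where "x = real (2 * n choose n)"
  define y where "y = real (2 * Suc n choose Suc n)"
  have x: "x = fact (2 * n) / (fact n * fact n)"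
    unfolding x_def by (subst binomial_fact) simp_all
  have "y = fact (2 * Suc n) / (fact (Suc n) * fact (Suc n))"
    unfolding y_def by (subst binomial_fact) simp_all
  also have "(fact (2 * Suc n) :: real) = 2 * (real n + 1) * ((2 * real n + 1) * fact (2 * n))"
    by (simp add: algebra_simps)
  also have "(fact (Suc n) :: real) = (real n + 1) * fact n" by (simp add: algebra_simps)
  finally have y': "y = 2 * (real n + 1) * ((2 * real n + 1) * fact (2 * n)) /
      ((real n + 1) * fact n * ((real n + 1) * fact n))" .
  define q where "q = real n + 1"
  have "q > 0" by (simp add: q_def)
  then have y: "q * y = 2 * (2 * real n + 1) * x"
    unfolding x y' q_def[symmetric] by (simp add: field_simps)
  have IH: "x\<^sup>2 * (2 * real n + 1) \<le> 16 ^ n" using Suc by (simp add: x_def add.commute)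
  have q: "4 * (2 * real n + 1) * (2 * real n + 3) \<le> 16 * q\<^sup>2"
    by (simp add: q_def power2_eq_square algebra_simps)
  have "q\<^sup>2 * (y\<^sup>2 * (2 * real n + 3)) = (q * y)\<^sup>2 * (2 * real n + 3)"
    by (simp only: power_mult_distrib mult.assoc)
  also have "\<dots> = (x\<^sup>2 * (2 * real n + 1)) * (4 * (2 * real n + 1) * (2 * real n + 3))"
    unfolding y power2_eq_square by (simp only: mult_ac)
  also have "\<dots> \<le> 16 ^ n * (16 * q\<^sup>2)"
    by (rule mult_mono[OF IH q]) auto
  finally have "q\<^sup>2 * (y\<^sup>2 * (2 * real n + 3)) \<le> q\<^sup>2 * 16 ^ Suc n"
    by (simp only: power_Suc mult_ac)
  then have "y\<^sup>2 * (2 * real n + 3) \<le> 16 ^ Suc n"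
    by (rule mult_left_le_imp_le) (use \<open>q > 0\<close> in simp)
  moreover have "real (2 * Suc n + 1) = 2 * real n + 3" by simp
  ultimately show ?case unfolding y_def by (simp only:)
qed simp

lemma central_power2_le: "central (2 ^ t) \<le> 2 powr (- real t / 2)"
proof (cases t)
  case 0
  then show ?thesis by (simp add: central_def)
next
  case (Suc u)
  define n where "n = (2::nat) ^ u"
  have N: "2 ^ t = 2 * n" by (simp add: n_def Suc)
  define x where "x = real (2 * n choose n)"
  have e16: "((2::real) ^ (2 * n))\<^sup>2 = 16 ^ n"
    by (simp add: power_mult power2_eq_square flip: power_mult_distrib)
  have "(central (2 ^ t))\<^sup>2 * (2 * real n) = x\<^sup>2 * (2 * real n) / 16 ^ n"
    using e16 by (simp add: central_def N x_def power_divide)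
  also have "\<dots> \<le> x\<^sup>2 * real (2 * n + 1) / 16 ^ n"
    by (intro divide_right_mono mult_left_mono) auto
  also have "\<dots> \<le> 1" using central_binomial_square_le[of n] by (simp add: x_def)
  finally have "(central (2 ^ t))\<^sup>2 * 2 ^ t \<le> 1"
    using N by (simp add: n_def Suc)
  then have "(central (2 ^ t))\<^sup>2 \<le> 1 / 2 ^ t" by (simp add: field_simps)
  also have "\<dots> = 2 powr (- real t / 2) * 2 powr (- real t / 2)"
    by (simp add: powr_add[symmetric] powr_minus powr_realpow inverse_eq_divide)
  also have "\<dots> = (2 powr (- real t / 2))\<^sup>2" by (simp only: power2_eq_square)
  finally show ?thesis by (rule power2_le_imp_le) simp
qed

section \<open>Linear forms on the cube\<close>

text \<open>Sign vectors are extended by 0, so that joining two of them is addition.\<close>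

definition cube :: "nat set \<Rightarrow> (nat \<Rightarrow> complex) set" where
  "cube I = {x. (\<forall>i\<in>I. x i = 1 \<or> x i = -1) \<and> (\<forall>i. i \<notin> I \<longrightarrow> x i = 0)}"

definition av :: "nat set \<Rightarrow> ((nat \<Rightarrow> complex) \<Rightarrow> real) \<Rightarrow> real" where
  "av I f = (\<Sum>x\<in>cube I. f x) / real (card (cube I))"

definition pr :: "nat set \<Rightarrow> ((nat \<Rightarrow> complex) \<Rightarrow> bool) \<Rightarrow> real" where
  "pr I E = av I (\<lambda>x. of_bool (E x))"

definition dot :: "nat set \<Rightarrow> (nat \<Rightarrow> complex) \<Rightarrow> (nat \<Rightarrow> complex) \<Rightarrow> complex" where
  "dot I a x = (\<Sum>i\<in>I. a i * x i)"

lemma finite_cube: "finite I \<Longrightarrow> finite (cube I)"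
  by (rule finite_subset[OF _ finite_set_of_finite_funs[of I "{1, -1}" 0]]) (auto simp: cube_def)

lemma card_cube_pos: "finite I \<Longrightarrow> card (cube I) > 0"
proof -
  assume "finite I"
  moreover have "(\<lambda>i. if i \<in> I then 1 else 0) \<in> cube I" by (auto simp: cube_def)
  ultimately show ?thesis using finite_cube card_gt_0_iff by blast
qed

lemma av_mono: "(\<And>x. x \<in> cube I \<Longrightarrow> f x \<le> g x) \<Longrightarrow> av I f \<le> av I g"
  unfolding av_def by (intro divide_right_mono sum_mono) auto

lemma av_cong: "(\<And>x. x \<in> cube I \<Longrightarrow> f x = g x) \<Longrightarrow> av I f = av I g"
  unfolding av_def by (intro arg_cong2[of _ _ _ _ "(/)"] sum.cong) auto

lemma av_const [simp]: "finite I \<Longrightarrow> av I (\<lambda>_. r) = r"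
  using card_cube_pos[of I] by (simp add: av_def)

lemma av_cmult: "av I (\<lambda>x. r * f x) = r * av I f"
  by (simp add: av_def sum_distrib_left)

lemma av_cmult_right: "av I (\<lambda>x. f x * r) = av I f * r"
  by (simp add: av_def sum_distrib_right)

lemma av_add: "av I (\<lambda>x. f x + g x) = av I f + av I g"
  by (simp add: av_def sum.distrib add_divide_distrib)

lemma av_sum: "av I (\<lambda>x. \<Sum>d\<in>D. f d x) = (\<Sum>d\<in>D. av I (f d))"
proof -
  have "(\<Sum>x\<in>cube I. \<Sum>d\<in>D. f d x) = (\<Sum>d\<in>D. \<Sum>x\<in>cube I. f d x)" by (rule sum.swap)
  then show ?thesis by (simp add: av_def sum_divide_distrib)
qed

lemma av_swap: "av I (\<lambda>x. av J (\<lambda>y. f x y)) = av J (\<lambda>y. av I (\<lambda>x. f x y))"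
proof -
  have "(\<Sum>x\<in>cube I. \<Sum>y\<in>cube J. f x y) = (\<Sum>y\<in>cube J. \<Sum>x\<in>cube I. f x y)" by (rule sum.swap)
  then show ?thesis by (simp add: av_def sum_divide_distrib[symmetric] mult.commute)
qed

lemma av_le_const: "finite I \<Longrightarrow> (\<And>x. x \<in> cube I \<Longrightarrow> f x \<le> r) \<Longrightarrow> av I f \<le> r"
  using av_mono[of I f "\<lambda>_. r"] by simp

lemma av_nonneg: "(\<And>x. x \<in> cube I \<Longrightarrow> 0 \<le> f x) \<Longrightarrow> 0 \<le> av I f"
  unfolding av_def by (intro divide_nonneg_nonneg sum_nonneg) auto

lemma pr_nonneg: "0 \<le> pr I E"
  unfolding pr_def by (rule av_nonneg) auto

lemma pr_le_one: "finite I \<Longrightarrow> pr I E \<le> 1"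
  unfolding pr_def by (rule av_le_const) auto

lemma pr_mono: "(\<And>x. x \<in> cube I \<Longrightarrow> E x \<Longrightarrow> E' x) \<Longrightarrow> pr I E \<le> pr I E'"
  unfolding pr_def by (rule av_mono) auto

lemma pr_cong: "(\<And>x. x \<in> cube I \<Longrightarrow> E x = E' x) \<Longrightarrow> pr I E = pr I E'"
  unfolding pr_def by (rule av_cong) auto

lemma pr_disj_le:
  assumes "\<And>x. x \<in> cube I \<Longrightarrow> E x \<Longrightarrow> E1 x \<or> E2 x"
  shows "pr I E \<le> pr I E1 + pr I E2"
  unfolding pr_def av_add[symmetric]
  by (rule av_mono) (use assms in \<open>auto simp: of_bool_def\<close>)

lemma cube_Un_bij:
  assumes "I \<inter> J = {}"
  shows "bij_betw (\<lambda>(y, z). y + z) (cube I \<times> cube J) (cube (I \<union> J))"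
proof (rule bij_betw_byWitness[where f' = "\<lambda>x. ((\<lambda>i. if i \<in> I then x i else 0), (\<lambda>i. if i \<in> J then x i else 0))"])
  show "\<forall>a\<in>cube I \<times> cube J. (case case a of (y, z) \<Rightarrow> y + z of
      x \<Rightarrow> ((\<lambda>i. if i \<in> I then x i else 0), (\<lambda>i. if i \<in> J then x i else 0))) = a"
    using assms by (fastforce simp: cube_def fun_eq_iff)
  show "\<forall>x\<in>cube (I \<union> J). (case ((\<lambda>i. if i \<in> I then x i else 0), (\<lambda>i. if i \<in> J then x i else 0)) of
      (y, z) \<Rightarrow> y + z) = x"
    using assms by (fastforce simp: cube_def fun_eq_iff)
  show "(\<lambda>(y, z). y + z) ` (cube I \<times> cube J) \<subseteq> cube (I \<union> J)"
  proof clarsimp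
    fix y z assume yz: "y \<in> cube I" "z \<in> cube J"
    have "(y + z) i = (if i \<in> I then y i else if i \<in> J then z i else 0)" for i
      using yz assms by (auto simp: cube_def)
    then show "y + z \<in> cube (I \<union> J)" using yz by (auto simp: cube_def)
  qed
  show "(\<lambda>x. ((\<lambda>i. if i \<in> I then x i else 0), (\<lambda>i. if i \<in> J then x i else 0))) ` cube (I \<union> J)
      \<subseteq> cube I \<times> cube J"
    by (auto simp: cube_def)
qed

lemma av_Un:
  assumes "I \<inter> J = {}"
  shows "av (I \<union> J) f = av I (\<lambda>y. av J (\<lambda>z. f (y + z)))"
proof -
  have "(\<Sum>x\<in>cube (I \<union> J). f x) = (\<Sum>p\<in>cube I \<times> cube J. f (fst p + snd p))"
    using sum.reindex_bij_betw[OF cube_Un_bij[OF assms], of f] by (simp add: case_prod_unfold)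
  also have "\<dots> = (\<Sum>y\<in>cube I. \<Sum>z\<in>cube J. f (y + z))"
    by (simp add: sum.cartesian_product case_prod_unfold)
  finally have "(\<Sum>x\<in>cube (I \<union> J). f x) = (\<Sum>y\<in>cube I. \<Sum>z\<in>cube J. f (y + z))" .
  moreover have "card (cube (I \<union> J)) = card (cube I) * card (cube J)"
    using bij_betw_same_card[OF cube_Un_bij[OF assms]] by (simp add: card_cartesian_product)
  ultimately show ?thesis
    by (simp add: av_def sum_divide_distrib[symmetric] mult.commute)
qed

lemma av_subset:
  assumes "J \<subseteq> I"
  shows "av I f = av (I - J) (\<lambda>y. av J (\<lambda>z. f (y + z)))"
proof -
  have "(I - J) \<union> J = I" using assms by auto
  then show ?thesis using av_Un[of "I - J" J f] by auto
qed

text \<open>This allows variables to be discarded: once they are fixed, only the lower order terms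
  of a quadratic function change, and the bounds are uniform in those.\<close>

lemma pr_le_sup:
  assumes "finite I" "J \<subseteq> I" "\<And>y. y \<in> cube (I - J) \<Longrightarrow> pr J (\<lambda>z. E (y + z)) \<le> r"
  shows "pr I E \<le> r"
  unfolding pr_def av_subset[OF assms(2)]
  by (rule av_le_const) (use assms in \<open>auto simp: pr_def\<close>)

lemma cube_empty: "cube {} = {0}"
  by (auto simp: cube_def fun_eq_iff)

lemma av_empty [simp]: "av {} f = f 0"
  by (simp add: av_def cube_empty)

section \<open>Vectors of linear forms as random walks\<close>

definition unit_fun :: "nat \<Rightarrow> nat \<Rightarrow> complex" where
  "unit_fun i = (\<lambda>j. of_bool (j = i))"

lemma cube_singleton: "cube {i} = {unit_fun i, - unit_fun i}"
proof (rule Set.set_eqI)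
  fix x
  have "x = unit_fun i \<longleftrightarrow> x i = 1 \<and> (\<forall>j. j \<noteq> i \<longrightarrow> x j = 0)"
    by (auto simp: unit_fun_def fun_eq_iff)
  moreover have "x = - unit_fun i \<longleftrightarrow> x i = -1 \<and> (\<forall>j. j \<noteq> i \<longrightarrow> x j = 0)"
    by (auto simp: unit_fun_def fun_eq_iff)
  ultimately show "x \<in> cube {i} \<longleftrightarrow> x \<in> {unit_fun i, - unit_fun i}" by (auto simp: cube_def)
qed

lemma av_singleton: "av {i} f = (f (unit_fun i) + f (- unit_fun i)) / 2"
proof -
  have "unit_fun i \<noteq> - unit_fun i"
  proof
    assume "unit_fun i = - unit_fun i"
    then have "unit_fun i i = (- unit_fun i) i" by metis
    then show False by (simp add: unit_fun_def)
  qed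
  then show ?thesis by (simp add: av_def cube_singleton)
qed

lemma av_insert:
  assumes "i \<notin> I"
  shows "av (insert i I) f = (av I (\<lambda>y. f (y + unit_fun i)) + av I (\<lambda>y. f (y - unit_fun i))) / 2"
proof -
  have "av ({i} \<union> I) f = av {i} (\<lambda>y. av I (\<lambda>z. f (y + z)))" by (rule av_Un) (use assms in auto)
  then show ?thesis by (simp add: av_singleton add.commute)
qed

lemma dot_add: "dot I a (x + y) = dot I a x + dot I a y"
  by (simp add: dot_def algebra_simps sum.distrib)

lemma dot_diff: "dot I a (x - y) = dot I a x - dot I a y"
  by (simp add: dot_def algebra_simps sum_subtractf)

text \<open>Revealing the sign of one variable moves the vector of values of all forms by plus or
  minus the column of coefficients of that variable.\<close>

lemma av_eq_walk_avg:
  assumes "distinct ts"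
  shows "av (set ts) (\<lambda>z. F (\<lambda>m. if m \<in> K then dot (set ts) (\<alpha> m) z else 0))
    = walk_avg (map (\<lambda>t m. if m \<in> K then \<alpha> m t else 0) ts) F"
  using assms
proof (induction ts arbitrary: F)
  case Nil
  have "(\<lambda>m. if m \<in> K then dot (set []) (\<alpha> m) 0 else 0) = 0"
    by (auto simp: dot_def fun_eq_iff)
  then show ?case by (simp only: list.map walk_avg.simps av_empty list.set)
next
  case (Cons t ts)
  let ?v = "\<lambda>m. if m \<in> K then \<alpha> m t else 0"
  have *: "dot (set (t # ts)) (\<alpha> m) (z + unit_fun t) = dot (set ts) (\<alpha> m) z + \<alpha> m t"
    "dot (set (t # ts)) (\<alpha> m) (z - unit_fun t) = dot (set ts) (\<alpha> m) z - \<alpha> m t"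
    if "z \<in> cube (set ts)" for z m
  proof -
    have "(\<Sum>i\<in>set ts. \<alpha> m i * unit_fun t i) = 0"
      by (rule sum.neutral) (use Cons.prems in \<open>auto simp: unit_fun_def\<close>)
    then have u: "dot (set (t # ts)) (\<alpha> m) (unit_fun t) = \<alpha> m t"
      using Cons.prems by (simp add: dot_def) (simp add: unit_fun_def)
    have z: "dot (set (t # ts)) (\<alpha> m) z = dot (set ts) (\<alpha> m) z"
      using Cons.prems that by (simp add: dot_def cube_def)
    show "dot (set (t # ts)) (\<alpha> m) (z + unit_fun t) = dot (set ts) (\<alpha> m) z + \<alpha> m t"
      "dot (set (t # ts)) (\<alpha> m) (z - unit_fun t) = dot (set ts) (\<alpha> m) z - \<alpha> m t"
      unfolding dot_add dot_diff u z by simp_all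
  qed
  have e: "(\<lambda>m. if m \<in> K then dot (set ts) (\<alpha> m) z + \<alpha> m t else 0)
      = (\<lambda>m. if m \<in> K then dot (set ts) (\<alpha> m) z else 0) + ?v"
    "(\<lambda>m. if m \<in> K then dot (set ts) (\<alpha> m) z - \<alpha> m t else 0)
      = (\<lambda>m. if m \<in> K then dot (set ts) (\<alpha> m) z else 0) - ?v" for z
    by (auto simp: fun_eq_iff)
  have 1: "av (set ts) (\<lambda>z. F (\<lambda>m. if m \<in> K then dot (set (t # ts)) (\<alpha> m) (z + unit_fun t) else 0))
      = walk_avg (map (\<lambda>t m. if m \<in> K then \<alpha> m t else 0) ts) (\<lambda>a. F (a + ?v))"
    using Cons.prems by (subst Cons.IH[symmetric]) (auto intro!: av_cong simp only: * e distinct.simps)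
  have 2: "av (set ts) (\<lambda>z. F (\<lambda>m. if m \<in> K then dot (set (t # ts)) (\<alpha> m) (z - unit_fun t) else 0))
      = walk_avg (map (\<lambda>t m. if m \<in> K then \<alpha> m t else 0) ts) (\<lambda>a. F (a - ?v))"
    using Cons.prems by (subst Cons.IH[symmetric]) (auto intro!: av_cong simp only: * e distinct.simps)
  have "t \<notin> set ts" using Cons.prems by simp
  then show ?case
    unfolding list.map walk_avg.simps 1[symmetric] 2[symmetric]
    by (simp only: list.set(2) av_insert not_False_eq_True)
qed

text \<open>Linear independence of the restrictions to \<open>J\<close>, formulated for the indexed
  family so that a repeated form counts as dependent.\<close>

definition indep :: "nat set \<Rightarrow> nat set \<Rightarrow> (nat \<Rightarrow> nat \<Rightarrow> complex) \<Rightarrow> bool" where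
  "indep K J \<alpha> \<longleftrightarrow> (\<forall>\<beta>. (\<forall>j\<in>J. (\<Sum>m\<in>K. \<beta> m * \<alpha> m j) = 0) \<longrightarrow> (\<forall>m\<in>K. \<beta> m = 0))"

lemma indep_mono: "indep K J \<alpha> \<Longrightarrow> J \<subseteq> J' \<Longrightarrow> indep K J' \<alpha>"
  unfolding indep_def by blast

lemma pr_eq_conc:
  assumes "distinct ts" "set ts = Z"
  shows "pr Z (\<lambda>z. \<forall>m\<in>K. dot Z (\<alpha> m) z = c m)
    = conc (map (\<lambda>t m. if m \<in> K then \<alpha> m t else 0) ts) (\<lambda>m. if m \<in> K then c m else 0)"
proof -
  have "(\<forall>m\<in>K. dot Z (\<alpha> m) z = c m) \<longleftrightarrow>
      (\<lambda>m. if m \<in> K then dot Z (\<alpha> m) z else 0) = (\<lambda>m. if m \<in> K then c m else 0)" for z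
    by (auto simp: fun_eq_iff)
  then show ?thesis
    unfolding pr_def conc_def av_eq_walk_avg[OF assms(1), symmetric] assms(2) by simp
qed

text \<open>A form of Halasz' inequality.\<close>

lemma pr_forms_le:
  assumes "finite Z" "finite K"
    and J: "\<And>b::nat. b < 2 ^ t \<Longrightarrow> J b \<subseteq> Z" "\<And>b. b < 2 ^ t \<Longrightarrow> indep K (J b) \<alpha>"
    and disj: "disjoint_family_on J {..<2 ^ t}"
  shows "pr Z (\<lambda>z. \<forall>m\<in>K. dot Z (\<alpha> m) z = c m) \<le> (2 powr (- real t / 2)) ^ card K"
proof -
  define L where "L b = sorted_list_of_set (J b)" for b
  have fin: "finite (J b)" if "b < 2 ^ t" for b using J(1)[OF that] assms(1) finite_subset by blast
  have L: "set (L b) = J b" "distinct (L b)" if "b < 2 ^ t" for b using fin[OF that] by (auto simp: L_def)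
  define ps where "ps = concat (map L [0..<2 ^ t])"
  define rs where "rs = sorted_list_of_set (Z - set ps)"
  have ps: "set ps \<subseteq> Z" using subsetD[OF J(1)] L(1) by (auto simp: ps_def)
  have rs: "set rs = Z - set ps" "distinct rs" using assms(1) by (auto simp: rs_def)
  have "distinct (concat (map L [0..<u]))" if "u \<le> 2 ^ t" for u
    using that
  proof (induction u)
    case (Suc u)
    have "J b \<inter> J u = {}" if "b < u" for b
      using disj that Suc.prems by (auto simp: disjoint_family_on_def)
    moreover have "set (concat (map L [0..<u])) = (\<Union>b<u. J b)"
      using L(1) Suc.prems by (auto simp: set_concat)
    ultimately show ?case using Suc L[of u] by auto
  qed simp
  then have "distinct ps" by (simp add: ps_def)
  then have ts: "distinct (ps @ rs)" "set (ps @ rs) = Z" using rs ps by auto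
  define w where "w = (\<lambda>t m. if m \<in> K then \<alpha> m t else 0)"
  \<comment> \<open>The columns over one \<open>J b\<close> form a block. The Hoelder inequality
    reduces the walk to 2^t copies of a single block, and independence on \<open>J b\<close> says
    that this block spans the coordinates in \<open>K\<close>.\<close>
  define Bs where "Bs = map (\<lambda>b. map w (L b)) [0..<2 ^ t]"
  have "conc (concat Bs) c' \<le> central (2 ^ t) ^ card K" for c'
  proof (rule conc_blocks)
    fix B c assume "B \<in> set Bs"
    then obtain b where b: "b < 2 ^ t" "B = map w (L b)" by (auto simp: Bs_def)
    have "mset (concat (replicate n B)) = mset (concat (map (replicate n) B))" for n
    proof (induction n)
      case 0
      then show ?case by (induction B) auto
    next
      case (Suc n)
      have *: "mset (concat (map (replicate (Suc n)) B)) = mset B + mset (concat (map (replicate n) B))"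
        by (induction B) auto
      have "mset (concat (replicate (Suc n) B)) = mset B + mset (concat (map (replicate n) B))"
        by (simp add: Suc)
      then show ?case by (rule trans[OF _ *[symmetric]])
    qed
    then have "conc (concat (replicate (2 ^ t) B)) c = conc (concat (map (replicate (2 ^ t)) B)) c"
      by (rule conc_mset)
    also have "\<dots> \<le> central (2 ^ t) ^ card K"
    proof (rule conc_copies_le[OF assms(2)])
      fix \<beta> assume *: "\<forall>v\<in>set B. (\<Sum>m\<in>K. \<beta> m * v m) = 0"
      have "\<forall>j\<in>J b. (\<Sum>m\<in>K. \<beta> m * \<alpha> m j) = 0"
      proof
        fix j assume "j \<in> J b"
        then have "w j \<in> set B" using b L(1) by auto
        then have "(\<Sum>m\<in>K. \<beta> m * w j m) = 0" using * by blast
        then show "(\<Sum>m\<in>K. \<beta> m * \<alpha> m j) = 0" by (simp add: w_def)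
      qed
      then show "\<forall>m\<in>K. \<beta> m = 0" using J(2)[OF b(1)] unfolding indep_def by blast
    qed
    finally show "conc (concat (replicate (2 ^ t) B)) c \<le> central (2 ^ t) ^ card K" .
  qed (auto simp: Bs_def central_nonneg)
  moreover have "concat Bs = map w ps" by (simp add: Bs_def ps_def map_concat o_def)
  ultimately have "conc (map w ps) c' \<le> central (2 ^ t) ^ card K" for c' by simp
  then have "conc (map w ps @ map w rs) c' \<le> central (2 ^ t) ^ card K" for c'
    by (rule conc_append_le)
  then have "pr Z (\<lambda>z. \<forall>m\<in>K. dot Z (\<alpha> m) z = c m) \<le> central (2 ^ t) ^ card K"
    unfolding pr_eq_conc[OF ts] map_append w_def .
  also have "\<dots> \<le> (2 powr (- real t / 2)) ^ card K"
    by (intro power_mono central_power2_le central_nonneg)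
  finally show ?thesis .
qed

text \<open>One spanning block with a single copy of each step, for which \<open>central 1\<close>
  is one half.\<close>

lemma pr_forms_le_half:
  assumes "finite Z" "finite K" "indep K Z \<alpha>"
  shows "pr Z (\<lambda>z. \<forall>m\<in>K. dot Z (\<alpha> m) z = c m) \<le> (1 / 2) ^ card K"
proof -
  define ts where "ts = sorted_list_of_set Z"
  have ts: "distinct ts" "set ts = Z" using assms by (auto simp: ts_def)
  define w where "w = (\<lambda>t m. if m \<in> K then \<alpha> m t else 0)"
  have "concat (map (replicate 1) (map w ts)) = map w ts" by (induction ts) auto
  moreover have "conc (concat (map (replicate 1) (map w ts))) c' \<le> central 1 ^ card K" for c'
  proof (rule conc_copies_le[OF assms(2)])
    fix \<beta> assume *: "\<forall>v\<in>set (map w ts). (\<Sum>m\<in>K. \<beta> m * v m) = 0"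
    have "\<forall>j\<in>Z. (\<Sum>m\<in>K. \<beta> m * \<alpha> m j) = 0"
      using * ts by (auto simp: w_def)
    then show "\<forall>m\<in>K. \<beta> m = 0" using assms(3) unfolding indep_def by blast
  qed
  ultimately have "conc (map w ts) c' \<le> central 1 ^ card K" for c' by simp
  then show ?thesis unfolding pr_eq_conc[OF ts] w_def central_def by simp
qed

text \<open>Odlyzko's lemma, by eliminating the spanning vectors one at a time.\<close>

lemma pr_forms_in_span_le:
  assumes "finite Z" "finite M" "finite T" "indep T Z h"
  shows "pr Z (\<lambda>y. \<exists>\<theta>. \<forall>t\<in>T. dot Z (h t) y + c t = (\<Sum>m\<in>M. \<theta> m * w m t))
    \<le> (1 / 2) ^ (card T - card M)"
  using assms(2,3,4)
proof (induction M arbitrary: T h c w rule: finite_induct)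
  case empty
  have "pr Z (\<lambda>y. \<exists>\<theta>. \<forall>t\<in>T. dot Z (h t) y + c t = (\<Sum>m\<in>{}. \<theta> m * w m t))
      = pr Z (\<lambda>y. \<forall>t\<in>T. dot Z (h t) y = - c t)"
    by (rule pr_cong) (auto simp: add_eq_0_iff2)
  then show ?case using pr_forms_le_half[OF assms(1) empty] by simp
next
  case (insert k M)
  show ?case
  proof (cases "\<forall>t\<in>T. w k t = 0")
    case True
    have "pr Z (\<lambda>y. \<exists>\<theta>. \<forall>t\<in>T. dot Z (h t) y + c t = (\<Sum>m\<in>insert k M. \<theta> m * w m t))
      \<le> pr Z (\<lambda>y. \<exists>\<theta>. \<forall>t\<in>T. dot Z (h t) y + c t = (\<Sum>m\<in>M. \<theta> m * w m t))"
      by (rule pr_mono) (use True insert.hyps in \<open>auto simp: sum.insert\<close>)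
    also have "\<dots> \<le> (1 / 2) ^ (card T - card M)" by (rule insert.IH) fact+
    also have "\<dots> \<le> (1 / 2) ^ (card T - card (insert k M))"
      by (rule power_decreasing) (use insert.hyps in auto)
    finally show ?thesis .
  next
    case False
    then obtain u where u: "u \<in> T" "w k u \<noteq> 0" by blast
    \<comment> \<open>Elimination with pivot \<open>u\<close> removes the vector \<open>w k\<close>
      and the form \<open>h u\<close> together, so the difference of the two cardinalities, the
      exponent, is unchanged.\<close>
    define q where "q t = w k t / w k u" for t
    define h' where "h' t = (\<lambda>j. h t j - q t * h u j)" for t
    define c' where "c' t = c t - q t * c u" for t
    define w' where "w' m t = w m t - q t * w m u" for m t
    have dot': "dot Z (h' t) y = dot Z (h t) y - q t * dot Z (h u) y" for t y
      by (simp add: dot_def h'_def algebra_simps sum_subtractf sum_distrib_left)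
    have ind: "indep (T - {u}) Z h'"
      unfolding indep_def
    proof (intro allI impI)
      fix \<beta> assume *: "\<forall>j\<in>Z. (\<Sum>m\<in>T - {u}. \<beta> m * h' m j) = 0"
      define \<gamma> where "\<gamma> = \<beta>(u := - (\<Sum>m\<in>T - {u}. \<beta> m * q m))"
      have "(\<Sum>m\<in>T. \<gamma> m * h m j) = (\<Sum>m\<in>T - {u}. \<beta> m * h' m j)" for j
      proof -
        have "(\<Sum>m\<in>T. \<gamma> m * h m j) = \<gamma> u * h u j + (\<Sum>m\<in>T - {u}. \<gamma> m * h m j)"
          using u(1) insert.prems(1) by (simp add: sum.remove)
        also have "(\<Sum>m\<in>T - {u}. \<gamma> m * h m j) = (\<Sum>m\<in>T - {u}. \<beta> m * h m j)"
          by (rule sum.cong) (auto simp: \<gamma>_def)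
        also have "\<gamma> u * h u j + \<dots> = (\<Sum>m\<in>T - {u}. \<beta> m * h' m j)"
          by (simp add: \<gamma>_def h'_def algebra_simps sum_subtractf sum_distrib_left)
        finally show ?thesis .
      qed
      then have "\<forall>j\<in>Z. (\<Sum>m\<in>T. \<gamma> m * h m j) = 0" using * by simp
      then have "\<forall>m\<in>T. \<gamma> m = 0" using insert.prems(2) unfolding indep_def by blast
      then show "\<forall>m\<in>T - {u}. \<beta> m = 0" by (auto simp: \<gamma>_def split: if_splits)
    qed
    have "pr Z (\<lambda>y. \<exists>\<theta>. \<forall>t\<in>T. dot Z (h t) y + c t = (\<Sum>m\<in>insert k M. \<theta> m * w m t))
      \<le> pr Z (\<lambda>y. \<exists>\<theta>. \<forall>t\<in>T - {u}. dot Z (h' t) y + c' t = (\<Sum>m\<in>M. \<theta> m * w' m t))"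
    proof (rule pr_mono)
      fix y assume "\<exists>\<theta>. \<forall>t\<in>T. dot Z (h t) y + c t = (\<Sum>m\<in>insert k M. \<theta> m * w m t)"
      then obtain \<theta> where \<theta>: "\<And>t. t \<in> T \<Longrightarrow> dot Z (h t) y + c t = (\<Sum>m\<in>insert k M. \<theta> m * w m t)"
        by blast
      have "dot Z (h' t) y + c' t = (\<Sum>m\<in>M. \<theta> m * w' m t)" if "t \<in> T" for t
      proof -
        have "dot Z (h' t) y + c' t = (dot Z (h t) y + c t) - q t * (dot Z (h u) y + c u)"
          by (simp add: dot' c'_def algebra_simps)
        also have "\<dots> = \<theta> k * (w k t - q t * w k u) + ((\<Sum>m\<in>M. \<theta> m * w m t) - q t * (\<Sum>m\<in>M. \<theta> m * w m u))"
          unfolding \<theta>[OF that] \<theta>[OF u(1)] using insert.hyps by (simp add: algebra_simps)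
        also have "w k t - q t * w k u = 0" using u(2) by (simp add: q_def)
        also have "(\<Sum>m\<in>M. \<theta> m * w m t) - q t * (\<Sum>m\<in>M. \<theta> m * w m u) = (\<Sum>m\<in>M. \<theta> m * w' m t)"
          by (simp add: w'_def algebra_simps sum_subtractf sum_distrib_left)
        finally show ?thesis by simp
      qed
      then show "\<exists>\<theta>. \<forall>t\<in>T - {u}. dot Z (h' t) y + c' t = (\<Sum>m\<in>M. \<theta> m * w' m t)" by blast
    qed
    also have "\<dots> \<le> (1 / 2) ^ (card (T - {u}) - card M)"
      by (rule insert.IH) (use insert.prems ind in auto)
    also have "card (T - {u}) - card M = card T - card (insert k M)"
      using u(1) insert.prems(1) insert.hyps by simp
    finally show ?thesis .
  qed
qed

section \<open>Decoupling and quadratic functions\<close>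

lemma av_Cauchy_Schwarz: "(av I (\<lambda>x. f x * g x))\<^sup>2 \<le> av I (\<lambda>x. (f x)\<^sup>2) * av I (\<lambda>x. (g x)\<^sup>2)"
proof -
  have "(av I (\<lambda>x. f x * g x))\<^sup>2 = (\<Sum>x\<in>cube I. f x * g x)\<^sup>2 / (real (card (cube I)))\<^sup>2"
    by (simp add: av_def power_divide)
  also have "\<dots> \<le> ((\<Sum>x\<in>cube I. (f x)\<^sup>2) * (\<Sum>x\<in>cube I. (g x)\<^sup>2)) / (real (card (cube I)))\<^sup>2"
    by (intro divide_right_mono Cauchy_Schwarz_ineq_sum) auto
  also have "\<dots> = av I (\<lambda>x. (f x)\<^sup>2) * av I (\<lambda>x. (g x)\<^sup>2)"
    by (simp add: av_def power2_eq_square)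
  finally show ?thesis .
qed

lemma sum_pr_classes_le:
  assumes "finite I" "finite D"
  shows "(\<Sum>d\<in>D. pr I (\<lambda>x. \<rho> x = d)) \<le> 1"
  unfolding pr_def av_sum[symmetric]
proof (rule av_le_const[OF assms(1)])
  fix x
  have "(\<Sum>d\<in>D. of_bool (\<rho> x = d) :: real) = of_bool (\<rho> x \<in> D)"
    using assms(2) by (auto simp: of_bool_def sum.delta')
  then show "(\<Sum>d\<in>D. of_bool (\<rho> x = d) :: real) \<le> 1" by simp
qed

lemma le_sqrt_add_of_square_le:
  fixes a p q :: real
  assumes "a\<^sup>2 \<le> p + q * a" "0 \<le> p" "0 \<le> q"
  shows "a \<le> sqrt p + q"
proof (rule ccontr)
  assume "\<not> ?thesis"
  then have a: "a > sqrt p + q" by simp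
  have s: "0 \<le> sqrt p" using assms by simp
  have "a * a > (sqrt p + q) * a" by (rule mult_strict_right_mono[OF a]) (use a s assms in linarith)
  moreover have "sqrt p * a \<ge> sqrt p * sqrt p" using a s assms by (intro mult_left_mono) auto
  moreover have "sqrt p * sqrt p = p" using assms by simp
  ultimately show False using assms(1) by (simp add: power2_eq_square algebra_simps)
qed

text \<open>Cauchy--Schwarz within the classes \<open>\<sigma> z = d\<close>. Compared with Cauchy--Schwarz for the whole sum
  this gains the factor \<open>h0\<close>, the largest probability of a class.\<close>

lemma av_pr_decouple_le:
  assumes fin: "finite Y" "finite Z"
    and cls: "\<And>y z. y \<in> cube Y \<Longrightarrow> z \<in> cube Z \<Longrightarrow> P y z \<Longrightarrow> \<rho> y = \<sigma> z"
    and h0: "\<And>d. pr Z (\<lambda>z. \<sigma> z = d) \<le> h0"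
    and h2: "\<And>y0. y0 \<in> cube Y \<Longrightarrow> pr Y (\<lambda>y1. \<rho> y1 = \<rho> y0 \<and> B y0 y1) \<le> h2"
    and T: "\<And>y0 y1. y0 \<in> cube Y \<Longrightarrow> y1 \<in> cube Y \<Longrightarrow> \<rho> y1 = \<rho> y0 \<Longrightarrow> \<not> B y0 y1 \<Longrightarrow>
        pr Z (\<lambda>z. P y0 z \<and> P y1 z) \<le> T"
    and nonneg: "0 \<le> T" "0 \<le> h0" "0 \<le> h2"
  shows "av Y (\<lambda>y. pr Z (P y)) \<le> sqrt (h0 * T) + h2"
proof -
  define \<mu> where "\<mu> z = av Y (\<lambda>y. of_bool (P y z))" for z
  define \<pi> where "\<pi> d = pr Z (\<lambda>z. \<sigma> z = d)" for d
  define \<nu> where "\<nu> d = pr Y (\<lambda>y. \<rho> y = d)" for d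
  define a where "a d = av Z (\<lambda>z. of_bool (\<sigma> z = d) * \<mu> z)" for d
  define D where "D = \<sigma> ` cube Z"
  have D: "finite D" using fin by (simp add: D_def finite_cube)
  have \<mu>0: "0 \<le> \<mu> z" for z unfolding \<mu>_def by (rule av_nonneg) auto
  have a0: "0 \<le> a d" for d unfolding a_def by (rule av_nonneg) (use \<mu>0 in auto)
  have \<pi>0: "0 \<le> \<pi> d" and \<nu>0: "0 \<le> \<nu> d" for d by (auto simp: \<pi>_def \<nu>_def pr_nonneg)
  have a_swap: "a d = av Y (\<lambda>y. pr Z (\<lambda>z. \<sigma> z = d \<and> P y z))" for d
    unfolding a_def \<mu>_def pr_def av_cmult[symmetric]
    by (subst av_swap) (simp add: of_bool_conj)
  \<comment> \<open>Squaring produces pairs \<open>y0\<close>, \<open>y1\<close> in class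
    \<open>d\<close>. Good pairs contribute at most \<open>T\<close> each. For fixed
    \<open>y0\<close> the bad \<open>y1\<close> have probability at most \<open>h2\<close>, so the
    bad pairs contribute at most \<open>h2\<close> times the first power of \<open>a d\<close>. The
    resulting inequality is quadratic in \<open>a d\<close> and can be solved for it.\<close>
  have bound: "a d \<le> sqrt (h0 * T) * \<nu> d + \<pi> d * h2" for d
  proof -
    have "(a d)\<^sup>2 = (av Z (\<lambda>z. of_bool (\<sigma> z = d) * (of_bool (\<sigma> z = d) * \<mu> z)))\<^sup>2"
      unfolding a_def by (intro arg_cong[of _ _ "\<lambda>x. x\<^sup>2"] av_cong) auto
    also have "\<dots> \<le> av Z (\<lambda>z. (of_bool (\<sigma> z = d))\<^sup>2) * av Z (\<lambda>z. (of_bool (\<sigma> z = d) * \<mu> z)\<^sup>2)"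
      by (rule av_Cauchy_Schwarz)
    also have "av Z (\<lambda>z. (of_bool (\<sigma> z = d))\<^sup>2) = \<pi> d"
      unfolding \<pi>_def pr_def by (intro av_cong) auto
    also have "av Z (\<lambda>z. (of_bool (\<sigma> z = d) * \<mu> z)\<^sup>2)
        = av Y (\<lambda>y0. av Y (\<lambda>y1. pr Z (\<lambda>z. \<sigma> z = d \<and> P y0 z \<and> P y1 z)))"
    proof -
      have "av Z (\<lambda>z. (of_bool (\<sigma> z = d) * \<mu> z)\<^sup>2)
          = av Z (\<lambda>z. av Y (\<lambda>y0. av Y (\<lambda>y1. of_bool (\<sigma> z = d \<and> P y0 z \<and> P y1 z))))"
      proof (rule av_cong)
        fix z
        have "(of_bool (\<sigma> z = d) * \<mu> z)\<^sup>2 = of_bool (\<sigma> z = d) * (\<mu> z * \<mu> z)"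
          by (auto simp: power2_eq_square)
        also have "\<dots> = av Y (\<lambda>y0. av Y (\<lambda>y1. of_bool (\<sigma> z = d) * (of_bool (P y0 z) * of_bool (P y1 z))))"
          by (simp only: av_cmult av_cmult_right \<mu>_def)
        finally show "(of_bool (\<sigma> z = d) * \<mu> z)\<^sup>2 = av Y (\<lambda>y0. av Y (\<lambda>y1. of_bool (\<sigma> z = d \<and> P y0 z \<and> P y1 z)))"
          by (simp only: of_bool_conj)
      qed
      also have "\<dots> = av Y (\<lambda>y0. av Z (\<lambda>z. av Y (\<lambda>y1. of_bool (\<sigma> z = d \<and> P y0 z \<and> P y1 z))))"
        by (rule av_swap)
      also have "\<dots> = av Y (\<lambda>y0. av Y (\<lambda>y1. pr Z (\<lambda>z. \<sigma> z = d \<and> P y0 z \<and> P y1 z)))"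
        unfolding pr_def by (rule av_cong) (rule av_swap)
      finally show ?thesis .
    qed
    also have "\<dots> \<le> av Y (\<lambda>y0. of_bool (\<rho> y0 = d) * (\<nu> d * T) + h2 * pr Z (\<lambda>z. \<sigma> z = d \<and> P y0 z))"
    proof (rule av_mono)
      fix y0 assume y0: "y0 \<in> cube Y"
      let ?p = "pr Z (\<lambda>z. \<sigma> z = d \<and> P y0 z)"
      have "av Y (\<lambda>y1. pr Z (\<lambda>z. \<sigma> z = d \<and> P y0 z \<and> P y1 z))
          \<le> av Y (\<lambda>y1. of_bool (\<rho> y0 = d) * (of_bool (\<rho> y1 = d) * T)
                + of_bool (\<rho> y1 = \<rho> y0 \<and> B y0 y1) * ?p)"
      proof (rule av_mono)
        fix y1 assume y1: "y1 \<in> cube Y"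
        let ?q = "pr Z (\<lambda>z. \<sigma> z = d \<and> P y0 z \<and> P y1 z)"
        have p0: "0 \<le> ?p" by (rule pr_nonneg)
        show "?q \<le> of_bool (\<rho> y0 = d) * (of_bool (\<rho> y1 = d) * T) + of_bool (\<rho> y1 = \<rho> y0 \<and> B y0 y1) * ?p"
        proof (cases "\<rho> y0 = d \<and> \<rho> y1 = d")
          case False
          have "?q \<le> pr Z (\<lambda>_. False)"
            by (rule pr_mono) (use False cls[OF y0] cls[OF y1] in auto)
          also have "\<dots> = 0" using fin by (simp add: pr_def)
          finally have "?q \<le> 0" .
          moreover have "0 \<le> of_bool (\<rho> y0 = d) * (of_bool (\<rho> y1 = d) * T) + of_bool (\<rho> y1 = \<rho> y0 \<and> B y0 y1) * ?p"
            using p0 nonneg by (intro add_nonneg_nonneg mult_nonneg_nonneg) auto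
          ultimately show ?thesis by linarith
        next
          case True
          show ?thesis
          proof (cases "B y0 y1")
            case B: True
            have "?q \<le> ?p" by (rule pr_mono) auto
            then show ?thesis using True B nonneg by simp
          next
            case B: False
            have "?q \<le> pr Z (\<lambda>z. P y0 z \<and> P y1 z)" by (rule pr_mono) auto
            also have "\<dots> \<le> T" by (rule T) (use y0 y1 True B in auto)
            finally show ?thesis using True B by simp
          qed
        qed
      qed
      also have "\<dots> = of_bool (\<rho> y0 = d) * (\<nu> d * T) + pr Y (\<lambda>y1. \<rho> y1 = \<rho> y0 \<and> B y0 y1) * ?p"
        by (simp only: av_add av_cmult av_cmult_right \<nu>_def pr_def)
      also have "\<dots> \<le> of_bool (\<rho> y0 = d) * (\<nu> d * T) + h2 * ?p"
        using h2[OF y0] pr_nonneg by (intro add_left_mono mult_right_mono) auto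
      finally show "av Y (\<lambda>y1. pr Z (\<lambda>z. \<sigma> z = d \<and> P y0 z \<and> P y1 z))
          \<le> of_bool (\<rho> y0 = d) * (\<nu> d * T) + h2 * ?p" .
    qed
    also have "\<dots> = \<nu> d * (\<nu> d * T) + h2 * a d"
      by (simp only: av_add av_cmult av_cmult_right a_swap) (simp only: \<nu>_def pr_def)
    finally have "(a d)\<^sup>2 \<le> \<pi> d * (\<nu> d * (\<nu> d * T) + h2 * a d)"
      using \<pi>0 by (simp add: mult_left_mono)
    then have "(a d)\<^sup>2 \<le> \<pi> d * T * (\<nu> d)\<^sup>2 + (\<pi> d * h2) * a d"
      by (simp add: algebra_simps power2_eq_square)
    then have "a d \<le> sqrt (\<pi> d * T * (\<nu> d)\<^sup>2) + \<pi> d * h2"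
      by (rule le_sqrt_add_of_square_le) (use \<pi>0 nonneg in auto)
    also have "sqrt (\<pi> d * T * (\<nu> d)\<^sup>2) = sqrt (\<pi> d * T) * \<nu> d"
      using \<nu>0 by (simp add: real_sqrt_mult)
    also have "sqrt (\<pi> d * T) * \<nu> d \<le> sqrt (h0 * T) * \<nu> d"
      using h0 nonneg \<nu>0 by (intro mult_right_mono real_sqrt_le_mono) (auto simp: \<pi>_def)
    finally show ?thesis by simp
  qed
  have "av Y (\<lambda>y. pr Z (P y)) = av Z \<mu>"
    unfolding pr_def \<mu>_def by (rule av_swap)
  also have "\<dots> = av Z (\<lambda>z. \<Sum>d\<in>D. of_bool (\<sigma> z = d) * \<mu> z)"
  proof (rule av_cong)
    fix z assume "z \<in> cube Z"
    then have "\<sigma> z \<in> D" by (simp add: D_def)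
    then have "(\<Sum>d\<in>D. of_bool (\<sigma> z = d)) = (1::real)" using D by (simp add: of_bool_def sum.delta')
    then show "\<mu> z = (\<Sum>d\<in>D. of_bool (\<sigma> z = d) * \<mu> z)" by (simp only: sum_distrib_right[symmetric])
  qed
  also have "\<dots> = (\<Sum>d\<in>D. a d)" unfolding a_def by (rule av_sum)
  also have "\<dots> \<le> (\<Sum>d\<in>D. sqrt (h0 * T) * \<nu> d + \<pi> d * h2)" by (rule sum_mono) (rule bound)
  also have "\<dots> = sqrt (h0 * T) * (\<Sum>d\<in>D. \<nu> d) + (\<Sum>d\<in>D. \<pi> d) * h2"
    by (simp only: sum.distrib sum_distrib_left sum_distrib_right)
  also have "\<dots> \<le> sqrt (h0 * T) * 1 + 1 * h2"
    unfolding \<pi>_def \<nu>_def using fin D nonneg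
    by (intro add_mono mult_left_mono mult_right_mono sum_pr_classes_le) auto
  finally show ?thesis by simp
qed

text \<open>The coefficient vector of the linear form that arises from the bilinear form by fixing
  its first argument.\<close>

definition bil :: "nat set \<Rightarrow> (nat \<Rightarrow> nat \<Rightarrow> complex) \<Rightarrow> (nat \<Rightarrow> complex) \<Rightarrow> nat \<Rightarrow> complex" where
  "bil I b u = (\<lambda>j. \<Sum>i\<in>I. b i j * u i)"

definition qf :: "nat set \<Rightarrow> (nat \<Rightarrow> nat \<Rightarrow> complex) \<Rightarrow> (nat \<Rightarrow> complex) \<Rightarrow> complex \<Rightarrow> (nat \<Rightarrow> complex) \<Rightarrow> complex" where
  "qf I b l k x = k + dot I l x + dot I (bil I b x) x"

lemma dot_scale: "dot I a (\<lambda>i. t * x i) = t * dot I a x"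
  by (simp add: dot_def sum_distrib_left mult.left_commute)

lemma dot_lincomb_left: "dot I (\<lambda>i. s * a i + t * b i) x = s * dot I a x + t * dot I b x"
  by (simp add: dot_def sum_distrib_left algebra_simps sum.distrib)

lemma dot_add_left: "dot I (\<lambda>i. a i + b i) x = dot I a x + dot I b x"
  using dot_lincomb_left[of I 1 a 1 b x] by simp

lemma dot_scale_left: "dot I (\<lambda>i. t * a i) x = t * dot I a x"
  using dot_lincomb_left[of I t a 0 "\<lambda>_. 0" x] by simp

lemma dot_sum_left: "dot I (\<lambda>i. \<Sum>m\<in>K. \<beta> m * \<alpha> m i) x = (\<Sum>m\<in>K. \<beta> m * dot I (\<alpha> m) x)"
proof -
  have "dot I (\<lambda>i. \<Sum>m\<in>K. \<beta> m * \<alpha> m i) x = (\<Sum>i\<in>I. \<Sum>m\<in>K. \<beta> m * (\<alpha> m i * x i))"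
    by (simp add: dot_def sum_distrib_right mult.assoc)
  also have "\<dots> = (\<Sum>m\<in>K. \<Sum>i\<in>I. \<beta> m * (\<alpha> m i * x i))" by (rule sum.swap)
  finally show ?thesis by (simp add: dot_def sum_distrib_left)
qed

lemma dot_cong: "(\<And>i. i \<in> I \<Longrightarrow> a i = a' i) \<Longrightarrow> dot I a x = dot I a' x"
  by (auto simp: dot_def intro!: sum.cong)

lemma dot_subset: "finite I \<Longrightarrow> Z \<subseteq> I \<Longrightarrow> z \<in> cube Z \<Longrightarrow> dot I a z = dot Z a z"
  unfolding dot_def by (rule sum.mono_neutral_right) (auto simp: cube_def)

lemma bil_add: "bil I b (x + y) = (\<lambda>j. bil I b x j + bil I b y j)"
  by (simp add: bil_def fun_eq_iff algebra_simps sum.distrib)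

lemma bil_scale: "bil I b (\<lambda>i. t * x i) = (\<lambda>j. t * bil I b x j)"
  by (simp add: bil_def fun_eq_iff sum_distrib_left mult.left_commute)

lemma dot_bil: "dot I (bil I b x) y = (\<Sum>i\<in>I. \<Sum>j\<in>I. b i j * x i * y j)"
proof -
  have "dot I (bil I b x) y = (\<Sum>j\<in>I. \<Sum>i\<in>I. b i j * x i * y j)"
    by (simp add: dot_def bil_def sum_distrib_right)
  then show ?thesis by (subst sum.swap)
qed

definition sym_on :: "nat set \<Rightarrow> (nat \<Rightarrow> nat \<Rightarrow> complex) \<Rightarrow> bool" where
  "sym_on I b \<longleftrightarrow> (\<forall>i\<in>I. \<forall>j\<in>I. b i j = b j i)"

lemma dot_bil_commute:
  assumes "sym_on I b"
  shows "dot I (bil I b x) y = dot I (bil I b y) x"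
proof -
  have "dot I (bil I b x) y = (\<Sum>i\<in>I. \<Sum>j\<in>I. b j i * y j * x i)"
    unfolding dot_bil by (intro sum.cong refl) (use assms in \<open>simp add: sym_on_def mult_ac\<close>)
  also have "\<dots> = dot I (bil I b y) x" unfolding dot_bil by (rule sum.swap)
  finally show ?thesis .
qed

lemma qf_add:
  assumes "sym_on I b"
  shows "qf I b l k (x + u) = qf I b l k x + dot I l u + 2 * dot I (bil I b x) u + dot I (bil I b u) u"
  using dot_bil_commute[OF assms, of x u]
  by (simp add: qf_def dot_add bil_add dot_add_left)

text \<open>Translation does not touch the bilinear part; so after fixing some variables one has a
  quadratic function of the same kind in the others.\<close>

lemma qf_shift:
  assumes "sym_on I b"
  shows "qf I b l k (x + u) = qf I b (\<lambda>i. l i + 2 * bil I b x i) (qf I b l k x) u"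
  unfolding qf_add[OF assms] by (simp add: qf_def dot_add_left dot_scale_left)

lemma dependent_combination:
  assumes "indep {..<j} I \<alpha>" "\<not> indep {..<Suc j} I (\<alpha>(j := g))"
  obtains \<beta> where "\<And>i. i \<in> I \<Longrightarrow> g i = (\<Sum>m<j. \<beta> m * \<alpha> m i)"
proof -
  obtain \<beta> where \<beta>: "\<forall>i\<in>I. (\<Sum>m<Suc j. \<beta> m * (\<alpha>(j := g)) m i) = 0" "\<not> (\<forall>m<Suc j. \<beta> m = 0)"
    using assms(2) unfolding indep_def by auto
  have *: "(\<Sum>m<j. \<beta> m * \<alpha> m i) + \<beta> j * g i = 0" if "i \<in> I" for i
  proof -
    have "(\<Sum>m<j. \<beta> m * (\<alpha>(j := g)) m i) = (\<Sum>m<j. \<beta> m * \<alpha> m i)" by (rule sum.cong) auto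
    then show ?thesis using \<beta>(1) that by auto
  qed
  have "\<beta> j \<noteq> 0"
  proof
    assume 0: "\<beta> j = 0"
    then have "\<forall>m\<in>{..<j}. \<beta> m = 0" using assms(1) * unfolding indep_def by auto
    with 0 \<beta>(2) show False by (auto simp: less_Suc_eq)
  qed
  show ?thesis
  proof (rule that)
    fix i assume "i \<in> I"
    from *[OF this] have "g i = - (\<Sum>m<j. \<beta> m * \<alpha> m i) / \<beta> j"
      using \<open>\<beta> j \<noteq> 0\<close> by (simp add: field_simps add_eq_0_iff)
    then show "g i = (\<Sum>m<j. (- \<beta> m / \<beta> j) * \<alpha> m i)"
      by (simp add: sum_divide_distrib sum_negf)
  qed
qed

text \<open>By induction there are dual vectors for the forms in \<open>K\<close>. If every common
  zero of these forms were a zero of the new form as well, expanding unit vectors along the dual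
  vectors would make the new form a combination of the others.\<close>

lemma indep_surj:
  assumes "finite K" "finite I" "indep K I \<alpha>"
  shows "\<exists>x. \<forall>m\<in>K. dot I (\<alpha> m) x = c m"
  using assms(1,3)
proof (induction K arbitrary: c rule: finite_induct)
  case (insert k K)
  have indK: "indep K I \<alpha>"
    unfolding indep_def
  proof (intro allI impI)
    fix \<beta> assume *: "\<forall>j\<in>I. (\<Sum>m\<in>K. \<beta> m * \<alpha> m j) = 0"
    have "(\<Sum>m\<in>insert k K. (\<beta>(k := 0)) m * \<alpha> m j) = (\<Sum>m\<in>K. \<beta> m * \<alpha> m j)" for j
      using insert.hyps by (auto intro!: sum.cong)
    then have "\<forall>m\<in>insert k K. (\<beta>(k := 0)) m = 0"
      using insert.prems * unfolding indep_def by metis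
    then show "\<forall>m\<in>K. \<beta> m = 0" using insert.hyps by (auto split: if_splits)
  qed
  obtain w where w: "\<And>m m'. m \<in> K \<Longrightarrow> dot I (\<alpha> m) (w m') = of_bool (m = m')"
  proof -
    have "\<forall>m'. \<exists>x. \<forall>m\<in>K. dot I (\<alpha> m) x = of_bool (m = m')"
      by (intro allI insert.IH[OF indK])
    then obtain w where "\<forall>m'. \<forall>m\<in>K. dot I (\<alpha> m) (w m') = of_bool (m = m')" by (rule choice[elim_format]) blast
    then show ?thesis using that by blast
  qed
  have "\<exists>v. (\<forall>m\<in>K. dot I (\<alpha> m) v = 0) \<and> dot I (\<alpha> k) v \<noteq> 0"
  proof (rule ccontr)
    assume no: "\<not> ?thesis"
    have eq: "\<alpha> k i = (\<Sum>m\<in>K. \<alpha> m i * dot I (\<alpha> k) (w m))" if i: "i \<in> I" for i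
    proof -
      \<comment> \<open>Subtracting its components along the dual vectors turns the unit vector at
        \<open>i\<close> into a common zero of the forms in \<open>K\<close>.\<close>
      define v where "v = (\<lambda>j. unit_fun i j - (\<Sum>m\<in>K. \<alpha> m i * w m j))"
      have dv: "dot I a v = a i - (\<Sum>m\<in>K. \<alpha> m i * dot I a (w m))" for a
      proof -
        have "dot I a v = (\<Sum>j\<in>I. a j * unit_fun i j) - (\<Sum>j\<in>I. \<Sum>m\<in>K. \<alpha> m i * (a j * w m j))"
          by (simp add: dot_def v_def right_diff_distrib sum_subtractf sum_distrib_left mult.left_commute)
        also have "(\<Sum>j\<in>I. \<Sum>m\<in>K. \<alpha> m i * (a j * w m j)) = (\<Sum>m\<in>K. \<alpha> m i * dot I a (w m))"
          by (subst sum.swap) (simp add: dot_def sum_distrib_left)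
        also have "(\<Sum>j\<in>I. a j * unit_fun i j) = a i"
          using i assms(2) by (simp add: unit_fun_def)
        finally show ?thesis .
      qed
      have "\<forall>m\<in>K. dot I (\<alpha> m) v = 0"
        using insert.hyps by (simp add: dv w)
      then have "dot I (\<alpha> k) v = 0" using no by blast
      then show ?thesis by (simp add: dv)
    qed
    define \<beta> where "\<beta> m = (if m = k then -1 else dot I (\<alpha> k) (w m))" for m
    have "(\<Sum>m\<in>insert k K. \<beta> m * \<alpha> m i) = 0" if "i \<in> I" for i
    proof -
      have "(\<Sum>m\<in>K. \<beta> m * \<alpha> m i) = (\<Sum>m\<in>K. \<alpha> m i * dot I (\<alpha> k) (w m))"
        by (rule sum.cong) (use insert.hyps in \<open>auto simp: \<beta>_def\<close>)
      then show ?thesis using insert.hyps eq[OF that] by (simp add: \<beta>_def)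
    qed
    then have "\<beta> k = 0" using insert.prems unfolding indep_def by blast
    then show False by (simp add: \<beta>_def)
  qed
  then obtain v where v: "\<And>m. m \<in> K \<Longrightarrow> dot I (\<alpha> m) v = 0" "dot I (\<alpha> k) v \<noteq> 0" by blast
  obtain x where x: "\<And>m. m \<in> K \<Longrightarrow> dot I (\<alpha> m) x = c m" using insert.IH[OF indK] by blast
  define s where "s = (c k - dot I (\<alpha> k) x) / dot I (\<alpha> k) v"
  have sk: "s * dot I (\<alpha> k) v = c k - dot I (\<alpha> k) x" using v(2) by (simp add: s_def)
  have "\<forall>m\<in>insert k K. dot I (\<alpha> m) (x + (\<lambda>i. s * v i)) = c m"
    using v x sk by (auto simp: dot_add dot_scale)
  then show ?case by blast
qed auto

section \<open>Quadratic functions of few linear forms\<close>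

definition lin_space :: "(nat \<Rightarrow> complex) set \<Rightarrow> bool" where
  "lin_space E \<longleftrightarrow> (\<lambda>_. 0) \<in> E \<and> (\<forall>g\<in>E. \<forall>h\<in>E. \<forall>t. (\<lambda>i. g i + t * h i) \<in> E)"

lemma lin_spaceD: "lin_space E \<Longrightarrow> g \<in> E \<Longrightarrow> h \<in> E \<Longrightarrow> (\<lambda>i. g i + t * h i) \<in> E"
  by (auto simp: lin_space_def)

lemma lin_space_sum:
  assumes "lin_space E" "finite K" "\<And>m. m \<in> K \<Longrightarrow> \<alpha> m \<in> E"
  shows "(\<lambda>i. \<Sum>m\<in>K. \<beta> m * \<alpha> m i) \<in> E"
  using assms(2,3)
proof (induction K rule: finite_induct)
  case empty
  then show ?case using assms(1) by (simp add: lin_space_def)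
next
  case (insert k K)
  then have "(\<lambda>i. (\<Sum>m\<in>K. \<beta> m * \<alpha> m i) + \<beta> k * \<alpha> k i) \<in> E"
    by (intro lin_spaceD[OF assms(1)]) auto
  then show ?case using insert.hyps by (simp add: add.commute)
qed

text \<open>Blocks play the role of bases: they survive passing to fewer forms, and a family of disjoint blocks
  can be split when the variables are split.\<close>

locale quad_system =
  fixes I :: "nat set" and E :: "(nat \<Rightarrow> complex) set" and b :: "nat \<Rightarrow> nat \<Rightarrow> complex"
  assumes fin: "finite I" and lin: "lin_space E" and sym: "sym_on I b" and bilE: "bil I b u \<in> E"
begin

text \<open>Restriction from \<open>I\<close> to \<open>J\<close> is injective on \<open>E\<close>.
  Hence a family in \<open>E\<close> that is independent on \<open>I\<close> stays independent on
  every block, which is the hypothesis of Halasz' inequality.\<close>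

definition block :: "nat set \<Rightarrow> bool" where
  "block J \<longleftrightarrow> (\<forall>g\<in>E. (\<forall>j\<in>J. g j = 0) \<longrightarrow> (\<forall>i\<in>I. g i = 0))"

lemma blockD: "block J \<Longrightarrow> g \<in> E \<Longrightarrow> (\<And>j. j \<in> J \<Longrightarrow> g j = 0) \<Longrightarrow> i \<in> I \<Longrightarrow> g i = 0"
  by (auto simp: block_def)

definition block_system :: "nat \<Rightarrow> nat set \<Rightarrow> (nat \<Rightarrow> nat set) \<Rightarrow> bool" where
  "block_system t Z J \<longleftrightarrow> Z \<subseteq> I \<and> (\<forall>b<2 ^ t. J b \<subseteq> Z \<and> block (J b)) \<and> disjoint_family_on J {..<2 ^ t}"

definition form_flat :: "nat \<Rightarrow> (nat \<Rightarrow> nat \<Rightarrow> complex) \<Rightarrow> (nat \<Rightarrow> complex) \<Rightarrow> (nat \<Rightarrow> complex) set" where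
  "form_flat j \<alpha> c = {x. \<forall>m<j. dot I (\<alpha> m) x = c m}"

lemma block_system_finite: "block_system t Z J \<Longrightarrow> finite Z"
  using fin finite_subset by (auto simp: block_system_def)

lemma block_system_forms_le:
  assumes "block_system t Z J" "finite K" "\<And>m. m \<in> K \<Longrightarrow> \<alpha> m \<in> E" "indep K I \<alpha>"
  shows "pr Z (\<lambda>z. \<forall>m\<in>K. dot I (\<alpha> m) z = c m) \<le> 2 powr (- real t * real (card K) / 2)"
proof -
  have Z: "Z \<subseteq> I" using assms(1) by (simp add: block_system_def)
  have "pr Z (\<lambda>z. \<forall>m\<in>K. dot I (\<alpha> m) z = c m) = pr Z (\<lambda>z. \<forall>m\<in>K. dot Z (\<alpha> m) z = c m)"
    by (rule pr_cong) (simp add: dot_subset[OF fin Z])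
  also have "\<dots> \<le> (2 powr (- real t / 2)) ^ card K"
  proof (rule pr_forms_le[OF block_system_finite[OF assms(1)] assms(2)])
    show "J b \<subseteq> Z" if "b < 2 ^ t" for b using assms(1) that by (auto simp: block_system_def)
    show "disjoint_family_on J {..<2 ^ t}" using assms(1) by (auto simp: block_system_def)
    fix b :: nat assume b: "b < 2 ^ t"
    show "indep K (J b) \<alpha>"
      unfolding indep_def
    proof (intro allI impI)
      fix \<beta> assume *: "\<forall>j\<in>J b. (\<Sum>m\<in>K. \<beta> m * \<alpha> m j) = 0"
      have bJ: "block (J b)" using assms(1) b by (simp add: block_system_def)
      have gE: "(\<lambda>i. \<Sum>m\<in>K. \<beta> m * \<alpha> m i) \<in> E"
        by (rule lin_space_sum[OF lin assms(2)]) (rule assms(3))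
      have "\<forall>i\<in>I. (\<Sum>m\<in>K. \<beta> m * \<alpha> m i) = 0"
        using blockD[OF bJ gE] * by simp
      then show "\<forall>m\<in>K. \<beta> m = 0" using assms(4) unfolding indep_def by blast
    qed
  qed
  also have "\<dots> = 2 powr (- real t * real (card K) / 2)"
    by (simp add: powr_power mult.commute)
  finally show ?thesis .
qed

lemma block_system_split:
  assumes "block_system (Suc t) Z J"
  obtains Y J' where "Y \<subseteq> Z" "block_system t Y J" "block_system t (Z - Y) J'"
proof -
  \<comment> \<open>Half of the blocks; the other half and all variables outside the blocks stay in
    \<open>Z - Y\<close>.\<close>
  define Y where "Y = (\<Union>b<2 ^ t. J b)"
  have sub: "b < 2 ^ t \<Longrightarrow> b < 2 ^ Suc t" "b < 2 ^ t \<Longrightarrow> b + 2 ^ t < 2 ^ Suc t" for b :: nat by auto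
  have J: "J b \<subseteq> Z" "block (J b)" if "b < 2 ^ Suc t" for b
    using assms that by (auto simp: block_system_def)
  have dj: "J b \<inter> J b' = {}" if "b < 2 ^ Suc t" "b' < 2 ^ Suc t" "b \<noteq> b'" for b b'
    using assms that unfolding block_system_def disjoint_family_on_def by blast
  have Z: "Z \<subseteq> I" using assms by (simp add: block_system_def)
  have Y: "Y \<subseteq> Z" unfolding Y_def using J(1) sub(1) by (intro UN_least) auto
  have "block_system t Y J"
    unfolding block_system_def
  proof (intro conjI allI impI)
    show "Y \<subseteq> I" using Y Z by blast
    show "J b \<subseteq> Y" if "b < 2 ^ t" for b using that by (auto simp: Y_def)
    show "block (J b)" if "b < 2 ^ t" for b using that J(2) sub(1) by blast
    show "disjoint_family_on J {..<2 ^ t}"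
      unfolding disjoint_family_on_def using dj sub(1) by blast
  qed
  moreover have "block_system t (Z - Y) (\<lambda>b. J (b + 2 ^ t))"
    unfolding block_system_def
  proof (intro conjI allI impI)
    show "Z - Y \<subseteq> I" using Z by blast
    show "J (b + 2 ^ t) \<subseteq> Z - Y" if b: "b < 2 ^ t" for b
    proof -
      have "J (b + 2 ^ t) \<inter> J b' = {}" if "b' < 2 ^ t" for b'
        by (rule dj) (use sub b that in auto)
      then show ?thesis using J(1)[OF sub(2)[OF b]] by (auto simp: Y_def)
    qed
    show "block (J (b + 2 ^ t))" if "b < 2 ^ t" for b using that J(2) sub(2) by blast
    show "disjoint_family_on (\<lambda>b. J (b + 2 ^ t)) {..<2 ^ t}"
      unfolding disjoint_family_on_def
    proof (intro ballI impI)
      fix m n :: nat assume "m \<in> {..<2 ^ t}" "n \<in> {..<2 ^ t}" "m \<noteq> n"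
      then show "J (m + 2 ^ t) \<inter> J (n + 2 ^ t) = {}" by (intro dj sub) auto
    qed
  qed
  ultimately show ?thesis using that Y by blast
qed

lemma all_less_Suc_upd_forms: "(\<forall>m<Suc j. dot I ((\<alpha>(j := g)) m) x = (c(j := c')) m)
    \<longleftrightarrow> (\<forall>m<j. dot I (\<alpha> m) x = c m) \<and> dot I g x = c'"
  by (auto simp: less_Suc_eq)

lemma form_flat_Suc: "form_flat (Suc j) (\<alpha>(j := g)) (c(j := c')) = {x \<in> form_flat j \<alpha> c. dot I g x = c'}"
  unfolding form_flat_def all_less_Suc_upd_forms by auto

lemma block_system_flat_le:
  assumes "block_system t Z J" "\<And>m. m < j \<Longrightarrow> \<alpha> m \<in> E" "indep {..<j} I \<alpha>"
  shows "pr Z (\<lambda>z. z \<in> form_flat j \<alpha> c) \<le> 2 powr (- real t * real j / 2)"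
  using block_system_forms_le[OF assms(1), of "{..<j}" \<alpha> c] assms(2,3) by (simp add: form_flat_def Ball_def)

text \<open>If the quadratic function vanishes on a hyperplane of the flat, it is there a product of two
  affine functions.\<close>

lemma block_system_reducible_le:
  assumes S: "block_system t Z J" and \<alpha>: "\<And>m. m < j \<Longrightarrow> \<alpha> m \<in> E" "indep {..<j} I \<alpha>"
    and nz: "\<exists>x\<in>form_flat j \<alpha> c. qf I b l k x \<noteq> 0"
    and g: "g \<in> E" "indep {..<Suc j} I (\<alpha>(j := g))"
    and van: "\<And>x. x \<in> form_flat j \<alpha> c \<Longrightarrow> dot I g x = c' \<Longrightarrow> qf I b l k x = 0"
  shows "pr Z (\<lambda>z. z \<in> form_flat j \<alpha> c \<and> qf I b l k z = 0) \<le> 2 * 2 powr (- real t * real (Suc j) / 2)"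
proof -
  obtain w where "\<forall>m\<in>{..<Suc j}. dot I ((\<alpha>(j := g)) m) w = of_bool (m = j)"
    using indep_surj[OF _ fin g(2), of "\<lambda>m. of_bool (m = j)"] by auto
  then have w: "\<And>m. m < j \<Longrightarrow> dot I (\<alpha> m) w = 0" "dot I g w = 1" by (auto simp: Ball_def less_Suc_eq split: if_splits)
  define B where "B = dot I (bil I b w) w"
  define \<gamma> where "\<gamma> = (\<lambda>i. 2 * bil I b w i + (- B) * g i)"
  define \<kappa> where "\<kappa> = dot I l w + c' * B"
  have \<gamma>E: "\<gamma> \<in> E"
  proof -
    have "(\<lambda>i. bil I b w i + 1 * bil I b w i) \<in> E" by (rule lin_spaceD[OF lin bilE bilE])
    from lin_spaceD[OF lin this g(1), of "- B"]
    have "(\<lambda>i. bil I b w i + 1 * bil I b w i + - B * g i) \<in> E" .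
    also have "(\<lambda>i. bil I b w i + 1 * bil I b w i + - B * g i) = \<gamma>"
      unfolding \<gamma>_def by (rule ext) simp
    finally show ?thesis .
  qed
  have fact: "qf I b l k v = (dot I g v - c') * (dot I \<gamma> v + \<kappa>)" if v: "v \<in> form_flat j \<alpha> c" for v
  proof -
    define \<tau> where "\<tau> = dot I g v - c'"
    define s where "s = - \<tau>"
    define v' where "v' = v + (\<lambda>i. s * w i)"
    have "v' \<in> form_flat j \<alpha> c" using v w by (simp add: form_flat_def v'_def dot_add dot_scale)
    moreover have "dot I g v' = c'" unfolding v'_def dot_add dot_scale by (simp add: w \<tau>_def s_def)
    ultimately have v'0: "qf I b l k v' = 0" by (rule van)
    have vv: "v = v' + (\<lambda>i. \<tau> * w i)" by (simp add: v'_def s_def fun_eq_iff)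
    have "dot I (bil I b v') w = dot I (bil I b w) v'" by (rule dot_bil_commute[OF sym])
    also have "\<dots> = dot I (bil I b w) v - \<tau> * B" unfolding v'_def dot_add dot_scale by (simp add: B_def s_def)
    finally have e: "dot I (bil I b v') w = dot I (bil I b w) v - \<tau> * B" .
    have "qf I b l k v = \<tau> * dot I l w + 2 * (\<tau> * dot I (bil I b v') w) + \<tau> * (\<tau> * B)"
      by (subst vv) (simp add: qf_add[OF sym] v'0 dot_scale bil_scale dot_scale_left B_def)
    also have "\<dots> = \<tau> * (2 * dot I (bil I b w) v - B * (\<tau> + c') + \<kappa>)"
      unfolding e \<kappa>_def by (simp add: algebra_simps)
    also have "2 * dot I (bil I b w) v - B * (\<tau> + c') = dot I \<gamma> v"
      unfolding \<gamma>_def dot_lincomb_left by (simp add: \<tau>_def)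
    finally show ?thesis by (simp add: \<tau>_def)
  qed
  have p1: "pr Z (\<lambda>z. z \<in> form_flat (Suc j) (\<alpha>(j := h)) (c(j := c''))) \<le> 2 powr (- real t * real (Suc j) / 2)"
    if "h \<in> E" "indep {..<Suc j} I (\<alpha>(j := h))" for h c''
    by (rule block_system_flat_le[OF S _ that(2)]) (use that \<alpha> in \<open>auto simp: less_Suc_eq\<close>)
  show ?thesis
  proof (cases "indep {..<Suc j} I (\<alpha>(j := \<gamma>))")
    case True
    have "pr Z (\<lambda>z. z \<in> form_flat j \<alpha> c \<and> qf I b l k z = 0)
      \<le> pr Z (\<lambda>z. z \<in> form_flat (Suc j) (\<alpha>(j := g)) (c(j := c')))
        + pr Z (\<lambda>z. z \<in> form_flat (Suc j) (\<alpha>(j := \<gamma>)) (c(j := - \<kappa>)))"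
      by (rule pr_disj_le) (auto simp: form_flat_Suc fact eq_neg_iff_add_eq_0)
    then show ?thesis using p1[OF g, of c'] p1[OF \<gamma>E True, of "- \<kappa>"] by simp
  next
    \<comment> \<open>The second factor is constant on the flat, and by \<open>nz\<close> this
      constant is nonzero, so only the hyperplane \<open>g = c'\<close> remains.\<close>
    case False
    then obtain \<beta> where \<beta>: "\<And>i. i \<in> I \<Longrightarrow> \<gamma> i = (\<Sum>m<j. \<beta> m * \<alpha> m i)"
      using dependent_combination[OF \<alpha>(2)] by metis
    have dg: "dot I \<gamma> v = (\<Sum>m<j. \<beta> m * c m)" if "v \<in> form_flat j \<alpha> c" for v
    proof -
      have "dot I \<gamma> v = (\<Sum>m<j. \<beta> m * dot I (\<alpha> m) v)"
        unfolding dot_sum_left[symmetric] by (rule dot_cong) (rule \<beta>)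
      then show ?thesis using that by (simp add: form_flat_def)
    qed
    obtain x where x: "x \<in> form_flat j \<alpha> c" "qf I b l k x \<noteq> 0" using nz by blast
    then have nz': "(\<Sum>m<j. \<beta> m * c m) + \<kappa> \<noteq> 0" using fact[OF x(1)] dg[OF x(1)] by auto
    have "pr Z (\<lambda>z. z \<in> form_flat j \<alpha> c \<and> qf I b l k z = 0)
      \<le> pr Z (\<lambda>z. z \<in> form_flat (Suc j) (\<alpha>(j := g)) (c(j := c')))"
      by (rule pr_mono) (use nz' in \<open>auto simp: form_flat_Suc fact dg\<close>)
    also note p1[OF g, of c']
    finally show ?thesis by (smt (verit) powr_ge_zero)
  qed
qed

text \<open>Otherwise a single form \<open>g\<close> would do, and the quadratic function would vanish on the hyperplane
  \<open>g = g v\<close> of the flat.\<close>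

lemma irreducible_two_forms:
  assumes \<alpha>: "\<And>m. m < j \<Longrightarrow> \<alpha> m \<in> E" "indep {..<j} I \<alpha>"
    and nz: "\<exists>x\<in>form_flat j \<alpha> c. qf I b l k x \<noteq> 0"
    and irr: "\<And>g c'. g \<in> E \<Longrightarrow> indep {..<Suc j} I (\<alpha>(j := g)) \<Longrightarrow>
        \<exists>x\<in>form_flat j \<alpha> c. dot I g x = c' \<and> qf I b l k x \<noteq> 0"
    and l: "l \<in> E" and v: "v \<in> form_flat j \<alpha> c" "qf I b l k v = 0"
  obtains g1 g2 where "g1 \<in> E" "g2 \<in> E" "indep {..<Suc (Suc j)} I (\<alpha>(j := g1, Suc j := g2))"
    "\<And>u. (\<And>w. w \<in> form_flat j \<alpha> (\<lambda>_. 0) \<Longrightarrow> dot I (bil I b w) u = 0) \<Longrightarrow>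
        dot I l u + 2 * dot I (bil I b v) u = 0 \<Longrightarrow> dot I g1 u = 0 \<and> dot I g2 u = 0"
proof -
  define l' where "l' = (\<lambda>i. l i + 2 * bil I b v i)"
  have l'E: "l' \<in> E" unfolding l'_def by (rule lin_spaceD[OF lin l bilE])
  \<comment> \<open>As \<open>l'\<close> is the linear part of the expansion around the zero
    \<open>v\<close>, the quadratic function vanishes at each \<open>x\<close> in the flat for which
    all forms in \<open>G\<close> vanish at \<open>x - v\<close>. So \<open>G\<close> has rank at
    least one modulo the forms of the flat by \<open>nz\<close>, and at least two by
    \<open>irr\<close>.\<close>
  define G where "G = insert l' {bil I b w |w. w \<in> form_flat j \<alpha> (\<lambda>_. 0)}"
  have GE: "G \<subseteq> E" using l'E bilE by (auto simp: G_def)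
  have key: "qf I b l k x = 0"
    if x: "x \<in> form_flat j \<alpha> c" and G0: "\<And>h. h \<in> G \<Longrightarrow> dot I h (x - v) = 0" for x
  proof -
    define u where "u = x - v"
    have u: "u \<in> form_flat j \<alpha> (\<lambda>_. 0)" using x v by (auto simp: form_flat_def u_def dot_diff)
    have "dot I (bil I b u) u = 0" "dot I l' u = 0"
      using G0[of "bil I b u"] G0[of l'] u by (auto simp: G_def u_def)
    moreover have "dot I l' u = dot I l u + 2 * dot I (bil I b v) u"
      by (simp add: l'_def dot_add_left dot_scale_left)
    moreover have "x = v + u" by (simp add: u_def)
    ultimately show ?thesis using v(2) by (simp add: qf_add[OF sym])
  qed
  have dep: "dot I h u = 0"
    if h: "\<not> indep {..<Suc i} I (\<alpha>'(i := h))" and ind: "indep {..<i} I \<alpha>'"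
      and u: "\<And>m. m < i \<Longrightarrow> dot I (\<alpha>' m) u = 0" for h u i \<alpha>'
  proof -
    obtain \<beta> where \<beta>: "\<And>q. q \<in> I \<Longrightarrow> h q = (\<Sum>m<i. \<beta> m * \<alpha>' m q)" using dependent_combination[OF ind h] by metis
    have "dot I h u = (\<Sum>m<i. \<beta> m * dot I (\<alpha>' m) u)"
      unfolding dot_sum_left[symmetric] by (rule dot_cong) (rule \<beta>)
    then show ?thesis using u by simp
  qed
  have diff0: "dot I (\<alpha> m) (x - v) = 0" if "x \<in> form_flat j \<alpha> c" "m < j" for x m
    using that v(1) by (simp add: form_flat_def dot_diff)
  have "\<exists>g1\<in>G. indep {..<Suc j} I (\<alpha>(j := g1))"
  proof (rule ccontr)
    assume no: "\<not> ?thesis"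
    obtain x where x: "x \<in> form_flat j \<alpha> c" "qf I b l k x \<noteq> 0" using nz by blast
    have "qf I b l k x = 0"
      by (rule key[OF x(1)]) (rule dep[OF _ \<alpha>(2)], use no diff0[OF x(1)] in auto)
    with x show False by simp
  qed
  then obtain g1 where g1: "g1 \<in> G" "indep {..<Suc j} I (\<alpha>(j := g1))" by blast
  have "\<exists>g2\<in>G. indep {..<Suc (Suc j)} I (\<alpha>(j := g1, Suc j := g2))"
  proof (rule ccontr)
    assume no: "\<not> ?thesis"
    obtain x where x: "x \<in> form_flat j \<alpha> c" "dot I g1 x = dot I g1 v" "qf I b l k x \<noteq> 0"
      using irr[OF _ g1(2), of "dot I g1 v"] g1(1) GE by blast
    have "qf I b l k x = 0"
      by (rule key[OF x(1)]) (rule dep[OF _ g1(2)], use no diff0[OF x(1)] x(2) in \<open>auto simp: less_Suc_eq dot_diff\<close>)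
    with x show False by simp
  qed
  then obtain g2 where g2: "g2 \<in> G" "indep {..<Suc (Suc j)} I (\<alpha>(j := g1, Suc j := g2))" by blast
  have Gu: "dot I g u = 0" if "g \<in> G" "\<And>w. w \<in> form_flat j \<alpha> (\<lambda>_. 0) \<Longrightarrow> dot I (bil I b w) u = 0"
    "dot I l u + 2 * dot I (bil I b v) u = 0" for g u
  proof -
    have "dot I l' u = 0" using that(3) by (simp add: l'_def dot_add_left dot_scale_left)
    then show ?thesis using that(1,2) by (auto simp: G_def)
  qed
  show ?thesis
    by (rule that[of g1 g2]) (use g1(1) g2 GE Gu in auto)
qed

text \<open>If \<open>y0\<close> and \<open>y1\<close> share a solution \<open>z\<close>, the
  difference of the two quadratic equations is linear in \<open>z\<close> with coefficients
  \<open>a = bil I b (y1 - y0)\<close>. If \<open>a\<close> is independent of the forms of the flat,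
  the equation for \<open>y0\<close> lives on a flat of codimension \<open>j + 1\<close> and
  \<open>T\<close> applies. Otherwise a common solution forces the pair to be bad:
  \<open>y1 - y0\<close> satisfies two equations besides those of the flat. Bad pairs therefore cost
  only the last term, with its \<open>j + 2\<close> equations.\<close>

lemma block_system_irreducible_le:
  assumes S: "block_system (Suc t) Z J" and \<alpha>: "\<And>m. m < j \<Longrightarrow> \<alpha> m \<in> E" "indep {..<j} I \<alpha>"
    and nz: "\<exists>x\<in>form_flat j \<alpha> c. qf I b l k x \<noteq> 0"
    and irr: "\<And>g c'. g \<in> E \<Longrightarrow> indep {..<Suc j} I (\<alpha>(j := g)) \<Longrightarrow>
        \<exists>x\<in>form_flat j \<alpha> c. dot I g x = c' \<and> qf I b l k x \<noteq> 0"
    and l: "l \<in> E" and T0: "0 \<le> T"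
    and T: "\<And>Z J \<alpha> c l k. block_system t Z J \<Longrightarrow> (\<And>m. m < Suc j \<Longrightarrow> \<alpha> m \<in> E) \<Longrightarrow> indep {..<Suc j} I \<alpha> \<Longrightarrow>
        l \<in> E \<Longrightarrow> \<exists>x\<in>form_flat (Suc j) \<alpha> c. qf I b l k x \<noteq> 0 \<Longrightarrow>
        pr Z (\<lambda>z. z \<in> form_flat (Suc j) \<alpha> c \<and> qf I b l k z = 0) \<le> T"
  shows "pr Z (\<lambda>z. z \<in> form_flat j \<alpha> c \<and> qf I b l k z = 0)
    \<le> sqrt (2 powr (- real t * real j / 2) * T) + 2 powr (- real t * real (Suc (Suc j)) / 2)"
proof (cases "\<exists>v\<in>form_flat j \<alpha> c. qf I b l k v = 0")
  case False
  have "pr Z (\<lambda>z. z \<in> form_flat j \<alpha> c \<and> qf I b l k z = 0) \<le> pr Z (\<lambda>_. False)"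
    by (rule pr_mono) (use False in auto)
  also have "\<dots> = 0" using block_system_finite[OF S] by (simp add: pr_def)
  also have "0 \<le> sqrt (2 powr (- real t * real j / 2) * T) + 2 powr (- real t * real (Suc (Suc j)) / 2)"
    using T0 by (intro add_nonneg_nonneg) auto
  finally show ?thesis .
next
  case True
  then obtain v where v: "v \<in> form_flat j \<alpha> c" "qf I b l k v = 0" by blast
  obtain g1 g2 where g: "g1 \<in> E" "g2 \<in> E" "indep {..<Suc (Suc j)} I (\<alpha>(j := g1, Suc j := g2))"
    and gu: "\<And>u. (\<And>w. w \<in> form_flat j \<alpha> (\<lambda>_. 0) \<Longrightarrow> dot I (bil I b w) u = 0) \<Longrightarrow>
        dot I l u + 2 * dot I (bil I b v) u = 0 \<Longrightarrow> dot I g1 u = 0 \<and> dot I g2 u = 0"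
    by (rule irreducible_two_forms[OF \<alpha> nz irr l v]) auto
  obtain Y J' where Y: "Y \<subseteq> Z" "block_system t Y J" "block_system t (Z - Y) J'" by (rule block_system_split[OF S])
  define W where "W = Z - Y"
  have W: "block_system t W J'" using Y(3) by (simp add: W_def)
  \<comment> \<open>The condition that \<open>y + z\<close> lies in the flat reads
    \<open>\<rho> y = \<sigma> z\<close>; these are the classes for the decoupling
    inequality.\<close>
  define \<rho> where "\<rho> y = (\<lambda>m. if m < j then dot I (\<alpha> m) y else 0)" for y
  define \<sigma> where "\<sigma> z = (\<lambda>m. if m < j then c m - dot I (\<alpha> m) z else 0)" for z
  define P where "P y z \<longleftrightarrow> y + z \<in> form_flat j \<alpha> c \<and> qf I b l k (y + z) = 0" for y z
  define B where "B y0 y1 \<longleftrightarrow> dot I g1 (y1 - y0) = 0 \<and> dot I g2 (y1 - y0) = 0" for y0 y1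
  have \<rho>eq: "\<rho> y1 = \<rho> y0 \<longleftrightarrow> (\<forall>m<j. dot I (\<alpha> m) y1 = dot I (\<alpha> m) y0)" for y0 y1
    by (auto simp: \<rho>_def fun_eq_iff)
  have main: "av Y (\<lambda>y. pr W (P y))
    \<le> sqrt (2 powr (- real t * real j / 2) * T) + 2 powr (- real t * real (Suc (Suc j)) / 2)"
  proof (rule av_pr_decouple_le[where \<rho> = \<rho> and \<sigma> = \<sigma> and B = B])
    show "finite Y" "finite W" using block_system_finite Y W by auto
    show "\<rho> y = \<sigma> z" if "P y z" for y z
      using that by (auto simp: P_def form_flat_def \<rho>_def \<sigma>_def dot_add fun_eq_iff eq_diff_eq)
    show "pr W (\<lambda>z. \<sigma> z = d) \<le> 2 powr (- real t * real j / 2)" for d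
    proof -
      have "pr W (\<lambda>z. \<sigma> z = d) \<le> pr W (\<lambda>z. z \<in> form_flat j \<alpha> (\<lambda>m. c m - d m))"
        by (rule pr_mono) (auto simp: form_flat_def \<sigma>_def)
      also have "\<dots> \<le> 2 powr (- real t * real j / 2)" by (rule block_system_flat_le[OF W \<alpha>])
      finally show ?thesis .
    qed
    show "pr Y (\<lambda>y1. \<rho> y1 = \<rho> y0 \<and> B y0 y1) \<le> 2 powr (- real t * real (Suc (Suc j)) / 2)" for y0
    proof -
      let ?a = "\<alpha>(j := g1, Suc j := g2)"
      have "pr Y (\<lambda>y1. \<rho> y1 = \<rho> y0 \<and> B y0 y1) \<le> pr Y (\<lambda>y1. y1 \<in> form_flat (Suc (Suc j)) ?a (\<lambda>m. dot I (?a m) y0))"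
        by (rule pr_mono) (auto simp: form_flat_def \<rho>eq B_def dot_diff less_Suc_eq)
      also have "\<dots> \<le> 2 powr (- real t * real (Suc (Suc j)) / 2)"
        by (rule block_system_flat_le[OF Y(2) _ g(3)]) (use g \<alpha> in \<open>auto simp: less_Suc_eq\<close>)
      finally show ?thesis .
    qed
    show "pr W (\<lambda>z. P y0 z \<and> P y1 z) \<le> T"
      if eq: "\<rho> y1 = \<rho> y0" and nB: "\<not> B y0 y1" for y0 y1
    proof -
      define u where "u = y1 - y0"
      have y1: "y1 = y0 + u" by (simp add: u_def)
      have u0: "dot I (\<alpha> m) u = 0" if "m < j" for m using eq that by (simp add: \<rho>eq u_def dot_diff)
      define a where "a = bil I b u"
      have aE: "a \<in> E" unfolding a_def by (rule bilE)
      define q where "q = dot I l u + dot I a u"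
      have both: "q + 2 * dot I a (y0 + z) = 0" if "P y0 z" "P y1 z" for z
      proof -
        have "y1 + z = (y0 + z) + u" by (simp add: y1 add_ac)
        then have "qf I b l k (y1 + z) = qf I b l k (y0 + z) + dot I l u
            + 2 * dot I (bil I b (y0 + z)) u + dot I (bil I b u) u"
          by (simp only: qf_add[OF sym])
        then show ?thesis
          using that dot_bil_commute[OF sym, of "y0 + z" u] by (simp add: P_def q_def a_def add_ac)
      qed
      show ?thesis
      proof (cases "indep {..<Suc j} I (\<alpha>(j := a))")
        case True
        define c1 where "c1 = (\<lambda>m. c m - dot I (\<alpha> m) y0)"
        \<comment> \<open>The equation \<open>q + 2 * dot I a (y0 + z) = 0\<close> solved for the
          value of \<open>a\<close> at \<open>z\<close>. At \<open>y0 + z\<close> it prescribes the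
          value \<open>- q / 2\<close>, the one for which irreducibility is invoked below.\<close>
        define c2 where "c2 = - q / 2 - dot I a y0"
        let ?l = "\<lambda>i. l i + 2 * bil I b y0 i"
        have "pr W (\<lambda>z. P y0 z \<and> P y1 z)
          \<le> pr W (\<lambda>z. z \<in> form_flat (Suc j) (\<alpha>(j := a)) (c1(j := c2)) \<and> qf I b ?l (qf I b l k y0) z = 0)"
        proof (rule pr_mono)
          fix z assume P: "P y0 z \<and> P y1 z"
          then have "qf I b ?l (qf I b l k y0) z = 0" by (simp add: P_def qf_shift[OF sym])
          moreover have "z \<in> form_flat j \<alpha> c1" using P by (auto simp: P_def form_flat_def c1_def dot_add eq_diff_eq add.commute)
          moreover have "dot I a z = c2"
            using both[of z] P by (simp add: dot_add c2_def field_simps add_eq_0_iff)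
          ultimately show "z \<in> form_flat (Suc j) (\<alpha>(j := a)) (c1(j := c2)) \<and> qf I b ?l (qf I b l k y0) z = 0"
            by (simp add: form_flat_Suc)
        qed
        also have "\<dots> \<le> T"
        proof (rule T[OF W _ True])
          show "(\<alpha>(j := a)) m \<in> E" if "m < Suc j" for m using that \<alpha>(1) aE by (auto simp: less_Suc_eq)
          show "?l \<in> E" by (rule lin_spaceD[OF lin l bilE])
          obtain x where x: "x \<in> form_flat j \<alpha> c" "dot I a x = - q / 2" "qf I b l k x \<noteq> 0"
            using irr[OF aE True] by blast
          have "qf I b ?l (qf I b l k y0) (x - y0) = qf I b l k (y0 + (x - y0))"
            by (rule qf_shift[OF sym, symmetric])
          then have "qf I b ?l (qf I b l k y0) (x - y0) \<noteq> 0" using x(3) by simp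
          moreover have "x - y0 \<in> form_flat (Suc j) (\<alpha>(j := a)) (c1(j := c2))"
            unfolding form_flat_Suc using x by (auto simp: form_flat_def c1_def c2_def dot_diff)
          ultimately show "\<exists>x\<in>form_flat (Suc j) (\<alpha>(j := a)) (c1(j := c2)). qf I b ?l (qf I b l k y0) x \<noteq> 0"
            by blast
        qed
        finally show ?thesis .
      next
        case False
        then obtain \<beta> where \<beta>: "\<And>i. i \<in> I \<Longrightarrow> a i = (\<Sum>m<j. \<beta> m * \<alpha> m i)"
          using dependent_combination[OF \<alpha>(2)] by metis
        have a0: "dot I a w = 0" if "w \<in> form_flat j \<alpha> (\<lambda>_. 0)" for w
        proof -
          have "dot I a w = (\<Sum>m<j. \<beta> m * dot I (\<alpha> m) w)"
            unfolding dot_sum_left[symmetric] by (rule dot_cong) (rule \<beta>)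
          then show ?thesis using that by (simp add: form_flat_def)
        qed
        \<comment> \<open>Here \<open>a\<close> vanishes on all directions of the flat, so its value
          at \<open>y0 + z\<close> is its value at \<open>v\<close>. Two solutions would then make
          \<open>u\<close> a zero of \<open>g1\<close> and \<open>g2\<close>, contrary to the pair
          being good.\<close>
        have "\<not> (P y0 z \<and> P y1 z)" for z
        proof
          assume P: "P y0 z \<and> P y1 z"
          have uf: "u \<in> form_flat j \<alpha> (\<lambda>_. 0)" using u0 by (simp add: form_flat_def)
          have "(y0 + z) - v \<in> form_flat j \<alpha> (\<lambda>_. 0)"
            using P v(1) by (auto simp: P_def form_flat_def dot_diff)
          then have "dot I a (y0 + z - v) = 0" by (rule a0)
          then have "dot I a (y0 + z) = dot I a v" unfolding dot_diff by simp
          moreover have "dot I a v = dot I (bil I b v) u"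
            unfolding a_def by (rule dot_bil_commute[OF sym])
          ultimately have "dot I l u + 2 * dot I (bil I b v) u = 0"
            using both[of z] P a0[OF uf] by (simp add: q_def)
          moreover have "dot I (bil I b w) u = 0" if "w \<in> form_flat j \<alpha> (\<lambda>_. 0)" for w
            using a0[OF that] dot_bil_commute[OF sym, of w u] by (simp add: a_def)
          ultimately have "dot I g1 u = 0 \<and> dot I g2 u = 0" using gu by blast
          then show False using nB by (simp add: B_def u_def)
        qed
        then have "pr W (\<lambda>z. P y0 z \<and> P y1 z) = pr W (\<lambda>_. False)" by (intro pr_cong) blast
        also have "\<dots> = 0" using block_system_finite[OF W] by (simp add: pr_def)
        finally have "pr W (\<lambda>z. P y0 z \<and> P y1 z) = 0" .
        then show ?thesis using T0 by simp
      qed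
    qed
  qed (use T0 in auto)
  have "pr Z (\<lambda>z. z \<in> form_flat j \<alpha> c \<and> qf I b l k z = 0) = av Y (\<lambda>y. pr W (P y))"
  proof -
    have YW: "Z = Y \<union> W" "Y \<inter> W = {}" using Y(1) by (auto simp: W_def)
    show ?thesis unfolding pr_def P_def YW(1) by (rule av_Un[OF YW(2)])
  qed
  then show ?thesis using main by simp
qed

text \<open>The solution of \<open>d n = n / 2\<close>, \<open>d j = j / 4 + d (j + 1) / 2\<close>.\<close>

definition flat_exponent :: "nat \<Rightarrow> nat \<Rightarrow> real" where
  "flat_exponent n j = (real j + 1) / 2 - (1 / 2) ^ (n - j) / 2"

text \<open>Downward induction on \<open>j\<close> from the bound for \<open>n\<close> independent
  equations. Nonvanishing somewhere on the flat is what allows a gain over the probability of the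
  flat itself. The constant reproduces itself: the square root turns 4^(n + 2) into 2^(n + 2), the
  bad pairs add 1, and the halving of the blocks, from \<open>t\<close> to \<open>t - 1\<close>,
  costs at most 2^(n + 1).\<close>

lemma block_system_quadratic_le:
  assumes "j \<le> n" "block_system t Z J" "\<And>m. m < j \<Longrightarrow> \<alpha> m \<in> E" "indep {..<j} I \<alpha>" "l \<in> E"
    "\<exists>x\<in>form_flat j \<alpha> c. qf I b l k x \<noteq> 0"
  shows "pr Z (\<lambda>z. z \<in> form_flat j \<alpha> c \<and> qf I b l k z = 0) \<le> 4 ^ (n + 2) * 2 powr (- real t * flat_exponent n j)"
  using assms
proof (induction j arbitrary: t Z J \<alpha> c l k rule: inc_induct)
  case base
  have "pr Z (\<lambda>z. z \<in> form_flat n \<alpha> c \<and> qf I b l k z = 0) \<le> pr Z (\<lambda>z. z \<in> form_flat n \<alpha> c)"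
    by (rule pr_mono) auto
  also have "\<dots> \<le> 2 powr (- real t * real n / 2)" by (rule block_system_flat_le) fact+
  also have "\<dots> \<le> 4 ^ (n + 2) * 2 powr (- real t * real n / 2)"
    using one_le_power[of "4::real" "n + 2"] by (simp add: mult_le_cancel_right1)
  also have "- real t * real n / 2 = - real t * flat_exponent n n" by (simp add: flat_exponent_def add_divide_distrib)
  finally show ?case .
next
  case (step j)
  have flat_exponent_Suc: "flat_exponent n j = real j / 4 + flat_exponent n (Suc j) / 2"
  proof -
    have "n - j = Suc (n - Suc j)" using step.hyps by simp
    then show ?thesis by (simp add: flat_exponent_def field_simps)
  qed
  have e1: "flat_exponent n j \<le> (real j + 1) / 2" "0 \<le> flat_exponent n j"
  proof -
    define p where "p = (1 / 2 :: real) ^ (n - j)"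
    have p: "p \<le> 1" "0 \<le> p" by (simp_all add: p_def power_le_one)
    have e: "flat_exponent n j = (real j + 1) / 2 - p / 2" by (simp only: flat_exponent_def p_def)
    show "flat_exponent n j \<le> (real j + 1) / 2" unfolding e using p(2) by linarith
    have "p \<le> real j + 1" using p(1) by (simp add: add_increasing)
    then have "p / 2 \<le> (real j + 1) / 2" by (rule divide_right_mono) simp
    then show "0 \<le> flat_exponent n j" unfolding e by (simp only: diff_ge_0_iff_ge)
  qed
  have four: "(4::real) ^ (n + 2) = 2 ^ (n + 2) * 2 ^ (n + 2)"
    using power_mult_distrib[of "2::real" 2 "n + 2"] by simp
  show ?case
  proof (cases t)
    case 0
    have "pr Z (\<lambda>z. z \<in> form_flat j \<alpha> c \<and> qf I b l k z = 0) \<le> 1"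
      using block_system_finite[OF step.prems(1)] by (rule pr_le_one)
    also have "1 \<le> (4::real) ^ (n + 2)" by (rule one_le_power) simp
    finally show ?thesis using 0 by simp
  next
    case (Suc s)
    show ?thesis
    proof (cases "\<exists>g c'. g \<in> E \<and> indep {..<Suc j} I (\<alpha>(j := g)) \<and>
        (\<forall>x\<in>form_flat j \<alpha> c. dot I g x = c' \<longrightarrow> qf I b l k x = 0)")
      case True
      then obtain g c' where g: "g \<in> E" "indep {..<Suc j} I (\<alpha>(j := g))"
        "\<And>x. x \<in> form_flat j \<alpha> c \<Longrightarrow> dot I g x = c' \<Longrightarrow> qf I b l k x = 0" by blast
      have "pr Z (\<lambda>z. z \<in> form_flat j \<alpha> c \<and> qf I b l k z = 0) \<le> 2 * 2 powr (- real t * real (Suc j) / 2)"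
        by (rule block_system_reducible_le[OF step.prems(1,2,3,5) g])
      also have "\<dots> \<le> 4 ^ (n + 2) * 2 powr (- real t * flat_exponent n j)"
      proof (rule mult_mono)
        have "(4::real) ^ 1 \<le> 4 ^ (n + 2)" by (rule power_increasing) auto
        then show "2 \<le> (4::real) ^ (n + 2)" by simp
        have "real t * flat_exponent n j \<le> real t * ((real j + 1) / 2)" by (rule mult_left_mono[OF e1(1)]) simp
        then show "2 powr (- real t * real (Suc j) / 2) \<le> 2 powr (- real t * flat_exponent n j)"
          by (simp add: add.commute)
      qed auto
      finally show ?thesis .
    next
      case False
      define T where "T = 4 ^ (n + 2) * 2 powr (- real s * flat_exponent n (Suc j))"
      have "pr Z (\<lambda>z. z \<in> form_flat j \<alpha> c \<and> qf I b l k z = 0)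
          \<le> sqrt (2 powr (- real s * real j / 2) * T) + 2 powr (- real s * real (Suc (Suc j)) / 2)"
      proof (rule block_system_irreducible_le[OF _ step.prems(2,3,5)])
        show "block_system (Suc s) Z J" using step.prems(1) Suc by simp
        show "\<exists>x\<in>form_flat j \<alpha> c. dot I g x = c' \<and> qf I b l k x \<noteq> 0"
          if "g \<in> E" "indep {..<Suc j} I (\<alpha>(j := g))" for g c' using False that by blast
        show "0 \<le> T" by (simp add: T_def)
        show "pr Z (\<lambda>z. z \<in> form_flat (Suc j) \<alpha> c \<and> qf I b l k z = 0) \<le> T"
          if "block_system s Z J" "\<And>m. m < Suc j \<Longrightarrow> \<alpha> m \<in> E" "indep {..<Suc j} I \<alpha>" "l \<in> E"
            "\<exists>x\<in>form_flat (Suc j) \<alpha> c. qf I b l k x \<noteq> 0" for Z J \<alpha> c l k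
          unfolding T_def by (rule step.IH[OF that])
      qed (assumption | rule step.prems(4))+
      also have "sqrt (2 powr (- real s * real j / 2) * T) = 2 ^ (n + 2) * 2 powr (- real s * flat_exponent n j)"
      proof -
        have "2 powr (- real s * real j / 2) * T = 4 ^ (n + 2) * 2 powr (- real s * real j / 2 + - real s * flat_exponent n (Suc j))"
          unfolding T_def powr_add by (simp only: mult_ac)
        also have "- real s * real j / 2 + - real s * flat_exponent n (Suc j) = - real s * flat_exponent n j + - real s * flat_exponent n j"
          unfolding flat_exponent_Suc by (simp add: field_simps)
        also have "4 ^ (n + 2) * 2 powr (- real s * flat_exponent n j + - real s * flat_exponent n j)
            = (2 ^ (n + 2) * 2 powr (- real s * flat_exponent n j))\<^sup>2"
          unfolding four powr_add power2_eq_square by (simp only: mult_ac)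
        finally show ?thesis by simp
      qed
      also have "2 ^ (n + 2) * 2 powr (- real s * flat_exponent n j) + 2 powr (- real s * real (Suc (Suc j)) / 2)
          \<le> 2 ^ (n + 2) * 2 powr (- real s * flat_exponent n j) + 2 powr (- real s * flat_exponent n j)"
      proof -
        have "real s * flat_exponent n j \<le> real s * ((real j + 2) / 2)"
          by (rule mult_left_mono) (use e1 in auto)
        then show ?thesis by (simp add: add.commute)
      qed
      also have "2 ^ (n + 2) * 2 powr (- real s * flat_exponent n j) + 2 powr (- real s * flat_exponent n j)
          = (2 ^ (n + 2) + 1) * 2 powr (- real s * flat_exponent n j)" by (simp add: distrib_right)
      also have "- real s * flat_exponent n j = - real t * flat_exponent n j + flat_exponent n j"
        by (simp add: Suc algebra_simps)
      also have "2 powr (- real t * flat_exponent n j + flat_exponent n j) = 2 powr (- real t * flat_exponent n j) * 2 powr flat_exponent n j"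
        by (rule powr_add)
      also have "(2 ^ (n + 2) + 1) * (2 powr (- real t * flat_exponent n j) * 2 powr flat_exponent n j)
          \<le> (2 * 2 ^ (n + 2)) * (2 powr (- real t * flat_exponent n j) * 2 ^ (n + 1))"
      proof (intro mult_mono mult_left_mono)
        have "(1::real) \<le> 2 ^ (n + 2)" by (rule one_le_power) simp
        then show "(2::real) ^ (n + 2) + 1 \<le> 2 * 2 ^ (n + 2)" by linarith
        have "2 powr flat_exponent n j \<le> 2 powr real (n + 1)"
          by (rule powr_mono) (use e1 step.hyps in auto)
        then show "2 powr flat_exponent n j \<le> 2 ^ (n + 1)" by (simp only: powr_realpow zero_less_numeral)
      qed auto
      also have "\<dots> = 4 ^ (n + 2) * 2 powr (- real t * flat_exponent n j)"
      proof -
        have "(2 * 2 ^ (n + 2)) * (2::real) ^ (n + 1) = 4 ^ (n + 2)"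
          unfolding four by simp
        moreover have "2 * 2 ^ (n + 2) * (x * 2 ^ (n + 1)) = (2 * 2 ^ (n + 2)) * 2 ^ (n + 1) * x" for x :: real
          by (simp only: mult_ac)
        ultimately show ?thesis by (simp only:)
      qed
      finally show ?thesis .
    qed
  qed
qed

end

section \<open>Low rank\<close>

interpretation cfun: vector_space "\<lambda>(c::complex) (v::nat \<Rightarrow> complex) i. c * v i"
  by unfold_locales (auto simp: fun_eq_iff algebra_simps)

lemma dot_zero_on_span:
  assumes "v \<in> cfun.span S" "\<And>u. u \<in> S \<Longrightarrow> (\<Sum>m\<in>K. \<theta> m * u m) = 0"
  shows "(\<Sum>m\<in>K. \<theta> m * v m) = 0"
  using assms(1)
proof (induction rule: cfun.span_induct_alt)
  case base
  show ?case by simp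
next
  case (step c x y)
  have "(\<Sum>m\<in>K. \<theta> m * ((\<lambda>i. c * x i) + y) m) = c * (\<Sum>m\<in>K. \<theta> m * x m) + (\<Sum>m\<in>K. \<theta> m * y m)"
    by (simp add: algebra_simps sum.distrib sum_distrib_left)
  then show ?case using step assms(2) by simp
qed

lemma supported_in_span:
  assumes "\<And>m. m \<ge> D \<Longrightarrow> v m = 0"
  shows "v \<in> cfun.span (unit_fun ` {..<D})"
proof -
  have "(\<Sum>m<n. (\<lambda>i. v m * unit_fun m i)) \<in> cfun.span (unit_fun ` {..<n})" for n
    by (intro cfun.span_sum cfun.span_scale cfun.span_base) auto
  moreover have "(\<Sum>m<n. (\<lambda>i. v m * unit_fun m i)) i = (if i < n then v i else 0)" for n i
    by (induction n) (auto simp: unit_fun_def less_Suc_eq)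
  then have "(\<Sum>m<D. (\<lambda>i. v m * unit_fun m i)) = v" using assms by (auto simp: fun_eq_iff)
  ultimately show ?thesis by metis
qed

lemma spanning_block:
  assumes "finite R" "\<forall>i\<in>R. \<forall>m\<ge>D. \<phi> i m = 0"
  obtains J where "J \<subseteq> R" "card J \<le> D" "\<phi> ` R \<subseteq> cfun.span (\<phi> ` J)" "cfun.independent (\<phi> ` J)" "inj_on \<phi> J"
proof -
  obtain B where B: "B \<subseteq> \<phi> ` R" "cfun.independent B" "\<phi> ` R \<subseteq> cfun.span B"
    by (rule cfun.maximal_independent_subset)
  obtain J where J: "J \<subseteq> R" "inj_on \<phi> J" "B = \<phi> ` J"
    using B(1) by (auto simp: subset_image_inj)
  have "B \<subseteq> cfun.span (unit_fun ` {..<D})" using B(1) assms(2) by (auto intro!: supported_in_span)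
  then have "card B \<le> card (unit_fun ` {..<D})"
    using cfun.independent_span_bound[OF _ B(2)] by blast
  also have "\<dots> \<le> D" using card_image_le[of "{..<D}" unit_fun] by simp
  finally have "card J \<le> D" using J by (simp add: card_image)
  then show ?thesis using that J B by blast
qed

text \<open>A block needs at most \<open>D\<close> indices. If the indices outside the blocks found
  so far still span everything, they contain one more block; otherwise removing few indices has made
  the span smaller.\<close>

lemma greedy_blocks:
  assumes "finite R" "\<forall>i\<in>R. \<forall>m\<ge>D. \<phi> i m = 0"
  shows "(\<exists>J. (\<forall>b<q. J b \<subseteq> R \<and> card (J b) \<le> D \<and> \<phi> ` R \<subseteq> cfun.span (\<phi> ` J b)) \<and>
      disjoint_family_on J {..<q}) \<or>
    (\<exists>R'\<subseteq>R. card (R - R') \<le> q * D \<and> \<not> \<phi> ` R \<subseteq> cfun.span (\<phi> ` R'))"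
proof (induction q)
  case 0
  show ?case by (auto simp: disjoint_family_on_def)
next
  case (Suc q)
  then consider
    (blocks) J where "\<forall>b<q. J b \<subseteq> R \<and> card (J b) \<le> D \<and> \<phi> ` R \<subseteq> cfun.span (\<phi> ` J b)"
      "disjoint_family_on J {..<q}"
    | (drop) R' where "R' \<subseteq> R" "card (R - R') \<le> q * D" "\<not> \<phi> ` R \<subseteq> cfun.span (\<phi> ` R')"
    by blast
  then show ?case
  proof cases
    case drop
    then have "card (R - R') \<le> Suc q * D" by simp
    with drop show ?thesis by blast
  next
    case blocks
    define R' where "R' = R - (\<Union>b<q. J b)"
    have R': "R' \<subseteq> R" by (auto simp: R'_def)
    have "R - R' \<subseteq> (\<Union>b<q. J b)" by (auto simp: R'_def)
    moreover have "finite (\<Union>b<q. J b)" by (rule finite_subset[OF _ assms(1)]) (use blocks(1) in auto)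
    ultimately have "card (R - R') \<le> card (\<Union>b<q. J b)" by (rule card_mono[rotated])
    also have "\<dots> \<le> (\<Sum>b<q. card (J b))" by (rule card_UN_le) simp
    also have "\<dots> \<le> (\<Sum>b<q. D)" by (rule sum_mono) (use blocks(1) in auto)
    finally have c: "card (R - R') \<le> q * D" by simp
    show ?thesis
    proof (cases "\<phi> ` R \<subseteq> cfun.span (\<phi> ` R')")
      case False
      moreover have "card (R - R') \<le> Suc q * D" using c by simp
      ultimately show ?thesis using R' by blast
    next
      case True
      obtain K where K: "K \<subseteq> R'" "card K \<le> D" "\<phi> ` R' \<subseteq> cfun.span (\<phi> ` K)"
        by (rule spanning_block[of R' D \<phi>, OF finite_subset[OF R' assms(1)]])
          (use assms(2) R' in auto)
      have "\<phi> ` R \<subseteq> cfun.span (\<phi> ` K)"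
        by (rule order_trans[OF True cfun.span_minimal[OF K(3) cfun.subspace_span]])
      define J' where "J' = J(q := K)"
      have "J' b \<subseteq> R \<and> card (J' b) \<le> D \<and> \<phi> ` R \<subseteq> cfun.span (\<phi> ` J' b)" if "b < Suc q" for b
        using that blocks(1) K R' \<open>\<phi> ` R \<subseteq> cfun.span (\<phi> ` K)\<close> by (auto simp: J'_def less_Suc_eq)
      moreover have "disjoint_family_on J' {..<Suc q}"
      proof -
        have JK: "J b \<inter> K = {}" "K \<inter> J b = {}" if "b < q" for b
          using K(1) that by (auto simp: R'_def)
        have JJ: "J b \<inter> J b' = {}" if "b < q" "b' < q" "b \<noteq> b'" for b b'
          using blocks(2) that by (simp add: disjoint_family_on_def)
        show ?thesis
          unfolding disjoint_family_on_def
        proof (intro ballI impI)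
          fix m n assume "m \<in> {..<Suc q}" "n \<in> {..<Suc q}" "m \<noteq> n"
          then show "J' m \<inter> J' n = {}"
            using JJ[of m n] JK[of m] JK[of n] by (cases "m = q"; cases "n = q") (simp_all add: J'_def)
        qed
      qed
      ultimately show ?thesis by blast
    qed
  qed
qed

text \<open>Whenever the greedy choice of disjoint spanning blocks gets stuck, few indices have been used
  up and the rank of the remaining ones has dropped.\<close>

lemma exists_spanning_blocks:
  assumes "finite R" "\<forall>i\<in>R. \<forall>m\<ge>D. \<phi> i m = 0"
    and "finite B" "card B \<le> d" "\<phi> ` R \<subseteq> cfun.span B"
  shows "\<exists>R'\<subseteq>R. \<exists>J. card (R - R') \<le> d * (N * D) \<and>
    (\<forall>b<N. J b \<subseteq> R' \<and> \<phi> ` R' \<subseteq> cfun.span (\<phi> ` J b)) \<and> disjoint_family_on J {..<N}"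
  using assms
proof (induction d arbitrary: R B)
  case 0
  \<comment> \<open>Here all \<open>\<phi> i\<close> vanish, so empty blocks span.\<close>
  then have "B = {}" by simp
  then have "\<phi> ` R \<subseteq> cfun.span {}" using 0 by simp
  then show ?case
    by (intro exI[of _ R] exI[of _ "\<lambda>_. {}"] conjI) (auto simp: disjoint_family_on_def)
next
  case (Suc d)
  from greedy_blocks[where \<phi> = \<phi> and D = D and q = N, OF Suc.prems(1,2)] show ?case
  proof (elim disjE exE conjE)
    fix J assume J: "\<forall>b<N. J b \<subseteq> R \<and> card (J b) \<le> D \<and> \<phi> ` R \<subseteq> cfun.span (\<phi> ` J b)"
      "disjoint_family_on J {..<N}"
    show ?thesis
      by (intro exI[of _ R] exI[of _ J] conjI) (use J in auto)
  next
    fix R' assume R': "R' \<subseteq> R" "card (R - R') \<le> N * D" "\<not> \<phi> ` R \<subseteq> cfun.span (\<phi> ` R')"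
    have fR': "finite R'" using R'(1) Suc.prems(1) finite_subset by blast
    obtain C where C: "C \<subseteq> \<phi> ` R'" "cfun.independent C" "\<phi> ` R' \<subseteq> cfun.span C"
      by (rule cfun.maximal_independent_subset)
    have fC: "finite C" using C(1) fR' finite_surj by blast
    have "cfun.span C = cfun.span (\<phi> ` R')"
      unfolding cfun.span_eq using C(3) order_trans[OF C(1) cfun.span_superset] by blast
    \<comment> \<open>\<open>C\<close> together with \<open>v\<close> is independent inside the span
      of \<open>B\<close>; this is the drop of the rank by one.\<close>
    then obtain v where v: "v \<in> \<phi> ` R" "v \<notin> cfun.span C" using R'(3) by blast
    have "cfun.independent (insert v C)" using C(2) v(2) by (simp add: cfun.independent_insert)
    moreover have "insert v C \<subseteq> cfun.span B" using v(1) C(1) R'(1) Suc.prems(5) by blast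
    ultimately have "card (insert v C) \<le> card B"
      using cfun.independent_span_bound[OF Suc.prems(3)] by blast
    moreover have "v \<notin> C" using v(2) cfun.span_base by blast
    ultimately have "card C \<le> d" using fC Suc.prems(4) by simp
    then obtain R'' J where R'': "R'' \<subseteq> R'" "card (R' - R'') \<le> d * (N * D)"
      "\<forall>b<N. J b \<subseteq> R'' \<and> \<phi> ` R'' \<subseteq> cfun.span (\<phi> ` J b)" "disjoint_family_on J {..<N}"
      using Suc.IH[OF fR' _ fC _ C(3)] Suc.prems(2) R'(1) by blast
    have "R - R'' = (R - R') \<union> (R' - R'')" using R' R'' by auto
    then have "card (R - R'') \<le> card (R - R') + card (R' - R'')" by (metis card_Un_le)
    also have "\<dots> \<le> Suc d * (N * D)" using R'(2) R''(2) by simp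
    finally show ?thesis using R'' R'(1) by (intro exI[of _ R''] exI[of _ J]) auto
  qed
qed

text \<open>The edges of a matching are disjoint, so every edge that meets \<open>X\<close> uses up
  an element of \<open>X\<close> of its own.\<close>

lemma surviving_pair:
  fixes p q :: "nat \<Rightarrow> nat"
  assumes inj: "inj_on p {..<r}" "inj_on q {..<r}" "p ` {..<r} \<inter> q ` {..<r} = {}"
    and fin: "finite X" and small: "card X < r"
  obtains i where "i < r" "p i \<notin> X" "q i \<notin> X"
proof -
  define f where "f i = (if p i \<in> X then p i else q i)" for i
  have "\<exists>i<r. p i \<notin> X \<and> q i \<notin> X"
  proof (rule ccontr)
    assume "\<not> ?thesis"
    then have "f ` {..<r} \<subseteq> X" by (auto simp: f_def)
    moreover have "inj_on f {..<r}"
      using inj by (auto simp: inj_on_def f_def split: if_splits)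
    ultimately have "card {..<r} \<le> card X" by (metis card_inj_on_le fin)
    then show False using small by simp
  qed
  then show ?thesis using that by blast
qed

lemma dot_unit: "finite I \<Longrightarrow> q \<in> I \<Longrightarrow> dot I a (unit_fun q) = a q"
  by (simp add: dot_def unit_fun_def)

text \<open>The increments in direction \<open>unit_fun q\<close> at the points
  \<open>unit_fun p\<close> and 0 differ by \<open>2 * b p q\<close>.\<close>

lemma qf_nonzero:
  assumes "finite I" "sym_on I b" "p \<in> I" "q \<in> I" "b p q \<noteq> 0"
  shows "\<exists>x. qf I b l k x \<noteq> 0"
proof (rule ccontr)
  assume "\<not> ?thesis"
  then have z: "qf I b l k x = 0" for x by blast
  have "bil I b (0 + unit_fun p) q = b p q"
    using assms by (simp add: bil_def unit_fun_def)
  then have "dot I (bil I b (unit_fun p)) (unit_fun q) = b p q"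
    using assms by (simp add: dot_unit)
  moreover have "dot I (bil I b (unit_fun p)) (unit_fun q) = dot I (bil I b 0) (unit_fun q)"
  proof -
    have e: "0 = 0 + dot I l (unit_fun q) + 2 * dot I (bil I b x) (unit_fun q)
        + dot I (bil I b (unit_fun q)) (unit_fun q)" for x
      using qf_add[OF assms(2), of l k x "unit_fun q"] unfolding z .
    have "0 + dot I l (unit_fun q) + 2 * dot I (bil I b (unit_fun p)) (unit_fun q)
        + dot I (bil I b (unit_fun q)) (unit_fun q) = 0 + dot I l (unit_fun q)
        + 2 * dot I (bil I b 0) (unit_fun q) + dot I (bil I b (unit_fun q)) (unit_fun q)"
      by (rule trans[OF e[of "unit_fun p", symmetric] e[of 0]])
    then show ?thesis by (simp only: add_right_cancel add_left_cancel mult_cancel_left) simp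
  qed
  moreover have "bil I b 0 = (\<lambda>_. 0)" by (simp add: bil_def)
  ultimately show False using assms by (simp add: dot_def)
qed

text \<open>On the cube the diagonal of \<open>b\<close> only contributes a constant, so it may be chosen such that
  \<open>b\<close> itself has low rank.\<close>

lemma pr_low_rank_le:
  fixes s t :: nat
  assumes finR: "finite R" and symR: "sym_on R b"
    and lr: "\<And>i j. i \<in> R \<Longrightarrow> j \<in> R \<Longrightarrow> i \<noteq> j \<Longrightarrow> b i j = (\<Sum>t<s. f t i * h t j)"
    and robust: "\<And>X. X \<subseteq> R \<Longrightarrow> card X \<le> (2 * s + 1) * (2 ^ t * (2 * s + 1)) \<Longrightarrow>
      \<exists>i\<in>R - X. \<exists>j\<in>R - X. i \<noteq> j \<and> b i j \<noteq> 0"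
  shows "pr R (\<lambda>x. qf R b l k x = 0) \<le> 4 ^ (n + 2) * 2 powr (- real t * (1 / 2 - (1 / 2) ^ n / 2))"
proof -
  define D where "D = 2 * s + 1"
  \<comment> \<open>The columns of the matrix whose rows are the \<open>2 * s\<close> factors
    \<open>f m\<close>, \<open>h m\<close> and the linear part \<open>l\<close>; hence the dimension
    \<open>2 * s + 1\<close>. Indices whose columns span all others form a block for the space
    \<open>E\<close> generated by the rows.\<close>
  define \<phi> :: "nat \<Rightarrow> nat \<Rightarrow> complex" where "\<phi> i m = (if m < s then f m i else if m < 2 * s then h (m - s) i
    else if m = 2 * s then l i else 0)" for i m
  have \<phi>D: "\<phi> i m = 0" if "m \<ge> D" for i m using that by (auto simp: \<phi>_def D_def)
  have "card (unit_fun ` {..<D}) \<le> D" using card_image_le[of "{..<D}" unit_fun] by simp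
  moreover have "\<phi> ` R \<subseteq> cfun.span (unit_fun ` {..<D})" using \<phi>D by (auto intro!: supported_in_span)
  ultimately have "\<exists>R'\<subseteq>R. \<exists>J :: nat \<Rightarrow> nat set. card (R - R') \<le> D * (2 ^ t * D) \<and>
    (\<forall>c<2 ^ t. J c \<subseteq> R' \<and> \<phi> ` R' \<subseteq> cfun.span (\<phi> ` J c)) \<and> disjoint_family_on J {..<2 ^ t}"
    by (intro exists_spanning_blocks[OF finR, where B = "unit_fun ` {..<D}"]) (auto simp: \<phi>D)
  then obtain R' and J :: "nat \<Rightarrow> nat set" where R': "R' \<subseteq> R" "card (R - R') \<le> D * (2 ^ t * D)"
    and J: "\<forall>c<2 ^ t. J c \<subseteq> R' \<and> \<phi> ` R' \<subseteq> cfun.span (\<phi> ` J c)" "disjoint_family_on J {..<2 ^ t}"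
    by blast
  have finR': "finite R'" using R'(1) finR finite_subset by blast
  obtain p q where pq: "p \<in> R'" "q \<in> R'" "p \<noteq> q" "b p q \<noteq> 0"
    using robust[of "R - R'"] R' unfolding D_def by blast
  define E where "E = {g. \<exists>\<theta>. g = (\<lambda>i. \<Sum>m<D. \<theta> m * \<phi> i m)}"
  have lin: "lin_space E"
    unfolding lin_space_def
  proof (intro conjI ballI allI)
    show "(\<lambda>_. 0) \<in> E" unfolding E_def by (rule CollectI, rule exI[of _ "\<lambda>_. 0"]) simp
    fix g g' t assume "g \<in> E" "g' \<in> E"
    then obtain \<theta> \<theta>' where g: "g = (\<lambda>i. \<Sum>m<D. \<theta> m * \<phi> i m)" "g' = (\<lambda>i. \<Sum>m<D. \<theta>' m * \<phi> i m)"
      unfolding E_def by blast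
    show "(\<lambda>i. g i + t * g' i) \<in> E"
      unfolding E_def g
      by (rule CollectI, rule exI[of _ "\<lambda>m. \<theta> m + t * \<theta>' m"])
        (simp add: fun_eq_iff distrib_right sum.distrib sum_distrib_left mult.assoc)
  qed
  have base: "(\<lambda>i. \<phi> i m) \<in> E" if "m < D" for m
    unfolding E_def
    by (rule CollectI, rule exI[of _ "\<lambda>m'. of_bool (m' = m)"]) (use that in simp)
  have fE: "f m \<in> E" if "m < s" for m
    using base[of m] that by (simp add: \<phi>_def D_def)
  have hE: "h m \<in> E" if "m < s" for m
  proof -
    have "(\<lambda>i. \<phi> i (s + m)) = h m" using that by (simp add: \<phi>_def)
    then show ?thesis using base[of "s + m"] that by (simp add: D_def)
  qed
  have lE: "l \<in> E"
  proof -
    have "(\<lambda>i. \<phi> i (2 * s)) = l" by (simp add: \<phi>_def)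
    then show ?thesis using base[of "2 * s"] by (simp add: D_def)
  qed
  \<comment> \<open>Symmetrised so that it fits \<open>quad_system\<close>; off the diagonal it is
    \<open>b\<close> because \<open>b\<close> is symmetric.\<close>
  define b' where "b' i j = (\<Sum>t<s. f t i * h t j + f t j * h t i) / 2" for i j
  have b': "b' i j = b i j" if "i \<in> R" "j \<in> R" "i \<noteq> j" for i j
  proof -
    have "(\<Sum>t<s. f t i * h t j + f t j * h t i) = b i j + b j i"
      using lr[OF that] lr[OF that(2,1)] that(3) by (simp add: sum.distrib)
    then show ?thesis using symR that by (simp add: b'_def sym_on_def)
  qed
  have bil_in_E: "bil X b' u \<in> E" for X u
  proof -
    have f0: "(\<lambda>j. \<Sum>t<s. (\<Sum>i\<in>X. f t i * u i / 2) * h t j) \<in> E"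
      by (rule lin_space_sum[OF lin]) (auto simp: hE)
    have h0: "(\<lambda>j. \<Sum>t<s. (\<Sum>i\<in>X. h t i * u i / 2) * f t j) \<in> E"
      by (rule lin_space_sum[OF lin]) (auto simp: fE)
    have "bil X b' u j = (\<Sum>t<s. (\<Sum>i\<in>X. f t i * u i / 2) * h t j)
        + 1 * (\<Sum>t<s. (\<Sum>i\<in>X. h t i * u i / 2) * f t j)" for j
    proof -
      have "bil X b' u j = (\<Sum>i\<in>X. \<Sum>t<s. f t i * u i / 2 * h t j + h t i * u i / 2 * f t j)"
        unfolding bil_def b'_def sum_divide_distrib sum_distrib_right
        by (intro sum.cong refl) (simp add: field_simps)
      also have "\<dots> = (\<Sum>t<s. \<Sum>i\<in>X. f t i * u i / 2 * h t j + h t i * u i / 2 * f t j)"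
        by (rule sum.swap)
      finally show ?thesis by (simp only: sum.distrib sum_distrib_right mult_1)
    qed
    then show ?thesis using lin_spaceD[OF lin f0 h0, of 1] by presburger
  qed
  have sym': "sym_on R' b'" by (simp add: sym_on_def b'_def add.commute)
  interpret quad_system R' E b'
    by unfold_locales (use finR' lin sym' bil_in_E in auto)
  have S: "block_system t R' J"
    unfolding block_system_def
  proof (intro conjI allI impI)
    fix c :: nat assume c: "c < 2 ^ t"
    show "J c \<subseteq> R'" using J(1) c by blast
    show "block (J c)"
      unfolding block_def
    proof (intro ballI impI)
      fix g i assume g: "g \<in> E" "\<forall>j\<in>J c. g j = 0" and i: "i \<in> R'"
      obtain \<theta> where \<theta>: "g = (\<lambda>i. \<Sum>m<D. \<theta> m * \<phi> i m)" using g(1) unfolding E_def by blast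
      have "\<phi> i \<in> cfun.span (\<phi> ` J c)" using J(1) c i by blast
      then have "(\<Sum>m<D. \<theta> m * \<phi> i m) = 0"
        by (rule dot_zero_on_span) (use g(2) in \<open>auto simp: \<theta>\<close>)
      then show "g i = 0" by (simp add: \<theta>)
    qed
  qed (use R'(1) J(2) in auto)
  have "pr R (\<lambda>x. qf R b l k x = 0) \<le> 4 ^ (n + 2) * 2 powr (- real t * flat_exponent n 0)"
  proof (rule pr_le_sup[OF finR R'(1)])
    fix y assume y: "y \<in> cube (R - R')"
    \<comment> \<open>Fixing \<open>y\<close> adds mixed terms to the linear part. They involve only
      off-diagonal entries, so they may be computed with \<open>b'\<close>, which keeps
      \<open>l'\<close> in \<open>E\<close>.\<close>
    define l' where "l' = (\<lambda>j. l j + 2 * bil (R - R') b' y j)"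
    define k' where "k' = qf R b l k y + (\<Sum>i\<in>R'. b i i - b' i i)"
    have eq: "qf R b l k (y + w) = qf R' b' l' k' w" if w: "w \<in> cube R'" for w
    proof -
      have e1: "bil R b y j = bil (R - R') b' y j" if j: "j \<in> R'" for j
      proof -
        have "bil R b y j = (\<Sum>i\<in>R - R'. b i j * y i)"
          unfolding bil_def by (rule sum.mono_neutral_right) (use finR y in \<open>auto simp: cube_def\<close>)
        also have "\<dots> = bil (R - R') b' y j"
          unfolding bil_def
        proof (rule sum.cong[OF refl])
          fix i assume "i \<in> R - R'"
          then have "b' i j = b i j" using j R'(1) by (intro b') auto
          then show "b i j * y i = b' i j * y i" by simp
        qed
        finally show ?thesis .
      qed
      have "dot R (\<lambda>j. l j + 2 * bil R b y j) w = dot R' (\<lambda>j. l j + 2 * bil R b y j) w"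
        by (rule dot_subset[OF finR R'(1) w])
      also have "\<dots> = dot R' l' w" by (rule dot_cong) (simp add: l'_def e1)
      finally have e2: "dot R (\<lambda>j. l j + 2 * bil R b y j) w = dot R' l' w" .
      have w0: "w i = 0" if "i \<notin> R'" for i using w that by (simp add: cube_def)
      have ww: "w i * w i = 1" if "i \<in> R'" for i using w that by (auto simp: cube_def)
      have "dot R (bil R b w) w = (\<Sum>i\<in>R. \<Sum>j\<in>R. b i j * w i * w j)" by (rule dot_bil)
      also have "\<dots> = (\<Sum>i\<in>R'. \<Sum>j\<in>R. b i j * w i * w j)"
        by (rule sum.mono_neutral_right) (use finR R'(1) w0 in auto)
      also have "\<dots> = (\<Sum>i\<in>R'. \<Sum>j\<in>R'. b i j * w i * w j)"
        by (intro sum.cong refl sum.mono_neutral_right) (use finR R'(1) w0 in auto)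
      also have "\<dots> = (\<Sum>i\<in>R'. (\<Sum>j\<in>R'. b' i j * w i * w j) + (b i i - b' i i))"
      proof (rule sum.cong[OF refl])
        fix i assume i: "i \<in> R'"
        have "(\<Sum>j\<in>R'. b i j * w i * w j) = (\<Sum>j\<in>R'. b' i j * w i * w j + of_bool (j = i) * (b i i - b' i i))"
        proof (rule sum.cong[OF refl])
          fix j assume j: "j \<in> R'"
          show "b i j * w i * w j = b' i j * w i * w j + of_bool (j = i) * (b i i - b' i i)"
          proof (cases "j = i")
            case True
            then show ?thesis using ww[OF i] by (simp add: mult.assoc)
          next
            case False
            then have "b' i j = b i j" using i j R'(1) by (intro b') auto
            then show ?thesis using False by simp
          qed
        qed
        then show "(\<Sum>j\<in>R'. b i j * w i * w j) = (\<Sum>j\<in>R'. b' i j * w i * w j) + (b i i - b' i i)"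
          using i finR' by (simp add: sum.distrib sum_distrib_right[symmetric])
      qed
      also have "\<dots> = dot R' (bil R' b' w) w + (\<Sum>i\<in>R'. b i i - b' i i)"
        by (simp only: dot_bil sum.distrib)
      finally have e3: "dot R (bil R b w) w = dot R' (bil R' b' w) w + (\<Sum>i\<in>R'. b i i - b' i i)" .
      show ?thesis
        unfolding qf_shift[OF symR] unfolding qf_def[of R b "\<lambda>i. l i + 2 * bil R b y i"] e2 e3
        by (simp add: qf_def[of R'] k'_def)
    qed
    have "b' p q \<noteq> 0" using b'[OF subsetD[OF R'(1) pq(1)] subsetD[OF R'(1) pq(2)] pq(3)] pq(4) by simp
    then have nz: "\<exists>x. qf R' b' l' k' x \<noteq> 0" by (rule qf_nonzero[OF finR' sym' pq(1,2)])
    have l'E: "l' \<in> E" unfolding l'_def by (rule lin_spaceD[OF lin lE bil_in_E])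
    have "pr R' (\<lambda>w. w \<in> form_flat 0 (\<lambda>_ _. 0) (\<lambda>_. 0) \<and> qf R' b' l' k' w = 0)
        \<le> 4 ^ (n + 2) * 2 powr (- real t * flat_exponent n 0)"
      by (rule block_system_quadratic_le[OF _ S _ _ l'E]) (use nz in \<open>auto simp: indep_def form_flat_def\<close>)
    moreover have "pr R' (\<lambda>w. qf R b l k (y + w) = 0)
      = pr R' (\<lambda>w. w \<in> form_flat 0 (\<lambda>_ _. 0) (\<lambda>_. 0) \<and> qf R' b' l' k' w = 0)"
      by (rule pr_cong) (simp add: eq form_flat_def)
    ultimately show "pr R' (\<lambda>w. qf R b l k (y + w) = 0) \<le> 4 ^ (n + 2) * 2 powr (- real t * flat_exponent n 0)"
      by simp
  qed
  then show ?thesis by (simp add: flat_exponent_def)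
qed

section \<open>High rank\<close>

text \<open>Jensen's inequality, in the role that Cauchy--Schwarz has for two copies.\<close>

lemma av_power_le:
  assumes "finite I" "\<And>x. x \<in> cube I \<Longrightarrow> 0 \<le> f x"
  shows "(av I f) ^ n \<le> av I (\<lambda>x. f x ^ n)"
proof -
  have conv: "convex_on {0..} (\<lambda>x::real. x ^ n)"
  proof (cases "even n")
    case True
    then show ?thesis using convex_power_even convex_on_subset by blast
  next
    case False
    then show ?thesis using convex_power_odd by blast
  qed
  let ?c = "1 / real (card (cube I))"
  have pos: "card (cube I) > 0" by (rule card_cube_pos) fact
  have "(\<Sum>x\<in>cube I. ?c *\<^sub>R f x) ^ n \<le> (\<Sum>x\<in>cube I. ?c * f x ^ n)"
    by (rule convex_on_sum[OF _ _ conv]) (use pos assms finite_cube card_gt_0_iff in auto)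
  then show ?thesis by (simp add: av_def sum_divide_distrib)
qed

text \<open>The average over \<open>K\<close> independent copies, arranged as a list so that the
  copies can be revealed one after the other.\<close>

fun av_list :: "nat \<Rightarrow> nat set \<Rightarrow> ((nat \<Rightarrow> complex) list \<Rightarrow> real) \<Rightarrow> real" where
  "av_list 0 Y F = F []"
| "av_list (Suc K) Y F = av Y (\<lambda>y. av_list K Y (\<lambda>ys. F (y # ys)))"

lemma av_list_power:
  "(av Y (\<lambda>y. of_bool (P y))) ^ K = av_list K Y (\<lambda>ys. of_bool (\<forall>y\<in>set ys. P y))"
proof (induction K)
  case (Suc K)
  have c: "av_list n Y (\<lambda>ys. r * F ys) = r * av_list n Y F" for n r F
    by (induction n arbitrary: F) (simp_all add: av_cmult)
  have "av_list (Suc K) Y (\<lambda>ys. of_bool (\<forall>y\<in>set ys. P y))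
      = av Y (\<lambda>y. av_list K Y (\<lambda>ys. of_bool (P y) * of_bool (\<forall>y\<in>set ys. P y)))"
    by (simp add: of_bool_conj)
  also have "\<dots> = av Y (\<lambda>y. of_bool (P y)) * av_list K Y (\<lambda>ys. of_bool (\<forall>y\<in>set ys. P y))"
    by (simp only: c av_cmult_right)
  finally show ?case by (simp add: Suc)
qed simp

lemma av_av_list_swap: "av Z (\<lambda>z. av_list K Y (F z)) = av_list K Y (\<lambda>ys. av Z (\<lambda>z. F z ys))"
proof (induction K arbitrary: F)
  case (Suc K)
  have "av Z (\<lambda>z. av_list (Suc K) Y (F z)) = av Y (\<lambda>y. av Z (\<lambda>z. av_list K Y (\<lambda>ys. F z (y # ys))))"
    by (simp add: av_swap[of Z])
  then show ?case by (simp add: Suc)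
qed simp

lemma av_list_mono:
  assumes "\<And>ys. length ys = K \<Longrightarrow> set ys \<subseteq> cube Y \<Longrightarrow> F ys \<le> G ys"
  shows "av_list K Y F \<le> av_list K Y G"
  using assms
proof (induction K arbitrary: F G)
  case (Suc K)
  show ?case
    unfolding av_list.simps
  proof (rule av_mono)
    fix y assume "y \<in> cube Y"
    then show "av_list K Y (\<lambda>ys. F (y # ys)) \<le> av_list K Y (\<lambda>ys. G (y # ys))"
      by (intro Suc.IH Suc.prems) auto
  qed
qed auto

lemma av_list_const: "finite Y \<Longrightarrow> av_list K Y (\<lambda>_. r) = r"
  by (induction K) auto

lemma av_list_add: "av_list K Y (\<lambda>ys. F ys + G ys) = av_list K Y F + av_list K Y G"
  by (induction K arbitrary: F G) (auto simp: av_add)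

lemma av_list_sum: "finite Y \<Longrightarrow> av_list K Y (\<lambda>ys. \<Sum>d\<in>D. F d ys) = (\<Sum>d\<in>D. av_list K Y (F d))"
  by (induction K arbitrary: F) (auto simp: av_sum)

lemma indep_cong: "(\<And>m j. m \<in> K \<Longrightarrow> j \<in> J \<Longrightarrow> \<alpha> m j = \<alpha>' m j) \<Longrightarrow> indep K J \<alpha> = indep K J \<alpha>'"
  unfolding indep_def by (simp cong: sum.cong)

text \<open>A union bound over the first copy that depends on its predecessors. The prefix
  \<open>ws\<close> holds the copies already revealed.\<close>

lemma av_list_dependent_le:
  assumes finY: "finite Y"
    and step: "\<And>ws. length ws < n \<Longrightarrow> indep {..<length ws} J (\<lambda>m. W (ws ! m)) \<Longrightarrow>
      pr Y (\<lambda>y. \<not> indep {..<Suc (length ws)} J ((\<lambda>m. W (ws ! m))(length ws := W y))) \<le> e"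
    and "length ws + K \<le> n" "indep {..<length ws} J (\<lambda>m. W (ws ! m))" "0 \<le> e"
  shows "av_list K Y (\<lambda>ys. of_bool (\<not> indep {..<length ws + K} J (\<lambda>m. W ((ws @ ys) ! m)))) \<le> real K * e"
  using assms(3,4)
proof (induction K arbitrary: ws)
  case 0
  then show ?case by simp
next
  case (Suc K)
  let ?F = "\<lambda>ws ys. of_bool (\<not> indep {..<length ws + length ys} J (\<lambda>m. W ((ws @ ys) ! m))) :: real"
  have eq: "indep {..<Suc (length ws)} J ((\<lambda>m. W (ws ! m))(length ws := W y))
      \<longleftrightarrow> indep {..<length (ws @ [y])} J (\<lambda>m. W ((ws @ [y]) ! m))" for y
    unfolding length_append list.size
    by (simp, rule indep_cong) (auto simp: nth_append less_Suc_eq)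
  have "av_list (Suc K) Y (\<lambda>ys. of_bool (\<not> indep {..<length ws + Suc K} J (\<lambda>m. W ((ws @ ys) ! m))))
      = av Y (\<lambda>y. av_list K Y (\<lambda>ys. of_bool (\<not> indep {..<length (ws @ [y]) + K} J (\<lambda>m. W (((ws @ [y]) @ ys) ! m)))))"
    by simp
  also have "\<dots> \<le> av Y (\<lambda>y. of_bool (\<not> indep {..<Suc (length ws)} J ((\<lambda>m. W (ws ! m))(length ws := W y))) + real K * e)"
  proof (rule av_mono)
    fix y
    let ?A = "av_list K Y (\<lambda>ys. of_bool (\<not> indep {..<length (ws @ [y]) + K} J (\<lambda>m. W (((ws @ [y]) @ ys) ! m)))) :: real"
    show "?A \<le> of_bool (\<not> indep {..<Suc (length ws)} J ((\<lambda>m. W (ws ! m))(length ws := W y))) + real K * e"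
    proof (cases "indep {..<Suc (length ws)} J ((\<lambda>m. W (ws ! m))(length ws := W y))")
      case True
      then have "?A \<le> real K * e" unfolding eq by (intro Suc.IH) (use Suc.prems in auto)
      then show ?thesis using True by simp
    next
      case False
      have "?A \<le> av_list K Y (\<lambda>_. 1)" by (rule av_list_mono) auto
      also have "\<dots> = 1" by (rule av_list_const[OF finY])
      also have "\<dots> \<le> 1 + real K * e" using assms(5) by simp
      finally show ?thesis using False by simp
    qed
  qed
  also have "\<dots> = pr Y (\<lambda>y. \<not> indep {..<Suc (length ws)} J ((\<lambda>m. W (ws ! m))(length ws := W y))) + real K * e"
    unfolding av_add pr_def using finY by simp
  also have "\<dots> \<le> e + real K * e"
    by (intro add_right_mono step) (use Suc.prems in auto)
  finally show ?case by (simp add: algebra_simps)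
qed

text \<open>With \<open>n + 1\<close> copies of the variables in the \<open>S i\<close>, the remaining variables have to satisfy \<open>n\<close>
  independent linear equations. Passing to many copies loses less and less in the exponent.\<close>

lemma pr_high_rank_le:
  fixes S T :: "nat \<Rightarrow> nat set" and t s n :: nat
  assumes fin: "finite I" and sym: "sym_on I b"
    and ST: "\<And>i. i < 2 ^ t \<Longrightarrow> S i \<subseteq> I" "\<And>i. i < 2 ^ t \<Longrightarrow> T i \<subseteq> I"
    and disj: "disjoint_family_on T {..<2 ^ t}"
      "\<And>i j. i < 2 ^ t \<Longrightarrow> j < 2 ^ t \<Longrightarrow> S i \<inter> T j = {}"
    and card: "\<And>i. i < 2 ^ t \<Longrightarrow> card (T i) = s"
    and ind: "\<And>i. i < 2 ^ t \<Longrightarrow> indep (T i) (S i) (\<lambda>t j. b j t)"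
    and r: "0 \<le> r" "2 ^ t * (real n * (1 / 2) ^ (s - n)) + (2 powr (- real t / 2)) ^ n \<le> r ^ Suc n"
  shows "pr I (\<lambda>x. qf I b l k x = 0) \<le> r"
proof -
  define Y where "Y = (\<Union>i<2 ^ t. S i)"
  define Z where "Z = (\<Union>i<2 ^ t. T i)"
  have YZ: "Y \<subseteq> I" "Z \<subseteq> I" using ST by (auto simp: Y_def Z_def)
  have finYZ: "finite Y" "finite Z" using YZ fin finite_subset by auto
  have YZ0: "Y \<inter> Z = {}" using disj(2) by (fastforce simp: Y_def Z_def)
  have core: "pr (Y \<union> Z) (\<lambda>x. qf I b l k x = 0) \<le> r" for l k
  proof -
    define g where "g = qf I b l k"
    let ?p = "pr (Y \<union> Z) (\<lambda>x. g x = 0)"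
    let ?H = "(2 powr (- real t / 2)) ^ n"
    let ?e = "(1 / 2 :: real) ^ (s - n)"
    have "?p = av Z (\<lambda>z. av Y (\<lambda>y. of_bool (g (y + z) = 0)))"
      unfolding pr_def av_Un[OF YZ0] by (rule av_swap)
    then have "?p ^ Suc n \<le> av Z (\<lambda>z. (av Y (\<lambda>y. of_bool (g (y + z) = 0))) ^ Suc n)"
      by (simp only:) (rule av_power_le[OF finYZ(2)], rule av_nonneg, simp)
    also have "\<dots> = av_list (Suc n) Y (\<lambda>ys. pr Z (\<lambda>z. \<forall>y\<in>set ys. g (y + z) = 0))"
      unfolding av_list_power av_av_list_swap pr_def ..
    also have "\<dots> = av Y (\<lambda>y0. av_list n Y (\<lambda>ys. pr Z (\<lambda>z. \<forall>y\<in>set (y0 # ys). g (y + z) = 0)))"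
      by (simp only: av_list.simps)
    also have "\<dots> \<le> 2 ^ t * (real n * ?e) + ?H"
    proof (rule av_le_const[OF finYZ(1)])
      fix y0
      \<comment> \<open>Subtracting the equation for the fixed copy \<open>y0\<close> from the one
        for \<open>y\<close> cancels the terms quadratic in \<open>z\<close> and leaves a linear
        equation for \<open>z\<close> with coefficients \<open>W y\<close>.\<close>
      define W where "W y = bil I b (y - y0)" for y
      \<comment> \<open>On \<open>T i\<close> the vector \<open>W y\<close> is the image of
        \<open>y\<close> under an affine map of full rank \<open>s\<close>, so by Odlyzko's lemma it
        rarely falls into the span of fewer than \<open>n\<close> earlier vectors.\<close>
      have bad: "av_list n Y (\<lambda>ys. of_bool (\<not> indep {..<n} (T i) (\<lambda>m. W (ys ! m)))) \<le> real n * ?e"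
        if i: "i < 2 ^ t" for i
      proof -
        have finT: "finite (T i)" using ST(2)[OF i] fin finite_subset by blast
        have indY: "indep (T i) Y (\<lambda>t j. b j t)"
          by (rule indep_mono[OF ind[OF i]]) (use i in \<open>auto simp: Y_def\<close>)
        have "av_list n Y (\<lambda>ys. of_bool (\<not> indep {..<length ([]::(nat \<Rightarrow> complex) list) + n} (T i) (\<lambda>m. W (([] @ ys) ! m))))
            \<le> real n * ?e"
        proof (rule av_list_dependent_le[OF finYZ(1), where n = n])
          fix ws :: "(nat \<Rightarrow> complex) list"
          assume ws: "length ws < n" "indep {..<length ws} (T i) (\<lambda>m. W (ws ! m))"
          define c where "c t = - dot I (\<lambda>j. b j t) y0" for t
          have "pr Y (\<lambda>y. \<not> indep {..<Suc (length ws)} (T i) ((\<lambda>m. W (ws ! m))(length ws := W y)))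
            \<le> pr Y (\<lambda>y. \<exists>\<theta>. \<forall>t\<in>T i. dot Y (\<lambda>j. b j t) y + c t = (\<Sum>m\<in>{..<length ws}. \<theta> m * W (ws ! m) t))"
          proof (rule pr_mono)
            fix y assume y: "y \<in> cube Y"
              and "\<not> indep {..<Suc (length ws)} (T i) ((\<lambda>m. W (ws ! m))(length ws := W y))"
            then obtain \<beta> where \<beta>: "\<And>t. t \<in> T i \<Longrightarrow> W y t = (\<Sum>m<length ws. \<beta> m * W (ws ! m) t)"
              using dependent_combination[OF ws(2)] by metis
            have "W y t = dot Y (\<lambda>j. b j t) y + c t" for t
            proof -
              have "W y t = dot I (\<lambda>j. b j t) (y - y0)" by (simp add: W_def bil_def dot_def)
              then show ?thesis by (simp add: dot_diff c_def dot_subset[OF fin YZ(1) y])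
            qed
            then show "\<exists>\<theta>. \<forall>t\<in>T i. dot Y (\<lambda>j. b j t) y + c t = (\<Sum>m\<in>{..<length ws}. \<theta> m * W (ws ! m) t)"
              using \<beta> by (intro exI[of _ \<beta>]) simp
          qed
          also have "\<dots> \<le> (1 / 2) ^ (card (T i) - card {..<length ws})"
            by (rule pr_forms_in_span_le[OF finYZ(1) _ finT indY]) simp
          also have "\<dots> \<le> ?e"
            by (rule power_decreasing) (use card[OF i] ws(1) in auto)
          finally show "pr Y (\<lambda>y. \<not> indep {..<Suc (length ws)} (T i) ((\<lambda>m. W (ws ! m))(length ws := W y))) \<le> ?e" .
        qed (auto simp: indep_def)
        then show ?thesis by simp
      qed
      have "av_list n Y (\<lambda>ys. pr Z (\<lambda>z. \<forall>y\<in>set (y0 # ys). g (y + z) = 0))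
        \<le> av_list n Y (\<lambda>ys. (\<Sum>i<2 ^ t. of_bool (\<not> indep {..<n} (T i) (\<lambda>m. W (ys ! m)))) + ?H)"
      proof (rule av_list_mono)
        fix ys :: "(nat \<Rightarrow> complex) list" assume ys: "length ys = n"
        let ?q = "pr Z (\<lambda>z. \<forall>y\<in>set (y0 # ys). g (y + z) = 0)"
        show "?q \<le> (\<Sum>i<2 ^ t. of_bool (\<not> indep {..<n} (T i) (\<lambda>m. W (ys ! m)))) + ?H"
        \<comment> \<open>Independence on all the disjoint sets \<open>T i\<close> is the input for
          Halasz' inequality; if it fails on one of them, the trivial bound 1 is covered by the
          sum.\<close>
        proof (cases "\<forall>i<2 ^ t. indep {..<n} (T i) (\<lambda>m. W (ys ! m))")
          case True
          define u where "u m = ys ! m - y0" for m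
          define c where "c m = - (dot I l (u m) + dot I (bil I b (u m)) (u m)) / 2 - dot I (W (ys ! m)) y0" for m
          have "?q \<le> pr Z (\<lambda>z. \<forall>m\<in>{..<n}. dot Z (W (ys ! m)) z = c m)"
          proof (rule pr_mono, rule ballI)
            fix z m assume z: "z \<in> cube Z" and g0: "\<forall>y\<in>set (y0 # ys). g (y + z) = 0" and m: "m \<in> {..<n}"
            have W: "W (ys ! m) = bil I b (u m)" by (simp add: W_def u_def)
            have "ys ! m + z = (y0 + z) + u m" by (simp add: u_def)
            moreover have "g (ys ! m + z) = 0" "g (y0 + z) = 0" using g0 m ys by auto
            ultimately have "0 = 0 + dot I l (u m) + 2 * dot I (bil I b (y0 + z)) (u m) + dot I (bil I b (u m)) (u m)"
              unfolding g_def by (metis qf_add[OF sym])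
            also have "dot I (bil I b (y0 + z)) (u m) = dot I (W (ys ! m)) y0 + dot I (W (ys ! m)) z"
              unfolding W dot_bil_commute[OF sym, of "y0 + z"] dot_add ..
            finally have "dot I (W (ys ! m)) z = c m"
              unfolding c_def by (simp add: field_simps add_eq_0_iff)
            then show "dot Z (W (ys ! m)) z = c m" by (simp add: dot_subset[OF fin YZ(2) z])
          qed
          also have "\<dots> \<le> (2 powr (- real t / 2)) ^ card {..<n}"
            by (rule pr_forms_le[OF finYZ(2) _ _ _ disj(1)]) (use True in \<open>auto simp: Z_def\<close>)
          also have "\<dots> \<le> (\<Sum>i<2 ^ t. of_bool (\<not> indep {..<n} (T i) (\<lambda>m. W (ys ! m)))) + ?H"
            by (simp add: sum_nonneg)
          finally show ?thesis .
        next
          case False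
          then obtain i where i: "i < 2 ^ t" "\<not> indep {..<n} (T i) (\<lambda>m. W (ys ! m))" by blast
          have "?q \<le> 1" by (rule pr_le_one[OF finYZ(2)])
          also have "1 = (of_bool (\<not> indep {..<n} (T i) (\<lambda>m. W (ys ! m))) :: real)" using i by simp
          also have "\<dots> \<le> (\<Sum>i<2 ^ t. of_bool (\<not> indep {..<n} (T i) (\<lambda>m. W (ys ! m))))"
            by (rule member_le_sum) (use i in auto)
          also have "\<dots> \<le> \<dots> + ?H" by simp
          finally show ?thesis .
        qed
      qed
      also have "\<dots> = (\<Sum>i<2 ^ t. av_list n Y (\<lambda>ys. of_bool (\<not> indep {..<n} (T i) (\<lambda>m. W (ys ! m))))) + ?H"
        by (simp only: av_list_add av_list_sum[OF finYZ(1)] av_list_const[OF finYZ(1)])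
      also have "\<dots> \<le> (\<Sum>i<(2::nat) ^ t. real n * ?e) + ?H"
        by (intro add_right_mono sum_mono bad) simp
      also have "\<dots> = 2 ^ t * (real n * ?e) + ?H" by simp
      finally show "av_list n Y (\<lambda>ys. pr Z (\<lambda>z. \<forall>y\<in>set (y0 # ys). g (y + z) = 0)) \<le> 2 ^ t * (real n * ?e) + ?H" .
    qed
    also have "\<dots> \<le> r ^ Suc n" by (rule r(2))
    finally have "?p ^ Suc n \<le> r ^ Suc n" .
    then show ?thesis unfolding g_def by (rule power_le_imp_le_base[OF _ r(1)])
  qed
  show ?thesis
  proof (rule pr_le_sup[OF fin, of "Y \<union> Z"])
    show "Y \<union> Z \<subseteq> I" using YZ by blast
    show "pr (Y \<union> Z) (\<lambda>z. qf I b l k (y + z) = 0) \<le> r" for y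
      unfolding qf_shift[OF sym] by (rule core)
  qed
qed

section \<open>Matchings\<close>

lemma qf_subset:
  assumes "finite I" "R \<subseteq> I" "w \<in> cube R"
  shows "qf I b l k w = qf R b l k w"
proof -
  have "bil I b w = bil R b w"
    unfolding bil_def by (rule ext, rule sum.mono_neutral_right) (use assms in \<open>auto simp: cube_def\<close>)
  then show ?thesis by (simp add: qf_def dot_subset[OF assms])
qed

text \<open>A nonsingular square submatrix with rows \<open>S\<close> and columns \<open>T\<close>.
  Disjointness avoids the diagonal and allows the two sets of variables to be decoupled.\<close>

definition good_pair :: "(nat \<Rightarrow> nat \<Rightarrow> complex) \<Rightarrow> nat set \<Rightarrow> nat \<Rightarrow> nat set \<Rightarrow> nat set \<Rightarrow> bool" where
  "good_pair b U s S T \<longleftrightarrow> S \<subseteq> U \<and> T \<subseteq> U \<and> S \<inter> T = {} \<and> card S = s \<and> card T = s \<and>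
    indep T S (\<lambda>t j. b j t)"

lemma greedy_good_pairs:
  assumes "finite V"
  shows "(\<exists>S T. (\<forall>i<N. good_pair b V s (S i) (T i)) \<and>
      (\<forall>i<N. \<forall>j<N. i \<noteq> j \<longrightarrow> (S i \<union> T i) \<inter> (S j \<union> T j) = {})) \<or>
    (\<exists>X\<subseteq>V. card X \<le> N * (2 * s) \<and> (\<forall>S T. \<not> good_pair b (V - X) s S T))"
proof (induction N)
  case 0
  show ?case by auto
next
  case (Suc N)
  then consider
    (pairs) S T where "\<forall>i<N. good_pair b V s (S i) (T i)"
      "\<forall>i<N. \<forall>j<N. i \<noteq> j \<longrightarrow> (S i \<union> T i) \<inter> (S j \<union> T j) = {}"
    | (stuck) X where "X \<subseteq> V" "card X \<le> N * (2 * s)" "\<forall>S T. \<not> good_pair b (V - X) s S T"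
    by blast
  then show ?case
  proof cases
    case stuck
    then have "card X \<le> Suc N * (2 * s)" by simp
    with stuck show ?thesis by blast
  next
    case pairs
    define X where "X = (\<Union>i<N. S i \<union> T i)"
    have X: "X \<subseteq> V" using pairs(1) by (auto simp: X_def good_pair_def)
    have "card X \<le> (\<Sum>i<N. card (S i \<union> T i))" unfolding X_def by (rule card_UN_le) simp
    also have "\<dots> \<le> (\<Sum>i<N. 2 * s)"
    proof (rule sum_mono)
      fix i assume "i \<in> {..<N}"
      then have "card (S i) = s" "card (T i) = s" using pairs(1) by (auto simp: good_pair_def)
      then show "card (S i \<union> T i) \<le> 2 * s" using card_Un_le[of "S i" "T i"] by simp
    qed
    finally have cX: "card X \<le> Suc N * (2 * s)" by simp
    show ?thesis
    proof (cases "\<exists>S T. good_pair b (V - X) s S T")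
      case False
      then show ?thesis using X cX by blast
    next
      case True
      then obtain S' T' where ST': "good_pair b (V - X) s S' T'" by blast
      define S2 T2 where "S2 = S(N := S')" and "T2 = T(N := T')"
      have "good_pair b V s (S2 i) (T2 i)" if "i < Suc N" for i
        using that pairs(1) ST' by (auto simp: S2_def T2_def good_pair_def less_Suc_eq)
      moreover have "(S2 i \<union> T2 i) \<inter> (S2 j \<union> T2 j) = {}" if ij: "i < Suc N" "j < Suc N" "i \<noteq> j" for i j
      proof -
        have new: "(S m \<union> T m) \<inter> (S' \<union> T') = {}" "(S' \<union> T') \<inter> (S m \<union> T m) = {}" if "m < N" for m
          using ST' that by (auto simp: good_pair_def X_def)
        have old: "(S i \<union> T i) \<inter> (S j \<union> T j) = {}" if "i < N" "j < N" using pairs(2) that ij by blast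
        consider "i < N" "j < N" | "i < N" "j = N" | "i = N" "j < N" using ij by linarith
        then show ?thesis using new old by cases (simp_all add: S2_def T2_def)
      qed
      ultimately show ?thesis by blast
    qed
  qed
qed

text \<open>If a pair of maximal size cannot be extended then, off the diagonal, the remaining columns are
  combinations of the columns in \<open>T\<close>, with coefficients determined by the rows in \<open>S\<close>.\<close>

lemma low_rank_of_maximal_pair:
  assumes fin: "finite T" and ST: "good_pair b U s S T" "finite S"
    and max: "\<And>S' T'. \<not> good_pair b U (Suc s) S' T'"
  shows "\<exists>\<gamma>. \<forall>i\<in>U - (S \<union> T). \<forall>j\<in>U - (S \<union> T). i \<noteq> j \<longrightarrow> b i j = (\<Sum>t\<in>T. b i t * \<gamma> t j)"
proof -
  have ind: "indep T S (\<lambda>t j. b j t)" using ST by (simp add: good_pair_def)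
  define P where "P j c x \<longleftrightarrow> b x j = (\<Sum>t\<in>T. b x t * c t)" for j c x
  \<comment> \<open>The submatrix enlarged by row \<open>i\<close> and column \<open>j\<close> is
    singular, while that of \<open>S\<close> and \<open>T\<close> is not; so column \<open>j\<close>
    occurs in the relation and can be solved for, on the rows in \<open>S\<close> and on row
    \<open>i\<close> at once.\<close>
  have ex: "\<exists>c. \<forall>x\<in>insert i S. P j c x"
    if ij: "i \<in> U - (S \<union> T)" "j \<in> U - (S \<union> T)" "i \<noteq> j" for i j
  proof -
    have "\<not> indep (insert j T) (insert i S) (\<lambda>t j. b j t)"
      using max[of "insert i S" "insert j T"] ij ST fin by (auto simp: good_pair_def)
    then obtain \<beta> where \<beta>: "\<forall>x\<in>insert i S. (\<Sum>m\<in>insert j T. \<beta> m * b x m) = 0" "\<not> (\<forall>m\<in>insert j T. \<beta> m = 0)"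
      unfolding indep_def by blast
    have jT: "j \<notin> T" using ij by blast
    have eq: "\<beta> j * b x j + (\<Sum>m\<in>T. \<beta> m * b x m) = 0" if "x \<in> insert i S" for x
      using bspec[OF \<beta>(1) that] fin jT by simp
    have "\<beta> j \<noteq> 0"
    proof
      assume 0: "\<beta> j = 0"
      then have "\<forall>x\<in>S. (\<Sum>m\<in>T. \<beta> m * b x m) = 0" using eq by simp
      then have "\<forall>m\<in>T. \<beta> m = 0" using ind unfolding indep_def by blast
      with 0 \<beta>(2) show False by simp
    qed
    have "P j (\<lambda>t. - \<beta> t / \<beta> j) x" if "x \<in> insert i S" for x
    proof -
      have "b x j = - (\<Sum>m\<in>T. \<beta> m * b x m) / \<beta> j"
        using eq[OF that] \<open>\<beta> j \<noteq> 0\<close> by (simp add: field_simps add_eq_0_iff)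
      also have "\<dots> = (\<Sum>t\<in>T. b x t * (- \<beta> t / \<beta> j))"
        by (simp add: sum_negf sum_divide_distrib mult.commute)
      finally show ?thesis by (simp add: P_def)
    qed
    then show ?thesis by blast
  qed
  \<comment> \<open>The rows in \<open>S\<close> already determine the coefficients, so those for
    column \<open>j\<close> do not depend on \<open>i\<close>.\<close>
  have uniq: "c t = c' t" if "\<forall>x\<in>S. P j c x" "\<forall>x\<in>S. P j c' x" "t \<in> T" for j c c' t
  proof -
    have "\<forall>x\<in>S. (\<Sum>t\<in>T. (c t - c' t) * b x t) = 0"
    proof
      fix x assume "x \<in> S"
      then have "(\<Sum>t\<in>T. b x t * c t) = (\<Sum>t\<in>T. b x t * c' t)" using that by (simp add: P_def)
      then show "(\<Sum>t\<in>T. (c t - c' t) * b x t) = 0"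
        by (simp add: algebra_simps sum_subtractf)
    qed
    then have "\<forall>t\<in>T. c t - c' t = 0" using spec[OF ind[unfolded indep_def], of "\<lambda>t. c t - c' t"] by simp
    then show ?thesis using that by simp
  qed
  define \<gamma> where "\<gamma> t j = (SOME c. \<forall>x\<in>S. P j c x) t" for t j
  have "b i j = (\<Sum>t\<in>T. b i t * \<gamma> t j)"
    if ij: "i \<in> U - (S \<union> T)" "j \<in> U - (S \<union> T)" "i \<noteq> j" for i j
  proof -
    obtain c where c: "\<forall>x\<in>insert i S. P j c x" using ex[OF ij] by blast
    then have cS: "\<forall>x\<in>S. P j c x" by blast
    have "\<forall>x\<in>S. P j (SOME c. \<forall>x\<in>S. P j c x) x" using someI[of "\<lambda>c. \<forall>x\<in>S. P j c x", OF cS] .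
    then have "\<gamma> t j = c t" if "t \<in> T" for t unfolding \<gamma>_def using uniq[OF _ cS that] by blast
    moreover have "b i j = (\<Sum>t\<in>T. b i t * c t)" using c by (simp add: P_def)
    ultimately show ?thesis by simp
  qed
  then show ?thesis by blast
qed

text \<open>Nonsingular submatrices are collected greedily among the matched vertices. Either 2^t of
  size \<open>s\<close> are found and the high rank bound applies, or the search gets stuck and, off
  the diagonal, the rank is below \<open>s\<close> after few deletions. The factor 3 in the size
  condition accounts for three deletions of at most (2s + 1)^2 2^t vertices each: the submatrices
  found, a maximal one in the rest, and the set in the robustness condition. An edge of the matching
  survives them all.\<close>

lemma pr_quadratic_matching_le:
  fixes p q :: "nat \<Rightarrow> nat" and r s t n :: nat
  assumes fin: "finite I" and sym: "sym_on I b"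
    and inj: "inj_on p {..<r}" "inj_on q {..<r}" "p ` {..<r} \<inter> q ` {..<r} = {}"
    and pq: "\<And>i. i < r \<Longrightarrow> p i \<in> I \<and> q i \<in> I \<and> b (p i) (q i) \<noteq> 0"
    and size: "3 * (2 * s + 1)\<^sup>2 * 2 ^ t < r" "s > 0"
    and R: "0 \<le> R" "2 ^ t * (real n * (1 / 2) ^ (s - n)) + (2 powr (- real t / 2)) ^ n \<le> R ^ Suc n"
      "4 ^ (n + 2) * 2 powr (- real t * (1 / 2 - (1 / 2) ^ n / 2)) \<le> R"
  shows "pr I (\<lambda>x. qf I b l k x = 0) \<le> R"
proof -
  define V where "V = p ` {..<r} \<union> q ` {..<r}"
  have V: "V \<subseteq> I" using pq by (auto simp: V_def)
  have finV: "finite V" by (simp add: V_def)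
  from greedy_good_pairs[OF finV, of "2 ^ t" b s] show ?thesis
  proof (elim disjE exE conjE)
    fix S T :: "nat \<Rightarrow> nat set" assume ST: "\<forall>i<2 ^ t. good_pair b V s (S i) (T i)"
      "\<forall>i<2 ^ t. \<forall>j<2 ^ t. i \<noteq> j \<longrightarrow> (S i \<union> T i) \<inter> (S j \<union> T j) = {}"
    show ?thesis
    proof (rule pr_high_rank_le[OF fin sym, of t S T s, OF _ _ _ _ _ _ R(1,2)])
      fix i j :: nat assume ij: "i < 2 ^ t" "j < 2 ^ t"
      show "S i \<inter> T j = {}"
      proof (cases "i = j")
        case True
        then show ?thesis using ST(1) ij by (auto simp: good_pair_def)
      next
        case False
        then have "(S i \<union> T i) \<inter> (S j \<union> T j) = {}" using ST(2) ij by blast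
        then show ?thesis by blast
      qed
    next
      show "disjoint_family_on T {..<2 ^ t}"
        unfolding disjoint_family_on_def
      proof (intro ballI impI)
        fix i j :: nat assume "i \<in> {..<2 ^ t}" "j \<in> {..<2 ^ t}" "i \<noteq> j"
        then have "(S i \<union> T i) \<inter> (S j \<union> T j) = {}" using ST(2) by simp
        then show "T i \<inter> T j = {}" by blast
      qed
    next
      fix i :: nat assume i: "i < 2 ^ t"
      then have "S i \<subseteq> V" "T i \<subseteq> V" using ST(1) by (simp_all add: good_pair_def)
      then show "S i \<subseteq> I" "T i \<subseteq> I" using V by blast+
      show "card (T i) = s" "indep (T i) (S i) (\<lambda>t j. b j t)"
        using ST(1) i by (simp_all add: good_pair_def)
    qed
  next
    fix X assume X: "X \<subseteq> V" "card X \<le> 2 ^ t * (2 * s)" "\<forall>S T. \<not> good_pair b (V - X) s S T"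
    define U where "U = V - X"
    define Q where "Q j \<longleftrightarrow> (\<exists>S T. good_pair b U j S T)" for j
    have "Q 0" unfolding Q_def by (intro exI[of _ "{}"]) (simp add: good_pair_def indep_def)
    moreover have "\<not> Q s" using X(3) by (simp add: Q_def U_def)
    ultimately obtain j where j: "j < s" "Q j" "\<not> Q (Suc j)"
      using ex_least_nat_less[of "\<lambda>j. \<not> Q j" s] by auto
    obtain S T where ST: "good_pair b U j S T" using j(2) by (auto simp: Q_def)
    have finU: "finite U" using finV by (simp add: U_def)
    have finST: "finite S" "finite T" using ST finU finite_subset by (auto simp: good_pair_def)
    define W where "W = U - (S \<union> T)"
    obtain \<gamma> where \<gamma>: "\<And>i i'. i \<in> W \<Longrightarrow> i' \<in> W \<Longrightarrow> i \<noteq> i' \<Longrightarrow> b i i' = (\<Sum>t\<in>T. b i t * \<gamma> t i')"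
      using low_rank_of_maximal_pair[OF finST(2) ST finST(1)] j(3) unfolding Q_def W_def by metis
    obtain e where e: "bij_betw e {..<j} T"
      using ex_bij_betw_nat_finite[OF finST(2)] ST by (auto simp: good_pair_def atLeast0LessThan)
    have W: "W \<subseteq> I" using V by (auto simp: W_def U_def)
    have finW: "finite W" using W fin finite_subset by blast
    have symW: "sym_on W b" using sym W by (auto simp: sym_on_def)
    define d where "d = 2 * s + 1"
    have low: "pr W (\<lambda>x. qf W b l k x = 0) \<le> R" for l k
    proof -
      have "pr W (\<lambda>x. qf W b l k x = 0) \<le> 4 ^ (n + 2) * 2 powr (- real t * (1 / 2 - (1 / 2) ^ n / 2))"
      proof (rule pr_low_rank_le[OF finW symW, where s = j and f = "\<lambda>m i. b i (e m)" and h = "\<lambda>m i. \<gamma> (e m) i"])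
        show "b i i' = (\<Sum>m<j. b i (e m) * \<gamma> (e m) i')" if "i \<in> W" "i' \<in> W" "i \<noteq> i'" for i i'
          unfolding \<gamma>[OF that] by (rule sum.reindex_bij_betw[OF e, symmetric])
        fix X' assume X': "X' \<subseteq> W" "card X' \<le> (2 * j + 1) * (2 ^ t * (2 * j + 1))"
        define Y where "Y = X \<union> (S \<union> T) \<union> X'"
        have finY: "finite Y" using finST X(1) finV X'(1) finW finite_subset by (auto simp: Y_def)
        have "card Y \<le> card X + card (S \<union> T) + card X'"
          unfolding Y_def using card_Un_le[of "X \<union> (S \<union> T)" X'] card_Un_le[of X "S \<union> T"] by linarith
        also have "card (S \<union> T) \<le> 2 * j"
          using card_Un_le[of S T] ST by (simp add: good_pair_def)
        also have "card X + 2 * j + card X' \<le> 2 ^ t * d\<^sup>2 + 2 ^ t * d\<^sup>2 + 2 ^ t * d\<^sup>2"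
        proof (intro add_mono)
          have dd: "d \<le> d\<^sup>2" by (simp add: d_def power2_eq_square)
          have "2 * s \<le> d\<^sup>2" using dd by (simp add: d_def)
          then show "card X \<le> 2 ^ t * d\<^sup>2" using X(2) by (meson le_trans mult_le_mono2)
          have "2 * j \<le> d" using j(1) by (simp add: d_def)
          also have "d \<le> 2 ^ t * d\<^sup>2" using dd by (metis le_trans mult_le_mono1 mult_1 one_le_numeral one_le_power)
          finally show "2 * j \<le> 2 ^ t * d\<^sup>2" .
          have "(2 * j + 1) * (2 ^ t * (2 * j + 1)) \<le> d * (2 ^ t * d)"
            by (intro mult_le_mono) (use j(1) in \<open>auto simp: d_def\<close>)
          then show "card X' \<le> 2 ^ t * d\<^sup>2" using X'(2) by (simp add: power2_eq_square mult_ac)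
        qed
        also have "\<dots> < r" using size(1) by (simp add: d_def mult_ac)
        finally have "card Y < r" by simp
        then obtain i where i: "i < r" "p i \<notin> Y" "q i \<notin> Y"
          by (rule surviving_pair[OF inj finY])
        then have "p i \<in> W - X'" "q i \<in> W - X'" by (auto simp: W_def U_def V_def Y_def)
        moreover have "p i \<noteq> q i" using inj(3) i(1) by blast
        ultimately show "\<exists>i\<in>W - X'. \<exists>j\<in>W - X'. i \<noteq> j \<and> b i j \<noteq> 0" using pq[OF i(1)] by blast
      qed
      then show ?thesis using R(3) by linarith
    qed
    show ?thesis
    proof (rule pr_le_sup[OF fin W])
      fix y
      have "pr W (\<lambda>z. qf I b l k (y + z) = 0)
          = pr W (\<lambda>z. qf W b (\<lambda>i. l i + 2 * bil I b y i) (qf I b l k y) z = 0)"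
        unfolding qf_shift[OF sym] by (rule pr_cong) (simp add: qf_subset[OF fin W])
      then show "pr W (\<lambda>z. qf I b l k (y + z) = 0) \<le> R" using low by simp
    qed
  qed
qed

text \<open>The vertices of a maximal matching cover all off-diagonal nonzero entries.\<close>

lemma exists_matching:
  fixes b :: "nat \<Rightarrow> nat \<Rightarrow> complex" and m :: real
  assumes "N \<ge> 1" and G: "real (card {(i, j). i < N \<and> j < N \<and> b i j \<noteq> 0}) \<ge> m * real N" and sym: "sym_on {..<N} b"
  obtains r and p q :: "nat \<Rightarrow> nat" where "inj_on p {..<r}" "inj_on q {..<r}" "p ` {..<r} \<inter> q ` {..<r} = {}"
    "\<And>i. i < r \<Longrightarrow> p i < N \<and> q i < N \<and> b (p i) (q i) \<noteq> 0" "m \<le> 1 + 4 * real r"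
proof -
  define P where "P r \<longleftrightarrow> (\<exists>p q. inj_on p {..<r} \<and> inj_on q {..<r} \<and> p ` {..<r} \<inter> q ` {..<r} = {} \<and>
    (\<forall>i<r. p i < N \<and> q i < N \<and> b (p i) (q i) \<noteq> 0))" for r :: nat
  have "P 0" by (simp add: P_def)
  moreover have bd: "r \<le> N" if "P r" for r
  proof -
    obtain p where p: "inj_on p {..<r}" "\<forall>i<r. p i < N" using \<open>P r\<close> unfolding P_def by blast
    then have "card {..<r} \<le> card {..<N}" by (intro card_inj_on_le[of p]) auto
    then show ?thesis by simp
  qed
  ultimately obtain r where r: "P r" "\<And>r'. P r' \<Longrightarrow> r' \<le> r"
    using Greatest_le_nat[of P _ N] GreatestI_nat[of P 0 N] by blast
  obtain p q where pq: "inj_on p {..<r}" "inj_on q {..<r}" "p ` {..<r} \<inter> q ` {..<r} = {}"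
    "\<And>i. i < r \<Longrightarrow> p i < N \<and> q i < N \<and> b (p i) (q i) \<noteq> 0"
    using r(1) unfolding P_def by blast
  define V where "V = p ` {..<r} \<union> q ` {..<r}"
  have cover: "i \<in> V \<or> j \<in> V" if ij: "i < N" "j < N" "b i j \<noteq> 0" "i \<noteq> j" for i j
  proof (rule ccontr)
    assume no: "\<not> ?thesis"
    have "P (Suc r)"
      unfolding P_def
    proof (intro exI conjI)
      have e: "{..<Suc r} = insert r {..<r}" by auto
      have im: "(f(r := v)) ` {..<Suc r} = insert v (f ` {..<r})" for f :: "nat \<Rightarrow> nat" and v
        unfolding e by auto
      have inj: "inj_on (f(r := v)) {..<Suc r}" if "inj_on f {..<r}" "v \<notin> f ` {..<r}"
        for f :: "nat \<Rightarrow> nat" and v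
      proof -
        have "inj_on (f(r := v)) {..<r} \<longleftrightarrow> inj_on f {..<r}" by (rule inj_on_cong) simp
        moreover have "(f(r := v)) ` ({..<r} - {r}) = f ` {..<r}" by (rule image_cong) auto
        ultimately show ?thesis using that unfolding e inj_on_insert by simp
      qed
      show "inj_on (p(r := i)) {..<Suc r}" "inj_on (q(r := j)) {..<Suc r}"
        by (rule inj; use pq(1,2) no in \<open>simp add: V_def\<close>)+
      show "(p(r := i)) ` {..<Suc r} \<inter> (q(r := j)) ` {..<Suc r} = {}"
        unfolding im using pq(3) no ij(4) by (auto simp: V_def)
      show "\<forall>i'<Suc r. (p(r := i)) i' < N \<and> (q(r := j)) i' < N \<and> b ((p(r := i)) i') ((q(r := j)) i') \<noteq> 0"
        using pq(4) ij by (auto simp: less_Suc_eq)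
    qed
    then show False using r(2) by fastforce
  qed
  have cV: "card V \<le> 2 * r"
    using card_Un_le[of "p ` {..<r}" "q ` {..<r}"] card_image_le[of "{..<r}" p] card_image_le[of "{..<r}" q]
    by (simp add: V_def)
  \<comment> \<open>There are \<open>N\<close> diagonal positions, and every other nonzero entry
    lies in a row or a column of one of at most \<open>2 * r\<close> matched vertices; hence
    \<open>1 + 4 * r\<close>.\<close>
  have "{(i, j). i < N \<and> j < N \<and> b i j \<noteq> 0} \<subseteq> (\<lambda>i. (i, i)) ` {..<N} \<union> (V \<times> {..<N} \<union> {..<N} \<times> V)"
    using cover by auto
  moreover have finV: "finite V" by (simp add: V_def)
  ultimately have "card {(i, j). i < N \<and> j < N \<and> b i j \<noteq> 0}
      \<le> card ((\<lambda>i. (i, i)) ` {..<N} \<union> (V \<times> {..<N} \<union> {..<N} \<times> V))"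
    by (intro card_mono) auto
  also have "\<dots> \<le> card ((\<lambda>i. (i, i)) ` {..<N}) + (card (V \<times> {..<N}) + card ({..<N} \<times> V))"
    by (meson card_Un_le add_left_mono le_trans)
  also have "\<dots> \<le> N + (2 * r * N + 2 * r * N)"
  proof (intro add_mono)
    show "card ((\<lambda>i. (i, i)) ` {..<N}) \<le> N" using card_image_le[of "{..<N}" "\<lambda>i. (i, i)"] by simp
    show "card (V \<times> {..<N}) \<le> 2 * r * N" "card ({..<N} \<times> V) \<le> 2 * r * N"
      using cV by (simp_all add: card_cartesian_product mult.commute)
  qed
  finally have "card {(i, j). i < N \<and> j < N \<and> b i j \<noteq> 0} \<le> (1 + 4 * r) * N"
    by (simp add: algebra_simps)
  then have "m * real N \<le> real ((1 + 4 * r) * N)" using G by linarith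
  then have "m * real N \<le> (1 + 4 * real r) * real N" by (simp add: distrib_right)
  then have "m \<le> 1 + 4 * real r" using assms(1) by simp
  then show ?thesis using that pq by blast
qed

section \<open>Choice of the parameters\<close>

lemma rademacher_vec_prob:
  "measure_pmf.prob (rademacher_vec n) {x. P x} = pr {..<n} (\<lambda>x. P (Matrix.vec n x))"
proof -
  have cube: "PiE_dflt {..<n} 0 (\<lambda>_. {1, -1}) = cube {..<n}"
    by (auto simp: PiE_dflt_def cube_def)
  have "Pi_pmf {..<n} 0 (\<lambda>_. pmf_of_set {1, -1 :: complex}) = pmf_of_set (cube {..<n})"
    unfolding cube[symmetric] by (rule Pi_pmf_of_set) auto
  then have "measure_pmf.prob (rademacher_vec n) {x. P x}
      = measure_pmf.prob (pmf_of_set (cube {..<n})) (Matrix.vec n -` {x. P x})"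
    by (simp add: rademacher_vec_def)
  also have "\<dots> = real (card (cube {..<n} \<inter> Matrix.vec n -` {x. P x})) / real (card (cube {..<n}))"
    by (rule measure_pmf_of_set) (use card_cube_pos[of "{..<n}"] finite_cube[of "{..<n}"] in auto)
  also have "real (card (cube {..<n} \<inter> Matrix.vec n -` {x. P x})) = (\<Sum>x\<in>cube {..<n}. of_bool (P (Matrix.vec n x)))"
    using finite_cube[of "{..<n}"] by (simp add: Int_def)
  finally show ?thesis by (simp add: pr_def av_def)
qed

lemma quadratic_form_eq_qf:
  assumes A: "A \<in> carrier_mat n n" "l \<in> carrier_vec n"
  shows "quadratic_form A (Matrix.vec n x) = linear_form l (Matrix.vec n x) + c \<longleftrightarrow>
    qf {..<n} (\<lambda>i j. A $$ (i, j)) (\<lambda>i. - l $ i) (- c) x = 0"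
proof -
  have "quadratic_form A (Matrix.vec n x) = (\<Sum>i<n. \<Sum>j<n. A $$ (i, j) * x i * x j)"
    using A by (simp add: quadratic_form_def scalar_prod_def atLeast0LessThan sum_distrib_left mult_ac)
  moreover have "linear_form l (Matrix.vec n x) = dot {..<n} (\<lambda>i. l $ i) x"
    using A by (simp add: linear_form_def scalar_prod_def atLeast0LessThan dot_def)
  moreover have "dot {..<n} (\<lambda>i. - l $ i) x = - dot {..<n} (\<lambda>i. l $ i) x"
    by (simp add: dot_def sum_negf)
  ultimately show ?thesis
    unfolding qf_def dot_bil by (auto simp: algebra_simps)
qed

text \<open>The number of copies is fixed by \<open>\<delta>\<close> alone, so that all quantities
  depending on it go into \<open>C\<close>. Then 2^t is about r^(1/(1 + \<delta>)) and
  \<open>s\<close> is linear in \<open>t\<close>; the factor quadratic in \<open>s\<close> in the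
  size condition is absorbed by 2^(\<delta> t). The first alternative takes care of bounded
  \<open>m\<close>.\<close>

lemma parameters_exist:
  fixes \<delta> :: real
  assumes \<delta>: "0 < \<delta>" "\<delta> < 1 / 2"
  obtains C where "C > 0" "\<And>(r::nat) m :: real. m \<ge> 3 \<Longrightarrow> m \<le> 6 * real r \<Longrightarrow>
    C * m powr (- 1 / 2 + \<delta>) \<ge> 1 \<or>
    (\<exists>s t n R. 3 * (2 * s + 1)\<^sup>2 * 2 ^ t < r \<and> s > 0 \<and> 0 \<le> R \<and>
      2 ^ t * (real n * (1 / 2) ^ (s - n)) + (2 powr (- real t / 2)) ^ n \<le> R ^ Suc n \<and>
      4 ^ (n + 2) * 2 powr (- real t * (1 / 2 - (1 / 2) ^ n / 2)) \<le> R \<and>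
      R \<le> C * m powr (- 1 / 2 + \<delta>))"
proof -
  define K where "K = nat \<lceil>1 / \<delta>\<rceil>"
  have K\<delta>: "1 / \<delta> \<le> real K" unfolding K_def by linarith
  have K: "K > 0" using \<delta>(1) K\<delta> by (smt (verit) divide_pos_pos of_nat_0_less_iff)
  \<comment> \<open>The loss in the exponent caused by taking \<open>K + 1\<close> copies:
    \<open>(K + 1) * (1 / 2 - \<theta>) = K / 2\<close>. It dominates the loss
    \<open>(1 / 2) ^ K / 2\<close> for low rank, since \<open>K + 1 \<le> 2 ^ K\<close>.\<close>
  define \<theta> where "\<theta> = 1 / (2 * (real K + 1))"
  have \<theta>: "0 < \<theta>" "\<theta> \<le> \<delta> / 2"
  proof -
    show "0 < \<theta>" by (simp add: \<theta>_def)
    have "1 \<le> \<delta> * real K" using K\<delta> \<delta>(1) by (simp add: field_simps)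
    also have "\<dots> \<le> \<delta> * (real K + 1)" using \<delta>(1) by simp
    finally show "\<theta> \<le> \<delta> / 2" by (simp add: \<theta>_def field_simps)
  qed
  define a where "a = \<delta> * ln 2 / 2"
  have a: "0 < a" "a < 1"
  proof -
    show "0 < a" using \<delta> by (simp add: a_def)
    have "\<delta> * ln 2 \<le> (1 / 2) * 1" by (intro mult_mono) (use \<delta> ln_2_less_1 in auto)
    then show "a < 1" by (simp add: a_def)
  qed
  have poly: "real t + 1 \<le> 2 powr (\<delta> * real t / 2) / a" for t :: nat
  proof -
    have "a * (real t + 1) \<le> 1 + a * real t" using a by (simp add: algebra_simps)
    also have "\<dots> \<le> exp (a * real t)" by (rule exp_ge_add_one_self)
    also have "\<dots> = 2 powr (\<delta> * real t / 2)" by (simp add: powr_def a_def mult_ac)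
    finally show ?thesis using a(1) by (simp add: field_simps)
  qed
  \<comment> \<open>Chosen such that
    \<open>3 * (2 * s + 1)\<^sup>2 \<le> M * 2 powr (\<delta> * t)\<close> for the \<open>s\<close>
    below.\<close>
  define M where "M = 12 * (real K + 1)\<^sup>2 / a\<^sup>2"
  have M: "M \<ge> 1"
  proof -
    have "a\<^sup>2 \<le> 1" using a by (simp add: power_le_one)
    moreover have "1 \<le> (real K + 1)\<^sup>2" by (simp add: one_le_power)
    ultimately have "a\<^sup>2 \<le> 12 * (real K + 1)\<^sup>2" by linarith
    then show ?thesis using a(1) by (simp add: M_def field_simps)
  qed
  define C1 :: real where "C1 = 4 ^ (K + 2)"
  have C1: "C1 \<ge> 1" "real K + 1 \<le> C1"
  proof -
    show "C1 \<ge> 1" unfolding C1_def by (rule one_le_power) simp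
    have "Suc K \<le> 4 ^ Suc K" using less_exp[of "Suc K"] power_mono[of 2 "4::nat" "Suc K"] by linarith
    also have "\<dots> \<le> 4 ^ (K + 2)" by (rule power_increasing) auto
    finally have "real (Suc K) \<le> real (4 ^ (K + 2))" by (rule of_nat_mono)
    then show "real K + 1 \<le> C1" by (simp add: C1_def)
  qed
  define C where "C = 24 * M * C1"
  define e where "e = 1 / 2 - \<delta>"
  have e: "0 < e" "e \<le> 1" using \<delta> by (auto simp: e_def)
  have shrink: "(m / (12 * M)) powr (- e) \<le> 12 * M * m powr (- e)" if m: "m \<ge> 3" for m :: real
  proof -
    have eq: "(m / (12 * M)) powr (- e) = m powr (- e) * (12 * M) powr e"
      using m M by (simp add: powr_divide powr_minus field_simps)
    have "(12 * M) powr e \<le> 12 * M" using powr_mono[of e 1 "12 * M"] e M by simp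
    then have "m powr (- e) * (12 * M) powr e \<le> m powr (- e) * (12 * M)" by (rule mult_left_mono) simp
    with eq show ?thesis by (simp only: mult.commute)
  qed
  have ee: "- 1 / 2 + \<delta> = - e" by (simp add: e_def)
  show ?thesis
  proof (rule that[of C])
    show "C > 0" using M C1 by (simp add: C_def)
    fix r :: nat and m :: real assume m: "m \<ge> 3" "m \<le> 6 * real r"
    \<comment> \<open>The factor 2 makes the size condition strict. If \<open>y < 1\<close>, then
      \<open>m < 12 * M\<close>, and the constant \<open>C\<close> makes the right-hand side at
      least 1.\<close>
    define y where "y = real r / (2 * M)"
    have my: "m / (12 * M) \<le> y" using m M by (simp add: y_def field_simps)
    have m0: "m / (12 * M) > 0" using m M by simp
    show "C * m powr (- 1 / 2 + \<delta>) \<ge> 1 \<or>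
      (\<exists>s t n R. 3 * (2 * s + 1)\<^sup>2 * 2 ^ t < r \<and> s > 0 \<and> 0 \<le> R \<and>
      2 ^ t * (real n * (1 / 2) ^ (s - n)) + (2 powr (- real t / 2)) ^ n \<le> R ^ Suc n \<and>
      4 ^ (n + 2) * 2 powr (- real t * (1 / 2 - (1 / 2) ^ n / 2)) \<le> R \<and>
      R \<le> C * m powr (- 1 / 2 + \<delta>))"
    proof (cases "y < 1")
      case True
      have "1 \<le> (m / (12 * M)) powr (- e)"
        using powr_mono2'[of "- e" "m / (12 * M)" 1] True my m0 e by simp
      also have "\<dots> \<le> 12 * M * m powr (- e)" by (rule shrink[OF m(1)])
      also have "\<dots> \<le> C * m powr (- e)"
      proof (rule mult_right_mono)
        have "12 * M * 1 \<le> 24 * M * C1" by (intro mult_mono) (use M C1 in auto)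
        then show "12 * M \<le> C" by (simp add: C_def)
      qed simp
      finally show ?thesis unfolding ee by (rule disjI1)
    next
      case False
      then have y: "y \<ge> 1" by simp
      \<comment> \<open>Since \<open>x powr (1 + \<delta>) = y\<close>, taking 2^t at most
        \<open>x\<close> leaves room for the factor 2^(\<delta> t).\<close>
      define x where "x = y powr (1 / (1 + \<delta>))"
      have x: "x \<ge> 1" unfolding x_def using y \<delta> by (simp add: ge_one_powr_ge_zero)
      define t where "t = nat \<lfloor>log 2 x\<rfloor>"
      have lx: "log 2 x \<ge> 0" using x by simp
      have t: "real t \<le> log 2 x" "log 2 x < real t + 1" unfolding t_def using lx by linarith+
      \<comment> \<open>This makes \<open>2 ^ t * (1 / 2) ^ (s - K)\<close> equal to
        \<open>2 powr (- t * K)\<close>: even after the union bound the error from Odlyzko's lemma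
        stays below the term from Halasz' inequality.\<close>
      define s where "s = K + t * (K + 1)"
      define R where "R = C1 * 2 powr (- real t * (1 / 2 - \<theta>))"
      have p2: "2 powr real t \<le> x" "x \<le> 2 * 2 powr real t"
      proof -
        have "2 powr real t \<le> 2 powr log 2 x" by (rule powr_mono) (use t in auto)
        then show "2 powr real t \<le> x" using x by simp
        have "2 powr log 2 x \<le> 2 powr (real t + 1)" by (rule powr_mono) (use t in auto)
        then show "x \<le> 2 * 2 powr real t" using x by (simp add: powr_add)
      qed
      have size: "3 * (2 * s + 1)\<^sup>2 * 2 ^ t < r"
      proof -
        have "2 * s + 1 \<le> 2 * (K + 1) * (t + 1)" by (simp add: s_def algebra_simps)
        then have "real (2 * s + 1) \<le> real (2 * (K + 1) * (t + 1))" by (rule of_nat_mono)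
        also have "\<dots> = 2 * (real K + 1) * (real t + 1)" by (simp add: algebra_simps)
        also have "\<dots> \<le> 2 * (real K + 1) * (2 powr (\<delta> * real t / 2) / a)"
          by (rule mult_left_mono[OF poly]) simp
        finally have "(real (2 * s + 1))\<^sup>2 \<le> (2 * (real K + 1) * (2 powr (\<delta> * real t / 2) / a))\<^sup>2"
          by (rule power_mono) simp
        also have "\<dots> = 4 * (real K + 1)\<^sup>2 / a\<^sup>2 * (2 powr (\<delta> * real t / 2))\<^sup>2"
          by (simp only: power_mult_distrib power_divide) simp
        also have "(2 powr (\<delta> * real t / 2))\<^sup>2 = 2 powr (\<delta> * real t)"
          by (simp add: power2_eq_square flip: powr_add)
        finally have "3 * (real (2 * s + 1))\<^sup>2 * 2 powr real t
            \<le> 3 * (4 * (real K + 1)\<^sup>2 / a\<^sup>2 * 2 powr (\<delta> * real t)) * 2 powr real t"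
          by (intro mult_right_mono mult_left_mono) auto
        also have "\<dots> = M * 2 powr (real t * (1 + \<delta>))"
          by (simp add: M_def powr_add distrib_left mult_ac)
        also have "2 powr (real t * (1 + \<delta>)) = (2 powr real t) powr (1 + \<delta>)"
          by (simp add: powr_powr)
        also have "\<dots> \<le> x powr (1 + \<delta>)" by (rule powr_mono2) (use p2 \<delta> in auto)
        also have "\<dots> = y" using y \<delta> by (simp add: x_def powr_powr)
        also have "M * y < real r"
        proof -
          have "r > 0" using y by (cases "r = 0") (auto simp: y_def)
          then show ?thesis using M by (simp add: y_def)
        qed
        finally have "3 * (real (2 * s + 1))\<^sup>2 * 2 powr real t < real r" using M by simp
        then have "real (3 * (2 * s + 1)\<^sup>2 * 2 ^ t) < real r" by (simp add: powr_realpow)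
        then show ?thesis by (simp only: of_nat_less_iff)
      qed
      have K1: "(real K + 1) * (1 / 2 - \<theta>) = real K / 2"
        by (simp add: \<theta>_def field_simps)
      have b1: "2 ^ t * (real K * (1 / 2) ^ (s - K)) + (2 powr (- real t / 2)) ^ K \<le> R ^ Suc K"
      proof -
        have e1: "(2 powr (- real t / 2)) ^ K = 2 powr (- (real t * real K / 2))"
          by (simp add: powr_power mult.commute)
        have "2 ^ t * (1 / 2 :: real) ^ (s - K) = 2 powr (- (real t * real K))"
        proof -
          have "(2::real) ^ (s - K) = 2 ^ t * 2 ^ (t * K)"
            by (simp add: s_def distrib_left power_add mult.commute)
          then show ?thesis
            by (simp add: power_one_over powr_minus powr_realpow[symmetric] inverse_eq_divide)
        qed
        also have "\<dots> \<le> 2 powr (- (real t * real K / 2))" by simp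
        finally have "real K * (2 ^ t * (1 / 2 :: real) ^ (s - K)) \<le> real K * 2 powr (- (real t * real K / 2))"
          by (rule mult_left_mono) simp
        then have "2 ^ t * (real K * (1 / 2) ^ (s - K)) + (2 powr (- real t / 2)) ^ K
            \<le> (real K + 1) * 2 powr (- (real t * real K / 2))"
          unfolding e1 by (simp add: algebra_simps)
        also have "\<dots> \<le> C1 ^ Suc K * 2 powr (- (real t * real K / 2))"
        proof (rule mult_right_mono)
          have "C1 ^ 1 \<le> C1 ^ Suc K" by (rule power_increasing) (use C1 in auto)
          then show "real K + 1 \<le> C1 ^ Suc K" using C1(2) unfolding power_one_right by linarith
        qed simp
        also have "2 powr (- (real t * real K / 2)) = (2 powr (- real t * (1 / 2 - \<theta>))) ^ Suc K"
        proof -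
          have "- real t * (1 / 2 - \<theta>) * real (Suc K) = - (real t * ((real K + 1) * (1 / 2 - \<theta>)))"
            by (simp add: algebra_simps)
          also have "\<dots> = - (real t * real K / 2)" unfolding K1 by simp
          finally have "- real t * (1 / 2 - \<theta>) * real (Suc K) = - (real t * real K / 2)" .
          moreover have "(2 powr (- real t * (1 / 2 - \<theta>))) ^ Suc K = 2 powr (- real t * (1 / 2 - \<theta>) * real (Suc K))"
            by (simp only: powr_realpow[symmetric] powr_powr powr_gt_zero zero_neq_numeral simp_thms)
          ultimately show ?thesis by (simp only:)
        qed
        finally show ?thesis by (simp only: R_def power_mult_distrib)
      qed
      have b2: "4 ^ (K + 2) * 2 powr (- real t * (1 / 2 - (1 / 2) ^ K / 2)) \<le> R"
      proof -
        have "K + 1 \<le> 2 ^ K" using Suc_leI[OF less_exp[of K]] unfolding Suc_eq_plus1 .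
        then have "real (K + 1) \<le> real (2 ^ K)" by (rule of_nat_mono)
        then have "(1 / 2) ^ K / 2 \<le> \<theta>"
          by (simp add: \<theta>_def power_one_over field_simps)
        then have "real t * (1 / 2 - \<theta>) \<le> real t * (1 / 2 - (1 / 2) ^ K / 2)"
          by (intro mult_left_mono) auto
        then show ?thesis unfolding R_def C1_def by (intro mult_left_mono) auto
      qed
      have half: "(x / 2) powr (- d) = x powr (- d) * 2 powr d" for d
        using x by (simp add: powr_divide powr_minus field_simps)
      have "R \<le> C * m powr (- e)"
      proof -
        have "2 powr (- real t * (1 / 2 - \<theta>)) = (2 powr real t) powr (- (1 / 2 - \<theta>))"
          by (simp only: powr_powr mult_minus_left mult_minus_right)
        also have "\<dots> \<le> (x / 2) powr (- (1 / 2 - \<theta>))"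
          using powr_mono2'[of "- (1 / 2 - \<theta>)" "x / 2" "2 powr real t"] p2 x \<theta> \<delta> by simp
        also have "\<dots> = x powr (- (1 / 2 - \<theta>)) * 2 powr (1 / 2 - \<theta>)"
          by (rule half)
        also have "\<dots> \<le> y powr (- e) * 2"
        proof (rule mult_mono)
          have "e * (1 + \<delta>) \<le> 1 / 2 - \<theta>"
          proof -
            have "e * (1 + \<delta>) = 1 / 2 - \<delta> / 2 - \<delta> * \<delta>" by (simp add: e_def field_simps)
            also have "\<dots> \<le> 1 / 2 - \<theta>" using \<theta>(2) zero_le_square[of \<delta>] by linarith
            finally show ?thesis .
          qed
          then have "e \<le> (1 / 2 - \<theta>) / (1 + \<delta>)" using \<delta> by (simp add: field_simps)
          moreover have "x powr (- (1 / 2 - \<theta>)) = y powr (- ((1 / 2 - \<theta>) / (1 + \<delta>)))"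
            by (simp only: x_def powr_powr times_divide_eq_left mult_1 minus_divide_left)
          ultimately show "x powr (- (1 / 2 - \<theta>)) \<le> y powr (- e)"
            using y by (simp add: powr_mono)
          have "2 powr (1 / 2 - \<theta>) \<le> 2 powr 1" by (rule powr_mono) (use \<theta> in auto)
          then show "2 powr (1 / 2 - \<theta>) \<le> 2" by simp
        qed auto
        also have "y powr (- e) \<le> (m / (12 * M)) powr (- e)"
          using powr_mono2'[of "- e" "m / (12 * M)" y] my m0 e by simp
        also have "\<dots> \<le> 12 * M * m powr (- e)" by (rule shrink[OF m(1)])
        finally have "2 powr (- real t * (1 / 2 - \<theta>)) \<le> 12 * M * m powr (- e) * 2" by simp
        then have "R \<le> C1 * (12 * M * m powr (- e) * 2)"
          unfolding R_def using C1 by (intro mult_left_mono) auto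
        then show ?thesis by (simp add: C_def mult_ac)
      qed
      moreover have "0 \<le> R" using C1 by (simp add: R_def)
      moreover have "s > 0" using K by (simp add: s_def)
      ultimately show ?thesis using size b1 b2 unfolding ee by blast
    qed
  qed
qed

theorem corollary1:
  fixes \<delta> :: real
  assumes "\<delta> > 0"
  shows "\<exists>C :: real. \<forall>(n :: nat) (m :: real) (A :: complex mat) (l :: complex Matrix.vec).
    n \<ge> 1 \<longrightarrow> m \<ge> 3 * exp (ln (real n) powr (1/4)) \<longrightarrow>
    A \<in> carrier_mat n n \<longrightarrow> transpose_mat A = A \<longrightarrow>
    real (card (nonzero_entries A)) \<ge> m * real n \<longrightarrow>
    l \<in> carrier_vec n \<longrightarrow>
    (SUP c :: complex. measure_pmf.prob (rademacher_vec n)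
        {x. quadratic_form A x = linear_form l x + c}) \<le> C * m powr (- 1/2 + \<delta>)"
proof -
  have "\<exists>C. \<forall>(n::nat) (m::real) (A :: complex mat) (l :: complex Matrix.vec) c.
    n \<ge> 1 \<longrightarrow> m \<ge> 3 \<longrightarrow> A \<in> carrier_mat n n \<longrightarrow> transpose_mat A = A \<longrightarrow>
    real (card (nonzero_entries A)) \<ge> m * real n \<longrightarrow> l \<in> carrier_vec n \<longrightarrow>
    measure_pmf.prob (rademacher_vec n) {x. quadratic_form A x = linear_form l x + c} \<le> C * m powr (- 1/2 + \<delta>)"
  proof (cases "\<delta> < 1 / 2")
    \<comment> \<open>The exponent is nonnegative, so the bound is at least 1.\<close>
    case False
    have "measure_pmf.prob p X \<le> 1 * m powr (- 1/2 + \<delta>)" if "m \<ge> 3" for p :: "complex Matrix.vec pmf" and X m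
    proof -
      have "1 \<le> m powr (- 1/2 + \<delta>)" using False that by (intro ge_one_powr_ge_zero) auto
      then show ?thesis using measure_pmf.prob_le_1[of p X] by linarith
    qed
    then show ?thesis by blast
  next
    case True
    obtain C where C: "C > 0" "\<And>(r::nat) m :: real. m \<ge> 3 \<Longrightarrow> m \<le> 6 * real r \<Longrightarrow>
      C * m powr (- 1 / 2 + \<delta>) \<ge> 1 \<or>
      (\<exists>s t n R. 3 * (2 * s + 1)\<^sup>2 * 2 ^ t < r \<and> s > 0 \<and> 0 \<le> R \<and>
        2 ^ t * (real n * (1 / 2) ^ (s - n)) + (2 powr (- real t / 2)) ^ n \<le> R ^ Suc n \<and>
        4 ^ (n + 2) * 2 powr (- real t * (1 / 2 - (1 / 2) ^ n / 2)) \<le> R \<and>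
        R \<le> C * m powr (- 1 / 2 + \<delta>))"
      using parameters_exist[OF assms True] by metis
    show ?thesis
    proof (intro exI[of _ C] allI impI)
      fix n :: nat and m :: real and A :: "complex mat" and l :: "complex Matrix.vec" and c :: complex
      assume n: "n \<ge> 1" and m: "m \<ge> 3" and A: "A \<in> carrier_mat n n" "transpose_mat A = A"
        and nz: "real (card (nonzero_entries A)) \<ge> m * real n" and l: "l \<in> carrier_vec n"
      define b where "b = (\<lambda>i j. A $$ (i, j))"
      have sym: "sym_on {..<n} b"
        unfolding sym_on_def b_def
      proof (intro ballI)
        fix i j assume "i \<in> {..<n}" "j \<in> {..<n}"
        then have "transpose_mat A $$ (i, j) = A $$ (j, i)" using A(1) by (intro index_transpose_mat) auto
        then show "A $$ (i, j) = A $$ (j, i)" by (simp only: A(2))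
      qed
      have "nonzero_entries A = {(i, j). i < n \<and> j < n \<and> b i j \<noteq> 0}"
        using A(1) by (auto simp: nonzero_entries_def b_def)
      with nz have "real (card {(i, j). i < n \<and> j < n \<and> b i j \<noteq> 0}) \<ge> m * real n" by simp
      then obtain r and p q :: "nat \<Rightarrow> nat" where pq: "inj_on p {..<r}" "inj_on q {..<r}"
        "p ` {..<r} \<inter> q ` {..<r} = {}" "\<And>i. i < r \<Longrightarrow> p i < n \<and> q i < n \<and> b (p i) (q i) \<noteq> 0"
        and mr: "m \<le> 1 + 4 * real r"
        by (rule exists_matching[OF n _ sym]) auto
      \<comment> \<open>For \<open>m \<ge> 3\<close> the diagonal is absorbed by the larger factor:
        \<open>6 * r \<ge> 3 / 2 * (m - 1) \<ge> m\<close>.\<close>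
      have mr6: "m \<le> 6 * real r" using mr m by linarith
      define P where "P = pr {..<n} (\<lambda>x. qf {..<n} b (\<lambda>i. - l $ i) (- c) x = 0)"
      have "measure_pmf.prob (rademacher_vec n) {x. quadratic_form A x = linear_form l x + c} = P"
        unfolding rademacher_vec_prob quadratic_form_eq_qf[OF A(1) l] P_def b_def ..
      also have "P \<le> C * m powr (- 1/2 + \<delta>)"
        using C(2)[OF m mr6]
      proof (elim disjE exE conjE)
        assume "1 \<le> C * m powr (- 1 / 2 + \<delta>)"
        moreover have "P \<le> 1" unfolding P_def by (rule pr_le_one) simp
        ultimately show ?thesis by linarith
      next
        fix s t k R
        assume R: "3 * (2 * s + 1)\<^sup>2 * 2 ^ t < r" "s > 0" "0 \<le> R"
          "2 ^ t * (real k * (1 / 2) ^ (s - k)) + (2 powr (- real t / 2)) ^ k \<le> R ^ Suc k"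
          "4 ^ (k + 2) * 2 powr (- real t * (1 / 2 - (1 / 2) ^ k / 2)) \<le> R"
          "R \<le> C * m powr (- 1 / 2 + \<delta>)"
        have "P \<le> R"
          unfolding P_def
          by (rule pr_quadratic_matching_le[OF _ sym pq(1-3) _ R(1-5)]) (use pq(4) in auto)
        then show ?thesis using R(6) by linarith
      qed
      finally show "measure_pmf.prob (rademacher_vec n) {x. quadratic_form A x = linear_form l x + c}
        \<le> C * m powr (- 1/2 + \<delta>)" .
    qed
  qed
  then obtain C where C: "\<And>(n::nat) (m::real) (A :: complex mat) (l :: complex Matrix.vec) c.
    n \<ge> 1 \<Longrightarrow> m \<ge> 3 \<Longrightarrow> A \<in> carrier_mat n n \<Longrightarrow> transpose_mat A = A \<Longrightarrow>
    real (card (nonzero_entries A)) \<ge> m * real n \<Longrightarrow> l \<in> carrier_vec n \<Longrightarrow>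
    measure_pmf.prob (rademacher_vec n) {x. quadratic_form A x = linear_form l x + c} \<le> C * m powr (- 1/2 + \<delta>)"
    by blast
  show ?thesis
  proof (intro exI[of _ C] allI impI)
    fix n :: nat and m :: real and A :: "complex mat" and l :: "complex Matrix.vec"
    assume "n \<ge> 1" "A \<in> carrier_mat n n" "transpose_mat A = A"
      "real (card (nonzero_entries A)) \<ge> m * real n" "l \<in> carrier_vec n"
      and m: "m \<ge> 3 * exp (ln (real n) powr (1/4))"
    moreover have "m \<ge> 3" using m exp_ge_add_one_self[of "ln (real n) powr (1/4)"]
      powr_ge_zero[of "ln (real n)" "1/4"] by linarith
    ultimately show "(SUP c. measure_pmf.prob (rademacher_vec n)
        {x. quadratic_form A x = linear_form l x + c}) \<le> C * m powr (- 1/2 + \<delta>)"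
      by (intro cSUP_least C) auto
  qed
qed

end
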